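(* Let $m\ge 2$ and let $I_k=[a_k,b_k]\subset[0,1]$, $k=1,\dots,m$, be segments of positive length with $a_1=0$, $b_m=1$ and $b_{k-1}<a_k$ for $k=2,\dots,m$. Let $\rho_1,\dots,\rho_m>0$ satisfy $\sum_{k=1}^m\rho_k=1$, and suppose that there is a constant $\tau$ such that $\rho_k(b_k-a_k)=\tau$ for all $k=1,\dots,m$. Let $\rho$ be the self-similar probability measure on $[0,1]$ which is the distributional derivative of the generalized Cantor ladder with these parameters. Put $\nu=-\ln\tau$ and let $D$ be defined by $\tau^{-D}=m$ (so that $D\in(0,\tfrac12)$). Let $N(\lambda)$ be the eigenvalue counting function of the Neumann problem $$-y''-\lambda\rho y=0,\qquad y'(0)=y'(1)=0,$$ and let $s$ be the continuous $\nu$-periodic function on $\mathbb R$ for which $$N(\lambda)=\lambda^{D}\cdot\bigl(s(\ln\lambda)+o(1)\bigr),\qquad \lambda\to+\infty .$$ Then there exists a purely singular non-decreasing function $\sigma$ on $[0,\nu]$ such that $$s(t)=e^{-Dt}\,\sigma(t)\qquad\text{for all } t\in[0,\nu].$$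
   Context: Generalized Cantor ladder: let $S_k(t)=a_k+(b_k-a_k)t$ be the orientation-preserving affine contraction of $[0,1]$ onto $I_k$. The operator $$\mathcal S(f)=\sum_{k=1}^m\left(\chi_{I_k}\,(f\circ S_k^{-1})+\chi_{\{x>b_k\}}\right)\rho_k$$ is a contraction on $L_\infty(0,1)$; its unique fixed point $C$ (which has a continuous, non-decreasing representative with $C(0)=0$, $C(1)=1$) is called the generalized Cantor ladder with $m$ steps. Its distributional derivative $\rho$ is a probability measure without atoms, singular with respect to Lebesgue measure, satisfying $\rho(E)=\sum_{k=1}^m\rho_k\,\rho\bigl(S_k^{-1}(E\cap I_k)\bigr)$ for Borel sets $E\subset[0,1]$. Neumann problem: $\lambda$ is an eigenvalue if there is a nonzero $y\in W_2^1[0,1]$ (Sobolev space) with $$\int_0^1 y'\eta'\,dx=\lambda\int_0^1 y\,\eta\;\rho(dx)\qquad\text{for all }\eta\in W_2^1[0,1].$$ The eigenvalues are simple and form an increasing sequence $0=\lambda_0<\lambda_1<\lambda_2<\dots\to+\infty$. The counting function is $N(\lambda)=\#\{n\ge 0:\lambda_n\le\lambda\}$. The existence of the continuous $\nu$-periodic function $s$ in the stated asymptotics is a known result (Solomyak–Verbitsky, Kigami–Lapidus); $s$ is uniquely determined by the asymptotics. A non-decreasing function on an interval is called purely singular if its derivative equals zero almost everywhere with respect to Lebesgue measure (equivalently, its associated Lebesgue–Stieltjes measure is singular with respect to Lebesgue measure). *)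

theory Defs
  imports "HOL-Probability.Probability"
begin

definition affine_map :: "real \<Rightarrow> real \<Rightarrow> real \<Rightarrow> real" where
  "affine_map p q t = p + (q - p) * t"

definition ladder_operator ::
  "nat \<Rightarrow> (nat \<Rightarrow> real) \<Rightarrow> (nat \<Rightarrow> real) \<Rightarrow> (nat \<Rightarrow> real) \<Rightarrow> (real \<Rightarrow> real) \<Rightarrow> real \<Rightarrow> real" where
  "ladder_operator m a b w f x =
     (\<Sum>k = 1..m. (indicator {a k..b k} x * f (inv (affine_map (a k) (b k)) x)
                  + indicator {x. x > b k} x) * w k)"

(* Elements of Lebesgue spaces on (0,1) are given by representatives; equality in
   L_infinity is equality almost everywhere, and values outside (0,1) are irrelevant. *)

definition L_infinity :: "(real \<Rightarrow> real) \<Rightarrow> bool" where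
  "L_infinity f \<longleftrightarrow>
     f \<in> borel_measurable (lebesgue_on {0<..<1}) \<and>
     (\<exists>B. AE x in lebesgue_on {0<..<1}. \<bar>f x\<bar> \<le> B)"

definition L_2 :: "(real \<Rightarrow> real) \<Rightarrow> bool" where
  "L_2 f \<longleftrightarrow>
     f \<in> borel_measurable (lebesgue_on {0<..<1}) \<and>
     integrable (lebesgue_on {0<..<1}) (\<lambda>x. (f x)\<^sup>2)"

definition cantor_ladder ::
  "nat \<Rightarrow> (nat \<Rightarrow> real) \<Rightarrow> (nat \<Rightarrow> real) \<Rightarrow> (nat \<Rightarrow> real) \<Rightarrow> (real \<Rightarrow> real) \<Rightarrow> bool" where
  "cantor_ladder m a b w C \<longleftrightarrow>
     L_infinity C \<and>
     (AE x in lebesgue_on {0<..<1}. ladder_operator m a b w C x = C x)"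

definition test_function :: "(real \<Rightarrow> real) \<Rightarrow> bool" where
  "test_function \<phi> \<longleftrightarrow>
     (\<forall>n x. ((deriv ^^ n) \<phi>) field_differentiable (at x)) \<and>
     (\<exists>c d. 0 < c \<and> d < 1 \<and> (\<forall>x. x \<notin> {c..d} \<longrightarrow> \<phi> x = 0))"

(* Test functions do not see the endpoints 0 and 1. A probability measure that is the
   distributional derivative of the ladder is nevertheless unique: the ladder increases
   by 1 over (0,1), which leaves no mass for the endpoints. *)

definition distributional_derivative :: "(real \<Rightarrow> real) \<Rightarrow> real measure \<Rightarrow> bool" where
  "distributional_derivative f M \<longleftrightarrow>
     (\<forall>\<phi>. test_function \<phi> \<longrightarrow>
        (\<integral>x. f x * deriv \<phi> x \<partial>lebesgue_on {0<..<1}) = - (\<integral>x. \<phi> x \<partial>M))"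

definition weak_derivative :: "(real \<Rightarrow> real) \<Rightarrow> (real \<Rightarrow> real) \<Rightarrow> bool" where
  "weak_derivative f g \<longleftrightarrow>
     (\<forall>\<phi>. test_function \<phi> \<longrightarrow>
        (\<integral>x. f x * deriv \<phi> x \<partial>lebesgue_on {0<..<1}) =
        - (\<integral>x. g x * \<phi> x \<partial>lebesgue_on {0<..<1}))"

(* sobolev y y' says that y is the continuous representative of an element of W_2^1[0,1]
   and y' is a representative of its weak derivative. The continuous representative is
   needed because y is integrated against measures singular to Lebesgue measure. *)

definition sobolev :: "(real \<Rightarrow> real) \<Rightarrow> (real \<Rightarrow> real) \<Rightarrow> bool" where
  "sobolev y y' \<longleftrightarrow> continuous_on {0..1} y \<and> L_2 y' \<and> weak_derivative y y'"

definition neumann_eigenvalue :: "real measure \<Rightarrow> real \<Rightarrow> bool" where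
  "neumann_eigenvalue M \<mu> \<longleftrightarrow>
     (\<exists>y y'. sobolev y y' \<and> (\<exists>x\<in>{0..1}. y x \<noteq> 0) \<and>
        (\<forall>\<eta> \<eta>'. sobolev \<eta> \<eta>' \<longrightarrow>
           (\<integral>x. y' x * \<eta>' x \<partial>lebesgue_on {0<..<1}) = \<mu> * (\<integral>x. y x * \<eta> x \<partial>M)))"

(* The eigenvalues are simple, so counting the set of eigenvalues is the same as
   counting the terms of their increasing enumeration, which tends to infinity (so the
   set below is finite). *)

definition counting_function :: "real measure \<Rightarrow> real \<Rightarrow> nat" where
  "counting_function M l = card {\<mu>. neumann_eigenvalue M \<mu> \<and> \<mu> \<le> l}"

definition purely_singular_on :: "real set \<Rightarrow> (real \<Rightarrow> real) \<Rightarrow> bool" where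
  "purely_singular_on S f \<longleftrightarrow>
     mono_on S f \<and> (AE t in lebesgue_on S. (f has_real_derivative 0) (at t within S))"

end

(*
Let lam 0 < lam 1 < ... be the eigenvalues, u n the orthonormal eigenfunctions, and put
F(x) = x^D s(ln x) = lim_k N(x tau^-k) / m^k, so that sigma(t) = F(e^t) is non-decreasing.
Restricting to the segments I_k gives lam (n div m) <= tau * lam n, i.e. N(x/tau) <= m N(x).
Conversely, transplant u j, j < M, into every I_k, with linear ramps to 0 in the adjacent gaps.
This gives mM orthonormal functions, and Ky Fan's principle bounds the sum of
tau * lam n - lam (n div m) over n < mM by a constant times the sum of u_j(0)^2 + u_j(1)^2 over
j < M. For every p that sum is O(w^-p + r^p lam (M - 1)), because the p-th level segment at an end
point has length r^p and mass w^p. As tau = w r, the set of x in [1, 1/tau] with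
N(x tau^-(k+1)) different from m N(x tau^-k) has measure O(r^k). By Borel-Cantelli,
N(x tau^-k) / m^k is eventually constant for almost every x, so F takes values in the countable
set of numbers n/m^k almost everywhere; a monotone function with this property is purely singular.
*)

theory Submission
  imports Defs "HOL-Complex_Analysis.Complex_Analysis" "HOL-Library.Function_Algebras"
begin

section \<open>Semi-inner products and variational principles\<close>

text \<open>The interval [tau^k lam (n div m), tau^(k+1) lam n) consists of exactly those x for
  which the index n is counted by m N(x tau^-k) but not by N(x tau^-(k+1)). So the bad set of level
  k has measure at most tau^k times the sum of the gaps, and no single eigenvalue has to be bounded
  from above; this is why a trace inequality such as Ky Fan's fits. The choice p = k balances the
  boundary terms: tau^k w^-k = r^k, and lam (M - 1) <= tau^-(k+1) in the relevant range. The measure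
  is given only through the ladder, and the eigenvalues only through weak derivatives of
  representatives. Hence the self-similarity of integrals is first derived from the fixed point
  equation, and the eigenfunctions are built among continuous functions, where the forms are merely
  semidefinite and nothing is complete. Since N counts a set of numbers, the constructed eigenvalues
  must also be shown to be distinct and to exhaust that set.\<close>

locale semi_inner =
  fixes H :: "'v::real_vector set" and ip :: "'v \<Rightarrow> 'v \<Rightarrow> real"
  assumes subspace_H: "subspace H"
    and ip_add_left: "\<lbrakk>x \<in> H; y \<in> H; z \<in> H\<rbrakk> \<Longrightarrow> ip (x + y) z = ip x z + ip y z"
    and ip_scale_left: "\<lbrakk>x \<in> H; z \<in> H\<rbrakk> \<Longrightarrow> ip (c *\<^sub>R x) z = c * ip x z"
    and ip_sym: "\<lbrakk>x \<in> H; y \<in> H\<rbrakk> \<Longrightarrow> ip x y = ip y x"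
    and ip_nonneg: "x \<in> H \<Longrightarrow> 0 \<le> ip x x"
begin

lemma H_add [intro]: "\<lbrakk>x \<in> H; y \<in> H\<rbrakk> \<Longrightarrow> x + y \<in> H"
  and H_scale [intro]: "x \<in> H \<Longrightarrow> c *\<^sub>R x \<in> H"
  and H_diff [intro]: "\<lbrakk>x \<in> H; y \<in> H\<rbrakk> \<Longrightarrow> x - y \<in> H"
  and H_zero [intro]: "0 \<in> H"
  and H_sum: "(\<And>i. i \<in> I \<Longrightarrow> g i \<in> H) \<Longrightarrow> sum g I \<in> H"
  using subspace_H by (auto simp: subspace_add subspace_scale subspace_diff subspace_0 subspace_sum)

lemma ip_add_right: "\<lbrakk>x \<in> H; y \<in> H; z \<in> H\<rbrakk> \<Longrightarrow> ip z (x + y) = ip z x + ip z y"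
  by (metis H_add ip_add_left ip_sym)

lemma ip_scale_right: "\<lbrakk>x \<in> H; z \<in> H\<rbrakk> \<Longrightarrow> ip z (c *\<^sub>R x) = c * ip z x"
  by (metis H_scale ip_scale_left ip_sym)

lemma ip_diff_left: "\<lbrakk>x \<in> H; y \<in> H; z \<in> H\<rbrakk> \<Longrightarrow> ip (x - y) z = ip x z - ip y z"
  by (metis H_diff diff_add_cancel ip_add_left add_diff_cancel_right')

lemma ip_diff_right: "\<lbrakk>x \<in> H; y \<in> H; z \<in> H\<rbrakk> \<Longrightarrow> ip z (x - y) = ip z x - ip z y"
  by (metis H_diff ip_diff_left ip_sym)

lemma ip_zero_left: "z \<in> H \<Longrightarrow> ip 0 z = 0"
  using ip_scale_left[of 0 z 0] H_zero by simp

lemma ip_sum_left: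
  assumes "\<And>i. i \<in> I \<Longrightarrow> g i \<in> H" "z \<in> H"
  shows "ip (sum g I) z = (\<Sum>i\<in>I. ip (g i) z)"
  using assms
  by (induction I rule: infinite_finite_induct) (auto simp: ip_zero_left ip_add_left H_sum)

lemma ip_sum_right:
  assumes "\<And>i. i \<in> I \<Longrightarrow> g i \<in> H" "z \<in> H"
  shows "ip z (sum g I) = (\<Sum>i\<in>I. ip z (g i))"
proof -
  have "ip z (sum g I) = (\<Sum>i\<in>I. ip (g i) z)"
    using ip_sum_left[OF assms] ip_sym[of z "sum g I"] H_sum[of I g] assms by simp
  also have "\<dots> = (\<Sum>i\<in>I. ip z (g i))"
    using assms by (intro sum.cong refl ip_sym) auto
  finally show ?thesis .
qed

lemmas ip_simps = ip_add_left ip_add_right ip_scale_left ip_scale_right ip_diff_left ip_diff_right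

lemma cauchy_schwarz:
  assumes "x \<in> H" "y \<in> H"
  shows "(ip x y)\<^sup>2 \<le> ip x x * ip y y"
proof -
  have pos: "0 \<le> ip x x - 2 * t * ip x y + t\<^sup>2 * ip y y" for t
  proof -
    have "0 \<le> ip (x - t *\<^sub>R y) (x - t *\<^sub>R y)"
      using assms by (intro ip_nonneg H_diff H_scale)
    also have "\<dots> = ip x x - 2 * t * ip x y + t\<^sup>2 * ip y y"
      using assms by (simp add: ip_simps H_scale H_diff ip_sym[of y x] power2_eq_square algebra_simps)
    finally show ?thesis .
  qed
  show ?thesis
  proof (cases "ip y y = 0")
    case True
    have "ip x y = 0"
    proof (rule ccontr)
      assume n: "ip x y \<noteq> 0"
      \<comment> \<open>With \<open>ip y y = 0\<close> the inequality \<open>pos\<close> is affine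
        in t, and this t turns its right-hand side into -1.\<close>
      show False
        using pos[of "(ip x x + 1) / (2 * ip x y)"] n True by (simp add: field_simps)
    qed
    then show ?thesis using True by simp
  next
    case False
    then have "ip y y > 0" using ip_nonneg[OF assms(2)] by simp
    then show ?thesis
      using pos[of "ip x y / ip y y"] by (simp add: field_simps power2_eq_square)
  qed
qed

definition nrm :: "'v \<Rightarrow> real" where "nrm x = sqrt (ip x x)"

lemma nrm_nonneg: "x \<in> H \<Longrightarrow> 0 \<le> nrm x"
  and nrm_sq: "x \<in> H \<Longrightarrow> (nrm x)\<^sup>2 = ip x x"
  by (simp_all add: nrm_def ip_nonneg)

lemma ip_le_nrm: "\<lbrakk>x \<in> H; y \<in> H\<rbrakk> \<Longrightarrow> \<bar>ip x y\<bar> \<le> nrm x * nrm y"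
  using real_sqrt_le_mono[OF cauchy_schwarz[of x y]] by (simp add: nrm_def real_sqrt_mult)

lemma nrm_triangle:
  assumes "x \<in> H" "y \<in> H"
  shows "nrm (x + y) \<le> nrm x + nrm y"
proof (rule power2_le_imp_le)
  show "(nrm (x + y))\<^sup>2 \<le> (nrm x + nrm y)\<^sup>2"
    using assms ip_le_nrm[of x y]
    by (simp add: power2_sum nrm_sq H_add ip_simps ip_sym[of y x])
qed (use assms nrm_nonneg in auto)

lemma nrm_scale: "x \<in> H \<Longrightarrow> nrm (c *\<^sub>R x) = \<bar>c\<bar> * nrm x"
  by (simp add: nrm_def ip_simps H_scale real_sqrt_mult flip: mult.assoc)

lemma nrm_minus: "\<lbrakk>x \<in> H; y \<in> H\<rbrakk> \<Longrightarrow> nrm (x - y) = nrm (y - x)"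
  using nrm_scale[OF H_diff, of x y "-1"] by simp

text \<open>A maximizing sequence satisfies \<open>|K h - \<mu> h| \<rightarrow> 0\<close> because \<open>|K h|\<^sup>2 \<le> \<mu> (K h, h)\<close>; the limit
  provided by compactness lies in \<open>H\<close>, so no completion of \<open>H\<close> is needed.\<close>

lemma compact_operator_max:
  fixes K :: "'v \<Rightarrow> 'v"
  assumes KH: "\<And>x. x \<in> H \<Longrightarrow> K x \<in> H"
    and K_add: "\<And>x y. \<lbrakk>x \<in> H; y \<in> H\<rbrakk> \<Longrightarrow> K (x + y) = K x + K y"
    and K_scale: "\<And>x c. x \<in> H \<Longrightarrow> K (c *\<^sub>R x) = c *\<^sub>R K x"
    and K_sym: "\<And>x y. \<lbrakk>x \<in> H; y \<in> H\<rbrakk> \<Longrightarrow> ip (K x) y = ip x (K y)"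
    and K_pos: "\<And>x. x \<in> H \<Longrightarrow> 0 \<le> ip (K x) x"
    and K_bound: "\<And>x. x \<in> H \<Longrightarrow> ip (K x) (K x) \<le> ip x x"
    and K_compact: "\<And>h. (\<And>n. h n \<in> H \<and> ip (h n) (h n) \<le> 1) \<Longrightarrow>
          \<exists>f\<in>H. \<exists>r. strict_mono (r :: nat \<Rightarrow> nat) \<and>
            (\<lambda>n. ip (K (h (r n)) - f) (K (h (r n)) - f)) \<longlonglongrightarrow> 0"
    and nontriv: "\<exists>h\<in>H. 0 < ip (K h) h"
  shows "\<exists>f\<in>H. \<exists>\<mu>>0. ip f f = 1 \<and> ip (K f - \<mu> *\<^sub>R f) (K f - \<mu> *\<^sub>R f) = 0 \<and>
           (\<forall>h\<in>H. ip (K h) h \<le> \<mu> * ip h h)"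
proof -
  define X where "X = (\<lambda>h. ip (K h) h) ` {h \<in> H. ip h h \<le> 1}"
  define \<mu> where "\<mu> = Sup X"
  have Kdiff: "K (x - y) = K x - K y" if "x \<in> H" "y \<in> H" for x y
    by (metis H_diff K_add add_diff_cancel_right' diff_add_cancel that)
  have nK: "nrm (K x) \<le> nrm x" if "x \<in> H" for x
    by (simp add: nrm_def K_bound that)
  have "ip (K h) h \<le> 1" if "h \<in> H" "ip h h \<le> 1" for h
  proof -
    have h1: "nrm h \<le> 1" using that by (simp add: nrm_def)
    have "ip (K h) h \<le> nrm (K h) * nrm h" using ip_le_nrm[OF KH[OF that(1)] that(1)] by simp
    also have "\<dots> \<le> 1 * 1"
      using nK[OF that(1)] h1 nrm_nonneg that KH by (intro mult_mono) auto
    finally show ?thesis by simp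
  qed
  then have bdd: "bdd_above X" unfolding X_def by (intro bdd_aboveI[of _ 1]) auto
  have null: "ip (K h) h = 0" if "h \<in> H" "ip h h = 0" for h
    using cauchy_schwarz[OF KH[OF that(1)] that(1)] that by simp
  have up: "ip (K h) h \<le> \<mu> * ip h h" if h: "h \<in> H" for h
  proof (cases "ip h h = 0")
    case False
    then have p: "0 < nrm h" using ip_nonneg[OF h] by (simp add: nrm_def)
    let ?g = "(1 / nrm h) *\<^sub>R h"
    have gg: "ip ?g ?g = 1" using h p False
      by (simp add: ip_simps H_scale nrm_sq[OF h, symmetric] power2_eq_square)
    have "ip (K ?g) ?g \<le> \<mu>"
      unfolding \<mu>_def X_def using bdd h gg by (intro cSup_upper) (auto simp: X_def)
    moreover have "ip (K ?g) ?g = ip (K h) h / (nrm h)\<^sup>2"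
      using h p by (simp add: K_scale ip_simps H_scale KH power2_eq_square)
    moreover have "0 < ip h h" using p nrm_sq[OF h] by (metis zero_less_power)
    ultimately show ?thesis using nrm_sq[OF h] by (simp add: pos_divide_le_eq)
  qed (use null h in simp)
  have mu: "0 < \<mu>"
  proof -
    obtain h where h: "h \<in> H" "0 < ip (K h) h" using nontriv by blast
    then show ?thesis using up[OF h(1)] ip_nonneg[OF h(1)]
      by (smt (verit) mult_nonpos_nonneg)
  qed
  have Ksq: "ip (K h) (K h) \<le> \<mu> * ip (K h) h" if h: "h \<in> H" for h
  proof -
    \<comment> \<open>Cauchy-Schwarz for the form (K x, y), applied to h and K h, gives |K h|^4 <=
      (K h, h) (K K h, K h), and the last factor is at most mu |K h|^2.\<close>
    interpret B: semi_inner H "\<lambda>x y. ip (K x) y"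
    proof
      show "ip (K x) y = ip (K y) x" if "x \<in> H" "y \<in> H" for x y
        using that K_sym[of x y] ip_sym[of x "K y"] KH by auto
    qed (use KH K_add K_scale K_pos subspace_H ip_simps in auto)
    have "(ip (K h) (K h))\<^sup>2 \<le> ip (K h) h * ip (K (K h)) (K h)"
      using B.cauchy_schwarz[OF h KH[OF h]] .
    also have "\<dots> \<le> ip (K h) h * (\<mu> * ip (K h) (K h))"
      using up[OF KH[OF h]] K_pos[OF h] by (intro mult_left_mono)
    finally have "ip (K h) (K h) * ip (K h) (K h) \<le> (\<mu> * ip (K h) h) * ip (K h) (K h)"
      by (simp add: power2_eq_square algebra_simps)
    then show ?thesis
      using ip_nonneg[OF KH[OF h]] K_pos[OF h] mu
      by (cases "ip (K h) (K h) = 0") (auto simp: mult_le_cancel_right)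
  qed
  have "\<exists>h. h \<in> H \<and> ip h h \<le> 1 \<and> \<mu> - 1 / Suc n < ip (K h) h" for n
  proof -
    have ne: "X \<noteq> {}" using ip_zero_left H_zero by (auto simp: X_def intro!: exI[of _ 0])
    have "\<mu> - 1 / Suc n < Sup X" by (simp add: \<mu>_def)
    then obtain x where "x \<in> X" "\<mu> - 1 / Suc n < x" using less_cSupD[OF ne] by blast
    then show ?thesis by (auto simp: X_def)
  qed
  then obtain h where h: "\<And>n. h n \<in> H" "\<And>n. ip (h n) (h n) \<le> 1"
      "\<And>n. \<mu> - 1 / Suc n < ip (K (h n)) (h n)" by metis
  obtain f r where f: "f \<in> H" and r: "strict_mono (r :: nat \<Rightarrow> nat)"
    and lim: "(\<lambda>n. ip (K (h (r n)) - f) (K (h (r n)) - f)) \<longlonglongrightarrow> 0"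
    using K_compact[of h] h by blast
  define d where "d n = nrm (K (h (r n)) - f)" for n
  define e where "e n = nrm (K (h (r n)) - \<mu> *\<^sub>R h (r n))" for n
  have d0: "d \<longlonglongrightarrow> 0" unfolding d_def nrm_def using tendsto_real_sqrt[OF lim] by simp
  have inv: "(\<lambda>n. 1 / real (Suc (r n))) \<longlonglongrightarrow> 0"
    using LIMSEQ_subseq_LIMSEQ[OF LIMSEQ_inverse_real_of_nat r] by (simp add: o_def field_simps)
  have e0: "e \<longlonglongrightarrow> 0"
  proof -
    \<comment> \<open>By \<open>Ksq\<close> the square |K h - mu h|^2 is at most mu (mu - (K h, h)),
      which tends to 0 along a maximizing sequence.\<close>
    have e2: "ip (K (h (r n)) - \<mu> *\<^sub>R h (r n)) (K (h (r n)) - \<mu> *\<^sub>R h (r n)) \<le> \<mu> * (1 / Suc (r n))" for n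
    proof -
      let ?h = "h (r n)"
      have "ip (K ?h - \<mu> *\<^sub>R ?h) (K ?h - \<mu> *\<^sub>R ?h)
          = ip (K ?h) (K ?h) - 2 * \<mu> * ip (K ?h) ?h + \<mu> * \<mu> * ip ?h ?h"
        using h(1)[of "r n"] KH[of ?h]
        by (simp add: ip_simps H_scale H_diff ip_sym[of ?h "K ?h"] algebra_simps)
      also have "\<dots> \<le> \<mu> * ip (K ?h) ?h - 2 * \<mu> * ip (K ?h) ?h + \<mu> * \<mu> * 1"
        using Ksq[OF h(1)] h(2) mu by (intro add_mono diff_mono mult_left_mono) auto
      also have "\<dots> = \<mu> * (\<mu> - ip (K ?h) ?h)" by (simp add: algebra_simps)
      also have "\<dots> \<le> \<mu> * (1 / Suc (r n))"
        using h(3)[of "r n"] mu by (intro mult_left_mono) auto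
      finally show ?thesis .
    qed
    have "(\<lambda>n. ip (K (h (r n)) - \<mu> *\<^sub>R h (r n)) (K (h (r n)) - \<mu> *\<^sub>R h (r n))) \<longlonglongrightarrow> 0"
    proof (rule real_tendsto_sandwich[of "\<lambda>_. 0" _ _ "\<lambda>n. \<mu> * (1 / Suc (r n))"])
      show "(\<lambda>n. \<mu> * (1 / Suc (r n))) \<longlonglongrightarrow> 0" using tendsto_mult[OF tendsto_const inv, of \<mu>] by simp
    qed (use e2 ip_nonneg[OF H_diff[OF KH[OF h(1)] H_scale[OF h(1)]]] in auto)
    then show ?thesis unfolding e_def nrm_def using tendsto_real_sqrt by fastforce
  qed
  have fh: "nrm (f - \<mu> *\<^sub>R h (r n)) \<le> d n + e n" for n
  proof -
    let ?h = "h (r n)"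
    have "f - \<mu> *\<^sub>R ?h = (f - K ?h) + (K ?h - \<mu> *\<^sub>R ?h)" by simp
    also have "nrm \<dots> \<le> nrm (f - K ?h) + nrm (K ?h - \<mu> *\<^sub>R ?h)"
      by (intro nrm_triangle H_diff H_scale KH f h)
    finally show ?thesis using nrm_minus[OF f KH[OF h(1)], of "r n"] by (simp add: d_def e_def)
  qed
  have "nrm (K f - \<mu> *\<^sub>R f) \<le> (d n + e n) + \<mu> * d n" for n
  proof -
    let ?h = "h (r n)"
    \<comment> \<open>K does not increase the seminorm, so both summands are small: the first by
      \<open>fh\<close>, the second by the choice of the subsequence.\<close>
    have "K f - \<mu> *\<^sub>R f = K (f - \<mu> *\<^sub>R ?h) + \<mu> *\<^sub>R (K ?h - f)"
      using f h by (simp add: Kdiff H_scale K_scale scaleR_diff_right)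
    also have "nrm \<dots> \<le> nrm (K (f - \<mu> *\<^sub>R ?h)) + nrm (\<mu> *\<^sub>R (K ?h - f))"
      by (intro nrm_triangle H_diff H_scale KH f h)
    also have "\<dots> \<le> (d n + e n) + \<mu> * d n"
      using order_trans[OF nK[OF H_diff[OF f H_scale[OF h(1)]]] fh] mu
      by (simp add: nrm_scale[OF H_diff[OF KH[OF h(1)] f]] d_def)
    finally show ?thesis .
  qed
  moreover have "(\<lambda>n. (d n + e n) + \<mu> * d n) \<longlonglongrightarrow> 0"
    using tendsto_add[OF tendsto_add[OF d0 e0] tendsto_mult[OF tendsto_const d0, of \<mu>]] by simp
  ultimately have "nrm (K f - \<mu> *\<^sub>R f) \<le> 0"
    by (intro LIMSEQ_le_const[where X = "\<lambda>n. (d n + e n) + \<mu> * d n"]) auto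
  then have eig0: "ip (K f - \<mu> *\<^sub>R f) (K f - \<mu> *\<^sub>R f) = 0"
    using ip_nonneg[of "K f - \<mu> *\<^sub>R f"] f KH by (auto simp: nrm_def H_diff H_scale)
  \<comment> \<open>The limit is not null: |mu h| >= mu |h|^2 >= (K h, h) is close to mu > 0, and mu
    h is close to f.\<close>
  have "\<mu> - 1 / Suc (r n) - (d n + e n) \<le> nrm f" for n
  proof -
    let ?h = "h (r n)"
    have h1: "nrm ?h \<le> 1" using h(2) by (simp add: nrm_def)
    have "\<mu> - 1 / Suc (r n) \<le> \<mu> * (nrm ?h)\<^sup>2"
      using h(3)[of "r n"] up[OF h(1), of "r n"] nrm_sq[OF h(1)] by simp
    also have "\<dots> \<le> \<mu> * nrm ?h"
      using h1 nrm_nonneg[OF h(1)] mu by (simp add: power2_eq_square mult_left_le)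
    also have "\<dots> = nrm (\<mu> *\<^sub>R ?h)" using mu h by (simp add: nrm_scale)
    also have "\<mu> *\<^sub>R ?h = f + (\<mu> *\<^sub>R ?h - f)" by simp
    also have "nrm \<dots> \<le> nrm f + nrm (\<mu> *\<^sub>R ?h - f)"
      by (intro nrm_triangle H_diff H_scale KH f h)
    also have "nrm (\<mu> *\<^sub>R ?h - f) \<le> d n + e n"
      using fh[of n] nrm_minus[OF f H_scale[OF h(1)], of \<mu> "r n"] by simp
    finally show ?thesis by simp
  qed
  moreover have "(\<lambda>n. \<mu> - 1 / Suc (r n) - (d n + e n)) \<longlonglongrightarrow> \<mu> - 0 - (0 + 0)"
    by (intro tendsto_diff tendsto_add d0 e0 inv tendsto_const)
  ultimately have "\<mu> - 0 - (0 + 0) \<le> nrm f"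
    by (intro LIMSEQ_le_const2[where X = "\<lambda>n. \<mu> - 1 / Suc (r n) - (d n + e n)"]) auto
  then have nf: "0 < nrm f" using mu by simp
  let ?g = "(1 / nrm f) *\<^sub>R f"
  have "K ?g - \<mu> *\<^sub>R ?g = (1 / nrm f) *\<^sub>R (K f - \<mu> *\<^sub>R f)"
    using f by (simp add: K_scale scaleR_diff_right)
  then have "ip (K ?g - \<mu> *\<^sub>R ?g) (K ?g - \<mu> *\<^sub>R ?g) = 0"
    using eig0 f KH by (simp add: ip_scale_left ip_scale_right H_diff H_scale)
  moreover have "ip ?g ?g = 1"
    using f nf by (simp add: ip_simps H_scale nrm_sq[OF f, symmetric] power2_eq_square)
  ultimately show ?thesis using f mu up by (intro bexI[of _ ?g] exI[of _ \<mu>]) auto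
qed

lemma bessel:
  fixes n :: nat
  assumes e: "\<And>i. i < n \<Longrightarrow> e i \<in> H" "\<And>i j. i < n \<Longrightarrow> j < n \<Longrightarrow> ip (e i) (e j) = of_bool (i = j)"
    and v: "v \<in> H"
  shows "(\<Sum>i<n. (ip (e i) v)\<^sup>2) \<le> ip v v"
proof -
  define p where "p = (\<Sum>i<n. ip (e i) v *\<^sub>R e i)"
  have p: "p \<in> H" unfolding p_def using e by (intro H_sum) auto
  have ep: "ip (e j) p = ip (e j) v" if "j < n" for j
  proof -
    have "ip (e j) p = (\<Sum>i<n. ip (e i) v * of_bool (j = i))"
      unfolding p_def using e that by (subst ip_sum_right) (auto simp: ip_scale_right H_scale intro!: sum.cong)
    also have "\<dots> = (\<Sum>i<n. if j = i then ip (e i) v else 0)" by (intro sum.cong) auto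
    also have "\<dots> = ip (e j) v" using that by (subst sum.delta') auto
    finally show ?thesis .
  qed
  have pv: "ip p v = (\<Sum>i<n. (ip (e i) v)\<^sup>2)"
    unfolding p_def using e v by (subst ip_sum_left) (auto simp: ip_scale_left power2_eq_square)
  have pp: "ip p p = (\<Sum>i<n. (ip (e i) v)\<^sup>2)"
  proof -
    have "ip p p = (\<Sum>i<n. ip (ip (e i) v *\<^sub>R e i) p)"
      using e p by (subst (1) p_def, subst ip_sum_left) auto
    also have "\<dots> = (\<Sum>i<n. (ip (e i) v)\<^sup>2)"
      using e p ep by (intro sum.cong) (auto simp: ip_scale_left power2_eq_square)
    finally show ?thesis .
  qed
  have "0 \<le> ip (v - p) (v - p)" using v p by (intro ip_nonneg) auto
  also have "\<dots> = ip v v - (\<Sum>i<n. (ip (e i) v)\<^sup>2)"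
    using v p pv pp by (simp add: ip_simps H_diff ip_sym[of v p])
  finally show ?thesis by simp
qed

end

section \<open>Min-max and trace inequalities for an eigenvalue sequence\<close>

lemma homogeneous_system_nontrivial:
  fixes A :: "nat \<Rightarrow> nat \<Rightarrow> real"
  shows "\<exists>c :: nat \<Rightarrow> real. (\<exists>i\<le>n. c i \<noteq> 0) \<and> (\<forall>k<n. (\<Sum>i\<le>n. c i * A k i) = 0)"
proof (induction n arbitrary: A)
  case 0
  show ?case by (intro exI[of _ "\<lambda>_. 1"]) auto
next
  case (Suc n)
  show ?case
  proof (cases "\<exists>i\<le>n. A n i \<noteq> 0")
    case False
    \<comment> \<open>The last equation involves at most the unknown with index
      \<open>Suc n\<close>, which is set to 0.\<close>
    obtain c where c: "\<exists>i\<le>n. c i \<noteq> 0" "\<forall>k<n. (\<Sum>i\<le>n. c i * A k i) = 0"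
      using Suc by blast
    show ?thesis
    proof (intro exI[of _ "\<lambda>i. if i \<le> n then c i else 0"] conjI allI impI)
      show "\<exists>i\<le>Suc n. (if i \<le> n then c i else 0) \<noteq> 0" using c(1) by auto
      show "(\<Sum>i\<le>Suc n. (if i \<le> n then c i else 0) * A k i) = 0" if "k < Suc n" for k
        using c(2) False that by (cases "k = n") auto
    qed
  next
    case True
    then obtain p where p: "p \<le> n" "A n p \<noteq> 0" by auto
    \<comment> \<open>Gaussian elimination of the unknown p by means of the last equation. The map
      \<open>s\<close> moves the unknown \<open>Suc n\<close> into the free slot, so that the
      remaining unknowns are again indexed by 0, ..., n.\<close>
    define s where "s i = (if i = p then Suc n else i)" for i
    define B where "B k i = A k (s i) - A n (s i) / A n p * A k p" for k i
    obtain c where c: "\<exists>i\<le>n. c i \<noteq> 0" "\<forall>k<n. (\<Sum>i\<le>n. c i * B k i) = 0"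
      using Suc[of B] by blast
    \<comment> \<open>The value that the last equation forces on the eliminated unknown.\<close>
    define x where "x = - (\<Sum>i\<le>n. c i * A n (s i)) / A n p"
    define d where "d i = (if i = p then x else if i = Suc n then c p else c i)" for i
    have ds: "d (s i) = c i" if "i \<le> n" for i using that p by (auto simp: d_def s_def)
    have tot: "(\<Sum>i\<le>Suc n. d i * A k i) = x * A k p + (\<Sum>i\<le>n. c i * A k (s i))" for k
    proof -
      have "(\<Sum>i\<le>Suc n. d i * A k i) = d p * A k p + (\<Sum>i\<in>{..Suc n} - {p}. d i * A k i)"
        using p by (intro sum.remove) auto
      also have "(\<Sum>i\<in>{..Suc n} - {p}. d i * A k i) = (\<Sum>i\<le>n. d (s i) * A k (s i))"
        using p by (intro sum.reindex_bij_witness[of _ s "\<lambda>i. if i = Suc n then p else i"])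
          (auto simp: s_def split: if_splits)
      finally show ?thesis using ds by (simp add: d_def)
    qed
    show ?thesis
    proof (intro exI[of _ d] conjI allI impI)
      obtain i where "i \<le> n" "c i \<noteq> 0" using c(1) by auto
      then show "\<exists>i\<le>Suc n. d i \<noteq> 0" using ds[of i] p by (intro exI[of _ "s i"]) (auto simp: s_def)
      fix k assume k: "k < Suc n"
      have "(\<Sum>i\<le>n. c i * B k i) = (\<Sum>i\<le>n. c i * A k (s i)) - (\<Sum>i\<le>n. c i * A n (s i)) / A n p * A k p"
        by (simp add: B_def algebra_simps sum_subtractf sum_distrib_left sum_distrib_right sum_divide_distrib)
      then have e: "(\<Sum>i\<le>n. c i * A k (s i)) + x * A k p = (\<Sum>i\<le>n. c i * B k i)"
        by (simp add: x_def)
      show "(\<Sum>i\<le>Suc n. d i * A k i) = 0"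
      proof (cases "k = n")
        case True then show ?thesis using p by (simp only: tot) (simp add: x_def)
      next
        case False then show ?thesis using e c(2) k tot[of k] by auto
      qed
    qed
  qed
qed

text \<open>The condition \<open>variational\<close> takes the place of an eigenfunction expansion:
  what remains of a vector after projection to the first n eigenvectors is controlled through its
  Rayleigh quotient alone.\<close>

locale eigen_system = ip: semi_inner H ip + q: semi_inner H q
  for H :: "'v::real_vector set" and ip q +
  fixes u :: "nat \<Rightarrow> 'v" and lam :: "nat \<Rightarrow> real"
  assumes u_H: "u i \<in> H"
    and u_orthonormal: "ip (u i) (u j) = of_bool (i = j)"
    and u_eigen: "f \<in> H \<Longrightarrow> q (u i) f = lam i * ip (u i) f"
    and variational: "\<lbrakk>f \<in> H; \<And>i. i < n \<Longrightarrow> ip (u i) f = 0\<rbrakk> \<Longrightarrow> lam n * ip f f \<le> q f f"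
begin

lemma q_u: "q (u i) (u i) = lam i"
  using u_eigen[OF u_H] u_orthonormal[of i i] by simp

lemma lam_mono: "i \<le> j \<Longrightarrow> lam i \<le> lam j"
  using variational[of "u j" i] u_H u_orthonormal q_u by auto

lemma lam_nonneg: "0 \<le> lam i"
  using q.ip_nonneg[OF u_H, of i] q_u by simp

lemma comb_H: "finite I \<Longrightarrow> (\<Sum>i\<in>I. c i *\<^sub>R u i) \<in> H"
  using u_H by (intro ip.H_sum) auto

lemma ip_comb_u:
  assumes "finite I"
  shows "ip (u j) (\<Sum>i\<in>I. c i *\<^sub>R u i) = (if j \<in> I then c j else 0)"
proof -
  have "ip (u j) (\<Sum>i\<in>I. c i *\<^sub>R u i) = (\<Sum>i\<in>I. c i * of_bool (j = i))"
    using u_H by (subst ip.ip_sum_right) (auto simp: ip.ip_scale_right u_orthonormal)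
  then show ?thesis using assms by (simp add: of_bool_def if_distrib sum.delta cong: if_cong)
qed

lemma ip_comb:
  assumes "finite I"
  shows "ip (\<Sum>i\<in>I. c i *\<^sub>R u i) (\<Sum>i\<in>I. c i *\<^sub>R u i) = (\<Sum>i\<in>I. (c i)\<^sup>2)"
  using u_H comb_H[OF assms] ip_comb_u[OF assms]
  by (subst ip.ip_sum_left) (auto simp: ip.ip_scale_left power2_eq_square ip.H_scale intro!: sum.cong)

lemma q_comb:
  assumes "finite I"
  shows "q (\<Sum>i\<in>I. c i *\<^sub>R u i) (\<Sum>i\<in>I. c i *\<^sub>R u i) = (\<Sum>i\<in>I. lam i * (c i)\<^sup>2)"
  using u_H comb_H[OF assms] ip_comb_u[OF assms]
  by (subst q.ip_sum_left)
    (auto simp: q.ip_scale_left u_eigen power2_eq_square ip.H_scale intro!: sum.cong)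

text \<open>Both forms are additive along the splitting of e into its projection on the first n
  eigenvectors and a remainder, and \<open>variational\<close> bounds the remainder. Measuring
  everything against \<open>lam n\<close> makes the coefficients \<open>lam j - lam n\<close>
  non-positive, which \<open>ky_fan\<close> exploits.\<close>

lemma q_lower:
  assumes e: "e \<in> H"
  shows "lam n * ip e e + (\<Sum>j<n. (lam j - lam n) * (ip (u j) e)\<^sup>2) \<le> q e e"
proof -
  define p where "p = (\<Sum>j<n. ip (u j) e *\<^sub>R u j)"
  define g where "g = e - p"
  have p: "p \<in> H" unfolding p_def by (rule comb_H) simp
  have g: "g \<in> H" using p e by (auto simp: g_def)
  have ug: "ip (u j) g = 0" if "j < n" for j
    using ip_comb_u[of "{..<n}" j "\<lambda>j. ip (u j) e"] that u_H e p
    by (simp add: g_def ip.ip_diff_right p_def[symmetric])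
  have "ip p g = 0" unfolding p_def
    using u_H g ug by (subst ip.ip_sum_left) (auto simp: ip.ip_scale_left ip.H_scale)
  moreover have "q p g = 0" unfolding p_def
    using u_H g ug by (subst q.ip_sum_left) (auto simp: q.ip_scale_left u_eigen ip.H_scale)
  moreover have "e = p + g" by (simp add: g_def)
  ultimately have "ip e e = ip p p + ip g g" "q e e = q p p + q g g"
    using p g by (simp_all add: ip.ip_simps q.ip_simps ip.H_add ip.ip_sym[of g p] q.ip_sym[of g p])
  moreover have "ip p p = (\<Sum>j<n. (ip (u j) e)\<^sup>2)" "q p p = (\<Sum>j<n. lam j * (ip (u j) e)\<^sup>2)"
    by (simp_all add: p_def ip_comb q_comb)
  moreover have "lam n * ip g g \<le> q g g" using variational g ug by blast
  ultimately show ?thesis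
    by (simp add: algebra_simps sum_subtractf sum_distrib_left)
qed

text \<open>Summing \<open>q_lower\<close> over the family attaches to \<open>lam j - lam n\<close>
  the factor sum_i (e i, u j)^2, which is at most 1 by Bessel. As that coefficient is non-positive,
  putting 1 for the factor only lowers the sum, and then the terms with \<open>lam n\<close>
  cancel.\<close>

lemma ky_fan:
  assumes e: "\<And>i. i < n \<Longrightarrow> e i \<in> H" "\<And>i j. i < n \<Longrightarrow> j < n \<Longrightarrow> ip (e i) (e j) = of_bool (i = j)"
  shows "(\<Sum>i<n. lam i) \<le> (\<Sum>i<n. q (e i) (e i))"
proof -
  have "(\<Sum>j<n. lam j) = real n * lam n + (\<Sum>j<n. (lam j - lam n) * 1)"
    by (simp add: sum_subtractf)
  also have "\<dots> \<le> real n * lam n + (\<Sum>j<n. (lam j - lam n) * (\<Sum>i<n. (ip (e i) (u j))\<^sup>2))"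
  proof (intro add_left_mono sum_mono)
    fix j assume j: "j \<in> {..<n}"
    have "(\<Sum>i<n. (ip (e i) (u j))\<^sup>2) \<le> 1" 
      using ip.bessel[OF e u_H, of n j] u_orthonormal by simp
    then show "(lam j - lam n) * 1 \<le> (lam j - lam n) * (\<Sum>i<n. (ip (e i) (u j))\<^sup>2)"
      using lam_mono[of j n] j by (intro mult_left_mono_neg) auto
  qed
  also have "\<dots> = (\<Sum>i<n. lam n * ip (e i) (e i) + (\<Sum>j<n. (lam j - lam n) * (ip (u j) (e i))\<^sup>2))"
  proof -
    have "(\<Sum>j<n. (lam j - lam n) * (\<Sum>i<n. (ip (e i) (u j))\<^sup>2))
        = (\<Sum>i<n. \<Sum>j<n. (lam j - lam n) * (ip (e i) (u j))\<^sup>2)"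
      unfolding sum_distrib_left by (rule sum.swap)
    also have "\<dots> = (\<Sum>i<n. \<Sum>j<n. (lam j - lam n) * (ip (u j) (e i))\<^sup>2)"
      using e u_H by (intro sum.cong refl) (simp add: ip.ip_sym)
    finally show ?thesis using e by (simp add: sum.distrib)
  qed
  also have "\<dots> \<le> (\<Sum>i<n. q (e i) (e i))" using e by (intro sum_mono q_lower) auto
  finally show ?thesis .
qed

text \<open>The bound is tested on v = sum_j l(u j) u j. Writing T for the sum to be estimated, l v
  and \<open>ip v v\<close> both equal T while \<open>q v v\<close> is at most lam (M - 1) T, so T^2
  <= (A + B lam (M - 1)) T. This avoids the factor M that adding up the bounds for the single u j
  would produce.\<close>

lemma functional_trace_bound:
  fixes l :: "'v \<Rightarrow> real"
  assumes add: "\<And>x y. \<lbrakk>x \<in> H; y \<in> H\<rbrakk> \<Longrightarrow> l (x + y) = l x + l y"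
    and scale: "\<And>x c. x \<in> H \<Longrightarrow> l (c *\<^sub>R x) = c * l x"
    and bound: "\<And>v. v \<in> H \<Longrightarrow> (l v)\<^sup>2 \<le> A * ip v v + B * q v v"
    and "0 \<le> A" "0 \<le> B"
  shows "(\<Sum>j<M. (l (u j))\<^sup>2) \<le> A + B * lam (M - 1)"
proof -
  define T where "T = (\<Sum>j<M. (l (u j))\<^sup>2)"
  define v where "v = (\<Sum>j<M. l (u j) *\<^sub>R u j)"
  have l_sum: "l (\<Sum>j<N. l (u j) *\<^sub>R u j) = (\<Sum>j<N. (l (u j))\<^sup>2)" for N
  proof (induction N)
    case 0
    show ?case using scale[of 0 0] ip.H_zero by simp
  next
    case (Suc N)
    then show ?case using add[OF comb_H[of "{..<N}" "\<lambda>j. l (u j)"] ip.H_scale[OF u_H]]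
      by (simp add: scale u_H power2_eq_square)
  qed
  have "T\<^sup>2 \<le> A * T + B * (\<Sum>j<M. lam j * (l (u j))\<^sup>2)"
    using bound[OF comb_H[of "{..<M}" "\<lambda>j. l (u j)"]] by (simp add: l_sum ip_comb q_comb T_def)
  also have "\<dots> \<le> A * T + B * (\<Sum>j<M. lam (M - 1) * (l (u j))\<^sup>2)"
    using lam_mono \<open>0 \<le> B\<close> by (intro add_left_mono mult_left_mono sum_mono mult_right_mono) auto
  also have "\<dots> = A * T + B * (lam (M - 1) * T)" by (simp add: T_def sum_distrib_left)
  finally have "T * T \<le> (A + B * lam (M - 1)) * T"
    by (simp add: power2_eq_square algebra_simps)
  moreover have "0 \<le> T" by (simp add: T_def sum_nonneg)
  moreover have "0 \<le> A + B * lam (M - 1)" using assms lam_nonneg by simp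
  ultimately show ?thesis unfolding T_def[symmetric]
    by (cases "T = 0") (auto simp: mult_le_cancel_right)
qed

text \<open>There are n conditions on the n + 1 coefficients of u 0, ..., u n, so a non-zero
  combination meets all of them. Its Rayleigh quotient is at least A and at most
  \<open>lam n\<close>.\<close>

lemma lam_lower_by_constraints:
  fixes l :: "nat \<Rightarrow> 'v \<Rightarrow> real"
  assumes add: "\<And>k x y. \<lbrakk>x \<in> H; y \<in> H\<rbrakk> \<Longrightarrow> l k (x + y) = l k x + l k y"
    and scale: "\<And>k x c. x \<in> H \<Longrightarrow> l k (c *\<^sub>R x) = c * l k x"
    and bound: "\<And>v. v \<in> H \<Longrightarrow> (\<And>k. k < n \<Longrightarrow> l k v = 0) \<Longrightarrow> A * ip v v \<le> q v v"
  shows "A \<le> lam n"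
proof -
  obtain c where c: "\<exists>i\<le>n. c i \<noteq> 0" "\<forall>k<n. (\<Sum>i\<le>n. c i * l k (u i)) = 0"
    using homogeneous_system_nontrivial[of n "\<lambda>k i. l k (u i)"] by blast
  define v where "v = (\<Sum>i\<le>n. c i *\<^sub>R u i)"
  have l_sum: "l k (\<Sum>i\<in>I. c i *\<^sub>R u i) = (\<Sum>i\<in>I. c i * l k (u i))" if "finite I" for k I
    using that
  proof induction
    case empty
    show ?case using scale[of 0 k 0] ip.H_zero by simp
  next
    case (insert i I)
    then show ?case using add[OF ip.H_scale[OF u_H] comb_H[of I c]] by (simp add: scale u_H)
  qed
  have "A * ip v v \<le> q v v"
    using c(2) l_sum[of "{..n}"] comb_H[of "{..n}"] by (intro bound) (auto simp: v_def)
  also have "\<dots> = (\<Sum>i\<le>n. lam i * (c i)\<^sup>2)" by (simp add: v_def q_comb)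
  also have "\<dots> \<le> (\<Sum>i\<le>n. lam n * (c i)\<^sup>2)"
    using lam_mono by (intro sum_mono mult_right_mono) auto
  also have "\<dots> = lam n * ip v v" by (simp add: v_def ip_comb sum_distrib_left)
  finally have "A * ip v v \<le> lam n * ip v v" .
  moreover have "0 < ip v v"
    using c(1) by (auto simp: v_def ip_comb intro!: sum_pos2)
  ultimately show ?thesis by simp
qed

end

section \<open>Absolutely continuous functions with square integrable derivative\<close>

text \<open>The Sobolev space W_2^1 on [p, q], with f as the continuous representative. The
  derivative is carried along as a second function because it is determined only almost
  everywhere.\<close>

definition ac_on :: "real \<Rightarrow> real \<Rightarrow> (real \<Rightarrow> real) \<Rightarrow> (real \<Rightarrow> real) \<Rightarrow> bool" where
  "ac_on p q f f' \<longleftrightarrow> (\<forall>x\<in>{p..q}. (f' has_integral (f x - f p)) {p..x}) \<and>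
     (\<lambda>x. (f' x)\<^sup>2) integrable_on {p..q}"

definition energy :: "(real \<Rightarrow> real) \<Rightarrow> (real \<Rightarrow> real) \<Rightarrow> real" where
  "energy f' g' = integral {0..1} (\<lambda>x. f' x * g' x)"

lemma ac_on_integrable: "\<lbrakk>ac_on p q f f'; p \<le> q\<rbrakk> \<Longrightarrow> f' integrable_on {p..q}"
  by (auto simp: ac_on_def integrable_on_def)

lemma ac_on_measurable: "\<lbrakk>ac_on p q f f'; p \<le> q\<rbrakk> \<Longrightarrow> f' \<in> borel_measurable (lebesgue_on {p..q})"
  by (intro integrable_imp_measurable ac_on_integrable)

lemma absolutely_integrable_product_of_squares:
  fixes f g :: "real \<Rightarrow> real"
  assumes "f \<in> borel_measurable (lebesgue_on {p..q})" "g \<in> borel_measurable (lebesgue_on {p..q})"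
    and "(\<lambda>x. (f x)\<^sup>2) integrable_on {p..q}" "(\<lambda>x. (g x)\<^sup>2) integrable_on {p..q}"
  shows "(\<lambda>x. f x * g x) absolutely_integrable_on {p..q}"
proof (rule measurable_bounded_by_integrable_imp_absolutely_integrable)
  show "(\<lambda>x. f x * g x) \<in> borel_measurable (lebesgue_on {p..q})" using assms by simp
  show "(\<lambda>x. (f x)\<^sup>2 + (g x)\<^sup>2) integrable_on {p..q}" using assms by (intro integrable_add)
  show "norm (f x * g x) \<le> (f x)\<^sup>2 + (g x)\<^sup>2" for x
  proof -
    have "2 * \<bar>f x\<bar> * \<bar>g x\<bar> \<le> (f x)\<^sup>2 + (g x)\<^sup>2"
      using sum_squares_bound[of "\<bar>f x\<bar>" "\<bar>g x\<bar>"] by (simp only: power2_abs)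
    moreover have "0 \<le> \<bar>f x\<bar> * \<bar>g x\<bar>" by simp
    ultimately show ?thesis by (simp only: real_norm_def abs_mult)
  qed
qed simp

lemma ac_on_mult_integrable:
  assumes "ac_on p q f f'" "ac_on p q g g'" "p \<le> q"
  shows "(\<lambda>x. f' x * g' x) absolutely_integrable_on {p..q}"
  using assms by (intro absolutely_integrable_product_of_squares)
    (auto intro: ac_on_measurable simp: ac_on_def)

lemma ac_on_mult_integrable': 
  "\<lbrakk>ac_on p q f f'; ac_on p q g g'; p \<le> q\<rbrakk> \<Longrightarrow> (\<lambda>x. f' x * g' x) integrable_on {p..q}"
  using ac_on_mult_integrable set_lebesgue_integral_eq_integral(1) by blast

lemma ac_on_const: "ac_on p q (\<lambda>_. c) (\<lambda>_. 0)"
  by (simp add: ac_on_def integrable_0)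

lemma ac_on_add:
  assumes "ac_on p q f f'" "ac_on p q g g'" "p \<le> q"
  shows "ac_on p q (\<lambda>x. f x + g x) (\<lambda>x. f' x + g' x)"
proof -
  have "(\<lambda>x. (f' x)\<^sup>2 + (g' x)\<^sup>2 + 2 * (f' x * g' x)) integrable_on {p..q}"
    using assms ac_on_mult_integrable'[OF assms]
    by (intro integrable_add integrable_on_mult_right) (auto simp: ac_on_def)
  then have "(\<lambda>x. (f' x + g' x)\<^sup>2) integrable_on {p..q}"
    by (simp add: power2_sum algebra_simps)
  moreover have "((\<lambda>x. f' x + g' x) has_integral (f x + g x - (f p + g p))) {p..x}" if "x \<in> {p..q}" for x
  proof -
    have "((\<lambda>x. f' x + g' x) has_integral ((f x - f p) + (g x - g p))) {p..x}"
      using assms that by (intro has_integral_add) (auto simp: ac_on_def)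
    then show ?thesis by (simp add: algebra_simps)
  qed
  ultimately show ?thesis by (simp add: ac_on_def)
qed

lemma ac_on_scale:
  assumes "ac_on p q f f'"
  shows "ac_on p q (\<lambda>x. c * f x) (\<lambda>x. c * f' x)"
proof -
  have "((\<lambda>x. c * f' x) has_integral (c * f x - c * f p)) {p..x}" if "x \<in> {p..q}" for x
    using has_integral_mult_right[of f' "f x - f p" "{p..x}" c] assms that
    by (simp add: ac_on_def right_diff_distrib)
  moreover have "(\<lambda>x. c\<^sup>2 * (f' x)\<^sup>2) integrable_on {p..q}"
    using assms by (intro integrable_on_mult_right) (simp add: ac_on_def)
  ultimately show ?thesis by (simp add: ac_on_def power_mult_distrib)
qed

text \<open>Agreement of the derivatives on the open interval is the right condition for piecewise
  definitions, whose formulas for the derivative conflict at the joints.\<close>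

lemma ac_on_cong:
  assumes "ac_on p q f f'" "p \<le> q" "\<And>x. x \<in> {p..q} \<Longrightarrow> g x = f x" "\<And>x. x \<in> {p<..<q} \<Longrightarrow> g' x = f' x"
  shows "ac_on p q g g'" "integral {p..q} (\<lambda>x. (g' x)\<^sup>2) = integral {p..q} (\<lambda>x. (f' x)\<^sup>2)"
proof -
  have "(g' has_integral (g x - g p)) {p..x}" if "x \<in> {p..q}" for x
  proof (rule has_integral_spike_finite[of "{p, q}" _ _ f'])
    show "(f' has_integral (g x - g p)) {p..x}" using assms that by (auto simp: ac_on_def)
  qed (use assms that in auto)
  moreover have "(\<lambda>x. (g' x)\<^sup>2) integrable_on {p..q}"
    by (rule integrable_spike_finite[of "{p, q}" _ _ "\<lambda>x. (f' x)\<^sup>2"]) (use assms in \<open>auto simp: ac_on_def\<close>)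
  ultimately show "ac_on p q g g'" by (simp add: ac_on_def)
  show "integral {p..q} (\<lambda>x. (g' x)\<^sup>2) = integral {p..q} (\<lambda>x. (f' x)\<^sup>2)"
    by (rule integral_spike[of "{p, q}"]) (use assms in auto)
qed

lemma ac_on_continuous:
  assumes "ac_on p q f f'" "p \<le> q"
  shows "continuous_on {p..q} f"
proof -
  have "continuous_on {p..q} (\<lambda>x. integral {p..x} f' + f p)"
    by (intro continuous_intros indefinite_integral_continuous_1 ac_on_integrable[OF assms])
  moreover have "integral {p..x} f' + f p = f x" if "x \<in> {p..q}" for x
    using integral_unique[of f' "f x - f p" "{p..x}"] assms that by (auto simp: ac_on_def)
  ultimately show ?thesis by (rule continuous_on_eq)
qed

lemma ac_on_has_integral:
  assumes "ac_on p q f f'" "p \<le> c" "c \<le> d" "d \<le> q"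
  shows "(f' has_integral (f d - f c)) {c..d}"
proof -
  have i: "f' integrable_on {p..d}" using assms by (auto simp: ac_on_def integrable_on_def)
  have "integral {p..c} f' + integral {c..d} f' = integral {p..d} f'"
    using assms i by (intro Henstock_Kurzweil_Integration.integral_combine) auto
  moreover have "integral {p..c} f' = f c - f p" "integral {p..d} f' = f d - f p"
    using assms by (auto simp: ac_on_def intro!: integral_unique)
  moreover have "f' integrable_on {c..d}"
    using i assms integrable_on_subinterval by fastforce
  ultimately show ?thesis by (simp add: has_integral_iff)
qed

lemma ac_on_subinterval:
  assumes "ac_on p q f f'" "p \<le> c" "d \<le> q"
  shows "ac_on c d f f'"
proof -
  have "(\<lambda>x. (f' x)\<^sup>2) integrable_on {c..d}"
    using assms by (auto simp: ac_on_def intro: integrable_on_subinterval)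
  then show ?thesis using ac_on_has_integral[OF assms(1)] assms by (auto simp: ac_on_def)
qed

lemma ac_on_combine:
  assumes "ac_on p c f f'" "ac_on c q f f'" "p \<le> c" "c \<le> q"
  shows "ac_on p q f f'"
    and "integral {p..q} (\<lambda>x. (f' x)\<^sup>2) = integral {p..c} (\<lambda>x. (f' x)\<^sup>2) + integral {c..q} (\<lambda>x. (f' x)\<^sup>2)"
proof -
  have sq: "(\<lambda>x. (f' x)\<^sup>2) integrable_on {p..q}"
    using assms by (intro Henstock_Kurzweil_Integration.integrable_combine[of p c q]) (auto simp: ac_on_def)
  have "(f' has_integral (f x - f p)) {p..x}" if "x \<in> {p..q}" for x
  proof (cases "x \<le> c")
    case False
    have "(f' has_integral ((f c - f p) + (f x - f c))) {p..x}"
      using assms that False by (intro has_integral_combine[of p c x]) (auto simp: ac_on_def)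
    then show ?thesis by simp
  qed (use assms that in \<open>auto simp: ac_on_def\<close>)
  then show "ac_on p q f f'" using sq by (simp add: ac_on_def)
  show "integral {p..q} (\<lambda>x. (f' x)\<^sup>2) = integral {p..c} (\<lambda>x. (f' x)\<^sup>2) + integral {c..q} (\<lambda>x. (f' x)\<^sup>2)"
    using Henstock_Kurzweil_Integration.integral_combine[OF assms(3,4) sq] by simp
qed

lemma ac_on_affinity:
  assumes f: "ac_on p q f f'" and k: "0 < k" and pq: "p \<le> q"
  shows "ac_on ((p - c) / k) ((q - c) / k) (\<lambda>x. f (k * x + c)) (\<lambda>x. k * f' (k * x + c))"
    and "integral {(p - c) / k..(q - c) / k} (\<lambda>x. (k * f' (k * x + c))\<^sup>2)
       = k * integral {p..q} (\<lambda>x. (f' x)\<^sup>2)"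
proof -
  have aff: "((\<lambda>x. g (k * x + c)) has_integral (i / k)) {(p' - c) / k..(q' - c) / k}"
    if "(g has_integral i) {p'..q'}" for g :: "real \<Rightarrow> real" and i p' q'
    using has_integral_affinity'[of g i p' q' k c] that k by (simp add: divide_inverse mult.commute)
  have "((\<lambda>x. (f' (k * x + c))\<^sup>2) has_integral (integral {p..q} (\<lambda>x. (f' x)\<^sup>2) / k)) {(p - c) / k..(q - c) / k}"
    using aff[of "\<lambda>x. (f' x)\<^sup>2"] f by (auto simp: ac_on_def integrable_integral)
  from has_integral_mult_right[OF this, of "k * k"]
  have sq: "((\<lambda>x. (k * f' (k * x + c))\<^sup>2) has_integral (k * integral {p..q} (\<lambda>x. (f' x)\<^sup>2))) {(p - c) / k..(q - c) / k}"
    using k by (simp add: power_mult_distrib power2_eq_square algebra_simps)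
  have "((\<lambda>x. k * f' (k * x + c)) has_integral (f (k * x + c) - f (k * ((p - c) / k) + c))) {(p - c) / k..x}"
    if x: "x \<in> {(p - c) / k..(q - c) / k}" for x
  proof -
    have "k * x + c \<in> {p..q}" using x k by (auto simp: field_simps)
    then have "(f' has_integral (f (k * x + c) - f p)) {p..k * x + c}" using f by (auto simp: ac_on_def)
    from has_integral_mult_right[OF aff[OF this], of k] show ?thesis using k by simp
  qed
  then show "ac_on ((p - c) / k) ((q - c) / k) (\<lambda>x. f (k * x + c)) (\<lambda>x. k * f' (k * x + c))"
    using sq by (auto simp: ac_on_def integrable_on_def)
  show "integral {(p - c) / k..(q - c) / k} (\<lambda>x. (k * f' (k * x + c))\<^sup>2)
       = k * integral {p..q} (\<lambda>x. (f' x)\<^sup>2)"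
    using sq by (rule integral_unique)
qed

lemma energy_eq_square: "energy f' f' = integral {0..1} (\<lambda>x. (f' x)\<^sup>2)"
  by (simp add: energy_def power2_eq_square)

text \<open>Expanding the integral of (f' - c)^2 over [x, y] with c = f y - f x shows that 2 c^2 -
  (y - x) c^2 is at most the energy, and y - x <= 1.\<close>

lemma ac_on_oscillation:
  assumes f: "ac_on 0 1 f f'" and xy: "x \<in> {0..1}" "y \<in> {0..1}"
  shows "(f x - f y)\<^sup>2 \<le> energy f' f'"
proof -
  have main: "(f y - f x)\<^sup>2 \<le> energy f' f'" if xy: "0 \<le> x" "x \<le> y" "y \<le> 1" for x y
  proof -
    define c where "c = f y - f x"
    have F: "ac_on x y f f'" using ac_on_subinterval[OF f] xy by auto
    have sq: "(\<lambda>t. (f' t)\<^sup>2) integrable_on {0..1}" using f by (simp add: ac_on_def)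
    have sq': "(\<lambda>t. (f' t)\<^sup>2) integrable_on {x..y}" using F by (simp add: ac_on_def)
    have i: "(f' has_integral c) {x..y}" using F xy by (auto simp: ac_on_def c_def)
    have "((\<lambda>t. (f' t)\<^sup>2 - 2 * c * f' t + c\<^sup>2) has_integral
        (integral {x..y} (\<lambda>t. (f' t)\<^sup>2) - 2 * c * c + (y - x) *\<^sub>R c\<^sup>2)) {x..y}"
      using xy has_integral_const_real[of "c\<^sup>2" x y]
      by (intro has_integral_add has_integral_diff has_integral_mult_right i integrable_integral sq') auto
    moreover have "(f' t)\<^sup>2 - 2 * c * f' t + c\<^sup>2 = (f' t - c)\<^sup>2" for t
      by (simp add: power2_diff algebra_simps)
    ultimately have "0 \<le> integral {x..y} (\<lambda>t. (f' t)\<^sup>2) - 2 * c * c + (y - x) *\<^sub>R c\<^sup>2"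
      by (simp add: has_integral_nonneg)
    then have "2 * c\<^sup>2 - (y - x) * c\<^sup>2 \<le> integral {x..y} (\<lambda>t. (f' t)\<^sup>2)" by (simp add: power2_eq_square)
    also have "\<dots> \<le> energy f' f'"
      unfolding energy_eq_square using xy sq sq' by (intro integral_subset_le) auto
    finally have "2 * c\<^sup>2 - (y - x) * c\<^sup>2 \<le> energy f' f'" .
    moreover have "(y - x) * c\<^sup>2 \<le> c\<^sup>2" using xy by (intro mult_left_le_one_le) auto
    ultimately show ?thesis by (simp add: c_def)
  qed
  show ?thesis
    using main[of x y] main[of y x] xy by (cases "x \<le> y") (auto simp: power2_commute)
qed

section \<open>Integration by parts against a finite measure\<close>

lemma lebesgue_on_Icc_integrable_iff:
  "integrable (lebesgue_on {p..q}) g \<longleftrightarrow> g absolutely_integrable_on {p..q}" for g :: "real \<Rightarrow> real"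
  by (simp add: integrable_restrict_space set_integrable_def)

text \<open>Fubini on the region s <= x: for fixed s the inner integral of g runs over [s, 1] and
  equals G 1 - G s. It is used with Lebesgue measure for test functions, and with
  \<open>\<rho>\<close> both for the distribution function (h = 1) and for the Green operator. The
  sigma-algebra of M is tied to the Borel sets only by measurability of the identity, which covers
  all these cases.\<close>

lemma fubini_tail:
  fixes M :: "real measure" and h g G :: "real \<Rightarrow> real"
  assumes M: "finite_measure M" and id: "(\<lambda>s. s) \<in> borel_measurable M" and sp: "space M \<subseteq> {0..1}"
    and h: "h \<in> borel_measurable M" "\<And>s. s \<in> space M \<Longrightarrow> \<bar>h s\<bar> \<le> B"
    and g: "g absolutely_integrable_on {0..1}"
    and G: "\<And>s. s \<in> {0..1} \<Longrightarrow> (g has_integral (G 1 - G s)) {s..1}"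
  shows "(\<lambda>x. g x * (\<integral>s. h s * indicator {..x} s \<partial>M)) absolutely_integrable_on {0..1}"
    and "integral {0..1} (\<lambda>x. g x * (\<integral>s. h s * indicator {..x} s \<partial>M)) = (\<integral>s. h s * (G 1 - G s) \<partial>M)"
proof -
  define L where "L = lebesgue_on {0..1::real}"
  interpret M: finite_measure M by fact
  interpret L: finite_measure L unfolding L_def by (rule finite_measure_lebesgue_on) auto
  interpret P: pair_sigma_finite L M ..
  have gL: "integrable L g" using g by (simp add: L_def lebesgue_on_Icc_integrable_iff)
  note [measurable] = id h(1) borel_measurable_integrable[OF gL]
  have idL [measurable]: "(\<lambda>x. x) \<in> borel_measurable L"
    unfolding L_def by (intro measurable_restrict_space1 measurable_completion) simp
  define f where "f = (\<lambda>(x, s). g x * (h s * indicator {..x} s))"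
  have ind: "(\<lambda>z. indicator {..fst z} (snd z) :: real) \<in> borel_measurable (L \<Otimes>\<^sub>M M)"
  proof -
    have "(\<lambda>z. if snd z \<le> fst z then 1 else 0 :: real) \<in> borel_measurable (L \<Otimes>\<^sub>M M)"
      by measurable
    then show ?thesis by (simp add: indicator_def)
  qed
  have fm: "f \<in> borel_measurable (L \<Otimes>\<^sub>M M)"
    unfolding f_def case_prod_beta using ind by measurable
  have hi: "integrable M (\<lambda>s. h s * indicator {..x} s)" for x
  proof (rule M.integrable_const_bound[where B = "\<bar>B\<bar>"])
    show "AE s in M. norm (h s * indicator {..x} s) \<le> \<bar>B\<bar>"
      using h(2) by (intro AE_I2) (force simp: indicator_def)
  qed measurable
  have hb: "norm (\<integral>s. norm (h s * indicator {..x} s) \<partial>M) \<le> \<bar>B\<bar> * measure M (space M)" for x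
  proof -
    have "(\<integral>s. norm (h s * indicator {..x} s) \<partial>M) \<le> (\<integral>s. \<bar>B\<bar> \<partial>M)"
      using hi h(2) by (intro integral_mono integrable_norm) (force simp: indicator_def)+
    then show ?thesis by (simp add: integral_nonneg_AE mult.commute)
  qed
  have fi: "integrable (L \<Otimes>\<^sub>M M) f"
  proof (rule P.Fubini_integrable[OF fm])
    show "AE x in L. integrable M (\<lambda>y. f (x, y))"
      using hi by (intro AE_I2) (simp add: f_def)
    have "integrable L (\<lambda>x. norm (g x) * (\<integral>y. norm (h y * indicator {..x} y) \<partial>M))"
    proof (rule Bochner_Integration.integrable_bound[where f = "\<lambda>x. g x * (\<bar>B\<bar> * measure M (space M))"])
      show "integrable L (\<lambda>x. g x * (\<bar>B\<bar> * measure M (space M)))" using gL by simp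
      have "(\<lambda>x. \<integral>y. norm (h y * indicator {..x} y) \<partial>M) \<in> borel_measurable L"
        by (rule M.borel_measurable_lebesgue_integral) (use ind in \<open>simp add: case_prod_beta\<close>)
      then show "(\<lambda>x. norm (g x) * (\<integral>y. norm (h y * indicator {..x} y) \<partial>M)) \<in> borel_measurable L"
        by measurable
      show "AE x in L. norm (norm (g x) * (\<integral>y. norm (h y * indicator {..x} y) \<partial>M))
          \<le> norm (g x * (\<bar>B\<bar> * measure M (space M)))"
        using hb by (intro AE_I2) (auto simp: norm_mult abs_mult intro!: mult_left_mono)
    qed
    then show "integrable L (\<lambda>x. \<integral>y. norm (f (x, y)) \<partial>M)"
      by (simp add: f_def norm_mult abs_mult)
  qed
  have inner: "(\<integral>y. f (x, y) \<partial>M) = g x * (\<integral>s. h s * indicator {..x} s \<partial>M)" for x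
    by (simp add: f_def)
  have I: "integrable L (\<lambda>x. g x * (\<integral>s. h s * indicator {..x} s \<partial>M))"
    using P.integrable_fst'[OF fi] by (simp add: inner)
  then show "(\<lambda>x. g x * (\<integral>s. h s * indicator {..x} s \<partial>M)) absolutely_integrable_on {0..1}"
    by (simp add: L_def lebesgue_on_Icc_integrable_iff)
  have outer: "(\<integral>x. f (x, s) \<partial>L) = h s * (G 1 - G s)" if "s \<in> space M" for s
  proof -
    have s: "s \<in> {0..1}" using that sp by auto
    have "(\<integral>x. f (x, s) \<partial>L) = h s * (\<integral>x. g x * indicator {s..1} x \<partial>L)"
      by (auto simp: f_def L_def indicator_def integral_mult_right_zero[symmetric]
        simp del: integral_mult_right_zero intro!: Bochner_Integration.integral_cong)
    also have "(\<integral>x. g x * indicator {s..1} x \<partial>L) = integral {s..1} g"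
    proof -
      have "(\<integral>x. g x * indicator {s..1} x \<partial>L) = (\<integral>x. indicator {0..1} x *\<^sub>R (g x * indicator {s..1} x) \<partial>lebesgue)"
        unfolding L_def by (rule integral_restrict_space) simp
      also have "\<dots> = (\<integral>x. indicator {s..1} x *\<^sub>R g x \<partial>lebesgue)"
        using s by (intro Bochner_Integration.integral_cong) (auto simp: indicator_def)
      also have "\<dots> = integral {s..1} g"
        using set_lebesgue_integral_eq_integral(2)[OF absolutely_integrable_on_subinterval[OF g, of s 1]] s
        by (simp add: set_lebesgue_integral_def)
      finally show ?thesis .
    qed
    also have "\<dots> = G 1 - G s" using G[OF s] by (rule integral_unique)
    finally show ?thesis .
  qed
  have "integral {0..1} (\<lambda>x. g x * (\<integral>s. h s * indicator {..x} s \<partial>M)) = (\<integral>x. (\<integral>y. f (x, y) \<partial>M) \<partial>L)"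
    using lebesgue_integral_eq_integral[OF I[unfolded L_def]] by (simp add: inner L_def)
  also have "\<dots> = (\<integral>y. (\<integral>x. f (x, y) \<partial>L) \<partial>M)"
    using P.Fubini_integral[of "\<lambda>x y. f (x, y)"] fi by (simp add: case_prod_beta')
  also have "\<dots> = (\<integral>s. h s * (G 1 - G s) \<partial>M)"
    using outer by (intro Bochner_Integration.integral_cong) auto
  finally show "integral {0..1} (\<lambda>x. g x * (\<integral>s. h s * indicator {..x} s \<partial>M)) = (\<integral>s. h s * (G 1 - G s) \<partial>M)" .
qed

section \<open>Test functions and weak derivatives\<close>

text \<open>Smoothness of finite order, defined by recursion on the order, supports the inductions
  for sums, products and affine substitutions.\<close>

primrec times_differentiable :: "nat \<Rightarrow> (real \<Rightarrow> real) \<Rightarrow> bool" where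
  "times_differentiable 0 f \<longleftrightarrow> True"
| "times_differentiable (Suc k) f \<longleftrightarrow>
     (\<forall>x. f field_differentiable (at x)) \<and> times_differentiable k (deriv f)"

lemma smooth_iff_times_differentiable:
  "(\<forall>n x. ((deriv ^^ n) f) field_differentiable (at x)) \<longleftrightarrow> (\<forall>k. times_differentiable k f)"
proof safe
  fix k assume "\<forall>n x. ((deriv ^^ n) f) field_differentiable (at x)"
  then show "times_differentiable k f"
  proof (induction k arbitrary: f)
    case (Suc k)
    have "\<forall>n x. ((deriv ^^ n) (deriv f)) field_differentiable (at x)"
      using Suc.prems by (metis funpow_simps_right(2) comp_apply)
    then show ?case using Suc.IH Suc.prems[rule_format, of 0] by auto
  qed simp
next
  fix n x assume "\<forall>k. times_differentiable k f"
  then show "((deriv ^^ n) f) field_differentiable (at x)"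
  proof (induction n arbitrary: f)
    case 0
    then show ?case by (metis funpow_0 times_differentiable.simps(2))
  next
    case (Suc n)
    have "\<forall>k. times_differentiable k (deriv f)" using Suc.prems by (metis times_differentiable.simps(2))
    then show ?case using Suc.IH by (metis funpow_simps_right(2) comp_apply)
  qed
qed

lemma times_differentiable_SucD: "times_differentiable (Suc k) f \<Longrightarrow> times_differentiable k f"
  by (induction k arbitrary: f) auto

lemma times_differentiable_add:
  "\<lbrakk>times_differentiable k f; times_differentiable k g\<rbrakk> \<Longrightarrow> times_differentiable k (\<lambda>x. f x + g x)"
proof (induction k arbitrary: f g)
  case (Suc k)
  then have "deriv (\<lambda>x. f x + g x) = (\<lambda>x. deriv f x + deriv g x)" by (intro ext deriv_add) auto
  then show ?case using Suc by (auto intro: field_differentiable_add)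
qed simp

lemma times_differentiable_mult:
  "\<lbrakk>times_differentiable k f; times_differentiable k g\<rbrakk> \<Longrightarrow> times_differentiable k (\<lambda>x. f x * g x)"
proof (induction k arbitrary: f g)
  case (Suc k)
  then have "deriv (\<lambda>x. f x * g x) = (\<lambda>x. f x * deriv g x + deriv f x * g x)"
    by (intro ext deriv_mult) auto
  moreover have "times_differentiable k f" "times_differentiable k g"
    using Suc.prems times_differentiable_SucD by blast+
  ultimately show ?case using Suc
    by (auto intro: field_differentiable_mult times_differentiable_add)
qed simp

lemma times_differentiable_const: "times_differentiable k (\<lambda>x. c)"
  by (induction k arbitrary: c) auto

lemma times_differentiable_affine:
  "times_differentiable k f \<Longrightarrow> times_differentiable k (\<lambda>x. f (c * x + d))"
proof (induction k arbitrary: f)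
  case (Suc k)
  have der: "((\<lambda>x. f (c * x + d)) has_field_derivative (c * deriv f (c * x + d))) (at x)" for x
  proof -
    have "(f has_field_derivative deriv f (c * x + d)) (at (c * x + d))"
      using Suc.prems by (simp add: DERIV_deriv_iff_field_differentiable)
    moreover have "((\<lambda>x. c * x + d) has_field_derivative c) (at x)"
      by (auto intro!: derivative_eq_intros)
    ultimately have "((\<lambda>x. f (c * x + d)) has_field_derivative (deriv f (c * x + d) * c)) (at x)"
      by (rule DERIV_chain2)
    then show ?thesis by (simp add: mult.commute)
  qed
  have "deriv (\<lambda>x. f (c * x + d)) = (\<lambda>x. c * deriv f (c * x + d))"
    using der by (intro ext DERIV_imp_deriv)
  then show ?case using Suc der
    by (auto simp: field_differentiable_def intro!: times_differentiable_mult times_differentiable_const)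
qed simp

text \<open>The functions \<open>p(1/x) exp(-1/x)\<close>, extended by 0, are closed under differentiation.\<close>

definition flat :: "real poly \<Rightarrow> real \<Rightarrow> real" where
  "flat p x = (if 0 < x then poly p (1 / x) * exp (- 1 / x) else 0)"

lemma poly_times_exp_tendsto_0: "((\<lambda>y. poly p y * exp (- y)) \<longlongrightarrow> (0::real)) at_top"
proof -
  have "((\<lambda>y. \<Sum>i\<le>degree p. coeff p i * (y ^ i / exp y)) \<longlongrightarrow> (\<Sum>i\<le>degree p. coeff p i * 0)) at_top"
    by (intro tendsto_sum tendsto_mult tendsto_const tendsto_power_div_exp_0)
  then show ?thesis
    by (simp add: poly_altdef exp_minus divide_inverse sum_distrib_right mult.assoc)
qed

text \<open>In the variable y = 1/x the derivative of p(y) exp(-y) with respect to x is y^2 (p -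
  p')(y) exp(-y); the polynomial \<open>[:0, 0, 1:]\<close> is y^2.\<close>

lemma flat_has_derivative: "(flat p has_field_derivative flat ([:0, 0, 1:] * (p - pderiv p)) x) (at x)"
proof -
  consider "x > 0" | "x < 0" | "x = 0" by linarith
  then show ?thesis
  proof cases
    case 1
    have "((\<lambda>x. poly p (1 / x) * exp (- 1 / x)) has_field_derivative
        poly p (1 / x) * (exp (- 1 / x) * (1 / x\<^sup>2)) + poly (pderiv p) (1 / x) * (- (1 / x\<^sup>2)) * exp (- 1 / x)) (at x)"
      using 1 by (auto intro!: derivative_eq_intros DERIV_chain2[OF poly_DERIV] simp: power2_eq_square field_simps)
    moreover have "\<forall>\<^sub>F z in nhds x. flat p z = poly p (1 / z) * exp (- 1 / z)"
      using eventually_nhds_in_open[of "{0<..}" x] 1 by (auto elim!: eventually_mono simp: flat_def)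
    ultimately show ?thesis using 1
      by (subst DERIV_cong_ev[OF refl _ refl]) (auto simp: flat_def power2_eq_square field_simps)
  next
    case 2
    have "\<forall>\<^sub>F z in nhds x. flat p z = 0"
      using eventually_nhds_in_open[of "{..<0}" x] 2 by (auto elim!: eventually_mono simp: flat_def)
    then show ?thesis using 2
      by (subst DERIV_cong_ev[OF refl _ refl, of _ "\<lambda>_. 0"]) (auto simp: flat_def)
  next
    case 3
    \<comment> \<open>Dividing by h multiplies by y = 1/h, which turns p into
      \<open>pCons 0 p\<close>; the difference quotient at 0 is thus again a polynomial in y times
      exp(-y).\<close>
    have "((\<lambda>h. poly (pCons 0 p) (inverse h) * exp (- inverse h)) \<longlongrightarrow> 0) (at_right 0)"
      by (rule filterlim_compose[OF poly_times_exp_tendsto_0 filterlim_inverse_at_top_right])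
    then have "((\<lambda>h. flat p h / h) \<longlongrightarrow> 0) (at_right 0)"
      by (rule Lim_transform_eventually)
        (auto simp: eventually_at_filter flat_def divide_inverse algebra_simps)
    moreover have "((\<lambda>h. flat p h / h) \<longlongrightarrow> 0) (at_left 0)"
      by (rule Lim_transform_eventually[OF tendsto_const])
        (auto simp: eventually_at_filter flat_def)
    ultimately have "((\<lambda>h. flat p h / h) \<longlongrightarrow> 0) (at 0)"
      using filterlim_split_at by blast
    then show ?thesis using 3 by (simp add: DERIV_def flat_def)
  qed
qed

lemma times_differentiable_flat: "times_differentiable k (flat p)"
proof (induction k arbitrary: p)
  case (Suc k)
  have "deriv (flat p) = flat ([:0, 0, 1:] * (p - pderiv p))"
    using flat_has_derivative by (intro ext DERIV_imp_deriv)
  then show ?case using Suc flat_has_derivative unfolding times_differentiable.simps field_differentiable_def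
    by metis
qed simp

text \<open>For c > 0 this is positive exactly on (\<alpha>, \<beta>). The factor c steepens both
  flanks, so that for large c the values inside approach 1.\<close>

definition bump :: "real \<Rightarrow> real \<Rightarrow> real \<Rightarrow> real \<Rightarrow> real" where
  "bump c \<alpha> \<beta> x = flat 1 (c * (x - \<alpha>)) * flat 1 (c * (\<beta> - x))"

lemma times_differentiable_bump: "times_differentiable k (bump c \<alpha> \<beta>)"
proof -
  have "times_differentiable k (\<lambda>x. flat 1 (c * x + (- c * \<alpha>)) * flat 1 ((- c) * x + c * \<beta>))"
    by (intro times_differentiable_mult times_differentiable_affine times_differentiable_flat)
  then show ?thesis by (simp add: bump_def[abs_def] algebra_simps)
qed

lemma flat_1: "flat 1 x = (if 0 < x then exp (- 1 / x) else 0)"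
  by (simp add: flat_def)

lemma bump_bounds: "0 \<le> bump c \<alpha> \<beta> x" "bump c \<alpha> \<beta> x \<le> 1"
  by (auto simp: bump_def flat_1 intro!: mult_le_one)

lemma bump_outside: "0 < c \<Longrightarrow> x \<notin> {\<alpha><..<\<beta>} \<Longrightarrow> bump c \<alpha> \<beta> x = 0"
  by (auto simp: bump_def flat_1 zero_less_mult_iff)

lemma times_differentiable_continuous:
  assumes "\<And>k. times_differentiable k f"
  shows "continuous_on A f"
proof -
  have "f field_differentiable (at x)" for x using assms[of 1] by simp
  then show ?thesis
    by (intro continuous_at_imp_continuous_on ballI field_differentiable_imp_continuous_at)
qed

text \<open>The vanishing mean makes the antiderivative return to 0 to the right of the support.
  This supplies test functions with prescribed derivative for the du Bois-Reymond argument.\<close>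

lemma test_function_antiderivative:
  assumes smooth: "\<And>k. times_differentiable k \<eta>" and cd: "0 < c" "c \<le> d" "d < 1"
    and supp: "\<And>x. x \<notin> {c..d} \<Longrightarrow> \<eta> x = 0" and zero: "integral {0..1} \<eta> = 0"
  shows "test_function (\<lambda>x. integral {0..x} \<eta>)" "deriv (\<lambda>x. integral {0..x} \<eta>) = \<eta>"
proof -
  define \<phi> where "\<phi> x = integral {0..x} \<eta>" for x
  have cont: "continuous_on A \<eta>" for A using times_differentiable_continuous smooth by blast
  have int: "\<eta> integrable_on {x..y}" for x y by (intro integrable_continuous_interval cont)
  have low: "\<phi> x = 0" if "x < c" for x
  proof -
    have "integral {0..x} \<eta> = integral {0..x} (\<lambda>_. 0)"
      using supp that by (intro integral_cong) auto
    then show ?thesis by (simp add: \<phi>_def)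
  qed
  have high: "\<phi> x = 0" if "x > d" for x
  proof -
    have z: "integral {y..z} \<eta> = 0" if "d < y" for y z
    proof -
      have "integral {y..z} \<eta> = integral {y..z} (\<lambda>_. 0)"
        using supp that by (intro integral_cong) auto
      then show ?thesis by simp
    qed
    show ?thesis
    proof (cases "x \<le> 1")
      case True
      have "integral {0..x} \<eta> + integral {x..1} \<eta> = integral {0..1} \<eta>"
        using True that cd by (intro Henstock_Kurzweil_Integration.integral_combine int) auto
      then show ?thesis using z[OF that] zero by (simp add: \<phi>_def)
    next
      case False
      have "integral {0..1} \<eta> + integral {1..x} \<eta> = integral {0..x} \<eta>"
        using False that cd by (intro Henstock_Kurzweil_Integration.integral_combine int) auto
      then show ?thesis using z[of 1] cd zero by (simp add: \<phi>_def)
    qed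
  qed
  have der: "(\<phi> has_field_derivative \<eta> x) (at x)" for x
  proof -
    consider "x < c" | "x > d" | "x \<in> {0<..<1}" using cd by force
    then show ?thesis
    proof cases
      case 1
      have "\<forall>\<^sub>F z in nhds x. \<phi> z = 0"
        using eventually_nhds_in_open[of "{..<c}" x] 1 low by (auto elim!: eventually_mono)
      then show ?thesis using 1 supp[of x]
        by (subst DERIV_cong_ev[OF refl _ refl, of _ "\<lambda>_. 0"]) auto
    next
      case 2
      have "\<forall>\<^sub>F z in nhds x. \<phi> z = 0"
        using eventually_nhds_in_open[of "{d<..}" x] 2 high by (auto elim!: eventually_mono)
      then show ?thesis using 2 supp[of x]
        by (subst DERIV_cong_ev[OF refl _ refl, of _ "\<lambda>_. 0"]) auto
    next
      case 3
      have "(\<phi> has_real_derivative \<eta> x) (at x within {0..1})"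
        unfolding \<phi>_def using 3 by (intro integral_has_real_derivative cont) auto
      then show ?thesis using 3 by (simp add: at_within_Icc_at)
    qed
  qed
  then have d: "deriv \<phi> = \<eta>" by (intro ext DERIV_imp_deriv)
  then show "deriv (\<lambda>x. integral {0..x} \<eta>) = \<eta>" by (simp add: \<phi>_def[abs_def])
  have "times_differentiable k \<phi>" for k
  proof (cases k)
    case (Suc j)
    then show ?thesis using der smooth[of j] d by (auto simp: field_differentiable_def)
  qed simp
  then have "test_function \<phi>"
    unfolding test_function_def smooth_iff_times_differentiable
    using low high cd by (intro conjI exI[of _ c] exI[of _ d]) (auto simp: not_le)
  then show "test_function (\<lambda>x. integral {0..x} \<eta>)" by (simp add: \<phi>_def[abs_def])
qed

lemma test_functionD:
  assumes "test_function \<phi>"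
  shows "\<And>x. (\<phi> has_field_derivative deriv \<phi> x) (at x)" "continuous_on A \<phi>" "continuous_on A (deriv \<phi>)"
    "\<phi> 0 = 0" "\<phi> 1 = 0"
proof -
  have td: "times_differentiable k \<phi>" for k
    using assms smooth_iff_times_differentiable by (auto simp: test_function_def)
  show "(\<phi> has_field_derivative deriv \<phi> x) (at x)" for x
    using td[of 1] by (simp add: DERIV_deriv_iff_field_differentiable)
  show "continuous_on A \<phi>" using times_differentiable_continuous td by blast
  have "times_differentiable k (deriv \<phi>)" for k using td[of "Suc k"] by simp
  then show "continuous_on A (deriv \<phi>)" using times_differentiable_continuous by blast
  show "\<phi> 0 = 0" "\<phi> 1 = 0" using assms by (auto simp: test_function_def)
qed

text \<open>The margins (\<beta> - \<alpha>) / (n + 3) keep the support compact inside (0,1) even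
  for \<alpha> = 0 or \<beta> = 1; with 3 in the denominator the two margins together never fill the
  interval.\<close>

lemma bump_tendsto_indicator:
  assumes "\<alpha> < \<beta>"
  shows "(\<lambda>n. bump (real (Suc n)) (\<alpha> + (\<beta> - \<alpha>) / (n + 3)) (\<beta> - (\<beta> - \<alpha>) / (n + 3)) x)
    \<longlonglongrightarrow> indicator {\<alpha><..<\<beta>} x"
proof (cases "x \<in> {\<alpha><..<\<beta>}")
  case False
  have "bump (real (Suc n)) (\<alpha> + (\<beta> - \<alpha>) / (n + 3)) (\<beta> - (\<beta> - \<alpha>) / (n + 3)) x = 0" for n
  proof (rule bump_outside)
    have "0 < (\<beta> - \<alpha>) / (n + 3)" using assms by simp
    then show "x \<notin> {\<alpha> + (\<beta> - \<alpha>) / (n + 3)<..<\<beta> - (\<beta> - \<alpha>) / (n + 3)}" using False by auto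
  qed simp
  then show ?thesis using False by simp
next
  case True
  have inv: "(\<lambda>n. 1 / (real n + 3)) \<longlonglongrightarrow> 0" by real_asymp
  have one: "(\<lambda>n. flat 1 (real (Suc n) * y n)) \<longlonglongrightarrow> 1" if y: "y \<longlonglongrightarrow> l" "0 < l" for y l
  proof -
    have "filterlim (\<lambda>n. y n * real (Suc n)) at_top sequentially"
      by (rule filterlim_tendsto_pos_mult_at_top[OF y]) real_asymp
    then have at: "filterlim (\<lambda>n. real (Suc n) * y n) at_top sequentially" by (simp add: mult.commute)
    have "(\<lambda>n. exp (- inverse (real (Suc n) * y n))) \<longlonglongrightarrow> exp (- 0)"
      by (intro tendsto_exp tendsto_minus tendsto_inverse_0_at_top at)
    moreover have "\<forall>\<^sub>F n in sequentially. real (Suc n) * y n > 0"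
      using at by (simp add: filterlim_at_top_dense)
    then have "\<forall>\<^sub>F n in sequentially. exp (- inverse (real (Suc n) * y n)) = flat 1 (real (Suc n) * y n)"
      by eventually_elim (simp add: flat_1 divide_inverse)
    ultimately show ?thesis by (simp add: Lim_transform_eventually)
  qed
  have "(\<lambda>n. x - (\<alpha> + (\<beta> - \<alpha>) * (1 / (real n + 3)))) \<longlonglongrightarrow> x - (\<alpha> + (\<beta> - \<alpha>) * 0)"
    "(\<lambda>n. (\<beta> - (\<beta> - \<alpha>) * (1 / (real n + 3))) - x) \<longlonglongrightarrow> (\<beta> - (\<beta> - \<alpha>) * 0) - x"
    by (intro tendsto_intros inv)+
  then have "(\<lambda>n. flat 1 (real (Suc n) * (x - (\<alpha> + (\<beta> - \<alpha>) * (1 / (real n + 3)))))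
      * flat 1 (real (Suc n) * ((\<beta> - (\<beta> - \<alpha>) * (1 / (real n + 3))) - x))) \<longlonglongrightarrow> 1 * 1"
    using True by (intro tendsto_mult one) auto
  then show ?thesis using True by (simp add: bump_def)
qed

section \<open>The lemma of du Bois-Reymond\<close>

abbreviation unit_lebesgue :: "real measure" where "unit_lebesgue \<equiv> lebesgue_on {0<..<1}"

lemma unit_lebesgue_integrable_iff:
  "integrable unit_lebesgue g \<longleftrightarrow> g absolutely_integrable_on {0..1}" for g :: "real \<Rightarrow> real"
proof -
  have "integrable unit_lebesgue g \<longleftrightarrow> g absolutely_integrable_on {0<..<1}"
    by (simp add: integrable_restrict_space set_integrable_def)
  then show ?thesis by (simp add: absolutely_integrable_on_def integrable_on_open_interval_real)
qed

lemma unit_lebesgue_integral: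
  fixes g :: "real \<Rightarrow> real"
  assumes "g absolutely_integrable_on {0..1}"
  shows "integral\<^sup>L unit_lebesgue g = integral {0..1} g"
  using lebesgue_integral_eq_integral[of "{0<..<1}" g] assms unit_lebesgue_integrable_iff[of g]
  by (simp add: integral_open_interval_real)

lemma continuous_mult_absolutely_integrable:
  fixes f g :: "real \<Rightarrow> real"
  assumes "continuous_on {0..1} f" "g absolutely_integrable_on {0..1}"
  shows "(\<lambda>x. f x * g x) absolutely_integrable_on {0..1}"
  using assms by (intro absolutely_integrable_bounded_measurable_product_real)
    (auto intro!: continuous_imp_measurable_on_sets_lebesgue compact_imp_bounded compact_continuous_image)

lemma continuous_absolutely_integrable_unit:
  "continuous_on {0..1::real} f \<Longrightarrow> f absolutely_integrable_on {0..1}" for f :: "real \<Rightarrow> real"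
  by (rule absolutely_integrable_continuous_real)

lemma finite_measure_unit_lebesgue: "finite_measure unit_lebesgue"
  by (intro finite_measure_lebesgue_on) auto

lemma integral_bump_pos: "0 < integral {0..1} (bump 1 (1/4) (3/4))"
proof -
  let ?f = "bump 1 (1/4) (3/4)"
  have c: "continuous_on {0..1} ?f" by (intro times_differentiable_continuous times_differentiable_bump)
  have "0 \<le> integral {0..1} ?f"
    by (intro integral_nonneg integrable_continuous_interval c bump_bounds)
  moreover have "?f (1/2) > 0" by (simp add: bump_def flat_1)
  then have "integral {0..1} ?f \<noteq> 0"
    using integral_eq_0_iff[OF c] bump_bounds by (auto intro!: bexI[of _ "1/2"])
  ultimately show ?thesis by simp
qed

text \<open>The constant is the mean of z weighted by one fixed bump. Any other bump minus a
  multiple of the fixed one has mean 0, hence is the derivative of a test function; so z - c is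
  orthogonal to every bump in (0,1), and in the limit to the indicator of every interval.\<close>

lemma du_bois_reymond_intervals:
  fixes z :: "real \<Rightarrow> real"
  assumes z: "z absolutely_integrable_on {0..1}"
    and orth: "\<And>\<phi>. test_function \<phi> \<Longrightarrow> (\<integral>x. z x * deriv \<phi> x \<partial>unit_lebesgue) = 0"
  shows "\<exists>c. \<forall>\<alpha> \<beta>. 0 \<le> \<alpha> \<longrightarrow> \<alpha> < \<beta> \<longrightarrow> \<beta> \<le> 1 \<longrightarrow>
    (\<integral>x. (z x - c) * indicator {\<alpha><..<\<beta>} x \<partial>unit_lebesgue) = 0"
proof -
  interpret finite_measure unit_lebesgue by (rule finite_measure_unit_lebesgue)
  let ?b = "bump 1 (1/4) (3/4)"
  define I0 where "I0 = integral {0..1} ?b"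
  define c where "c = (\<integral>x. z x * ?b x \<partial>unit_lebesgue) / I0"
  have I0: "I0 > 0" using integral_bump_pos by (simp add: I0_def)
  have bc: "continuous_on {0..1} (bump k \<alpha> \<beta>)" for k \<alpha> \<beta>
    by (intro times_differentiable_continuous times_differentiable_bump)
  have bi: "integrable unit_lebesgue (bump k \<alpha> \<beta>)" for k \<alpha> \<beta>
    by (simp add: unit_lebesgue_integrable_iff bc continuous_absolutely_integrable_unit)
  have zi: "integrable unit_lebesgue z" using z by (simp add: unit_lebesgue_integrable_iff)
  have zb: "integrable unit_lebesgue (\<lambda>x. z x * bump k \<alpha> \<beta> x)" for k \<alpha> \<beta>
    using continuous_mult_absolutely_integrable[OF bc z]
    by (simp add: unit_lebesgue_integrable_iff mult.commute)
  have bump0: "(\<integral>x. (z x - c) * bump k \<alpha> \<beta> x \<partial>unit_lebesgue) = 0" if ab: "0 < k" "0 < \<alpha>" "\<alpha> < \<beta>" "\<beta> < 1" for k \<alpha> \<beta>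
  proof -
    define I where "I = integral {0..1} (bump k \<alpha> \<beta>)"
    \<comment> \<open>The multiple of the fixed bump is chosen so that the mean of \<eta> is I - (I
      / I0) I0 = 0.\<close>
    define \<eta> where "\<eta> x = bump k \<alpha> \<beta> x + (- (I / I0)) * ?b x" for x
    have sm: "times_differentiable n \<eta>" for n
      unfolding \<eta>_def[abs_def]
      by (intro times_differentiable_add times_differentiable_mult times_differentiable_const times_differentiable_bump)
    have supp: "\<eta> x = 0" if "x \<notin> {min \<alpha> (1/4)..max \<beta> (3/4)}" for x
      unfolding \<eta>_def using ab that by (subst (1 2) bump_outside) auto
    have bint: "bump k' \<alpha>' \<beta>' integrable_on {0..1}" for k' \<alpha>' \<beta>'
      by (intro integrable_continuous_interval bc)
    have "integral {0..1} (\<lambda>x. bump k \<alpha> \<beta> x + q * ?b x) = I + q * I0" for q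
      unfolding I_def I0_def
      by (subst Henstock_Kurzweil_Integration.integral_add) (auto intro: integrable_on_mult_right bint)
    then have "integral {0..1} \<eta> = I + (- (I / I0)) * I0" unfolding \<eta>_def .
    then have zero: "integral {0..1} \<eta> = 0" using I0 by simp
    have T: "test_function (\<lambda>x. integral {0..x} \<eta>)" "deriv (\<lambda>x. integral {0..x} \<eta>) = \<eta>"
      by (rule test_function_antiderivative[OF sm _ _ _ supp zero]; use ab in simp)+
    have "0 = (\<integral>x. z x * \<eta> x \<partial>unit_lebesgue)" using orth[OF T(1)] T(2) by simp
    also have "\<dots> = (\<integral>x. z x * bump k \<alpha> \<beta> x + (- (I / I0)) * (z x * ?b x) \<partial>unit_lebesgue)"
      by (simp add: \<eta>_def algebra_simps)
    also have "\<dots> = (\<integral>x. z x * bump k \<alpha> \<beta> x \<partial>unit_lebesgue) + (- (I / I0)) * (c * I0)"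
    proof (subst Bochner_Integration.integral_add)
      show "integrable unit_lebesgue (\<lambda>x. (- (I / I0)) * (z x * ?b x))"
        by (intro Bochner_Integration.integrable_mult_right zb)
    qed (use I0 zb in \<open>simp_all add: c_def\<close>)
    finally have "(\<integral>x. z x * bump k \<alpha> \<beta> x \<partial>unit_lebesgue) = c * I" using I0 by simp
    moreover have "I = integral\<^sup>L unit_lebesgue (bump k \<alpha> \<beta>)"
      by (simp add: I_def unit_lebesgue_integral bc continuous_absolutely_integrable_unit)
    moreover have "(\<integral>x. (z x - c) * bump k \<alpha> \<beta> x \<partial>unit_lebesgue)
       = (\<integral>x. z x * bump k \<alpha> \<beta> x \<partial>unit_lebesgue) - c * integral\<^sup>L unit_lebesgue (bump k \<alpha> \<beta>)"
      using zb bi by (simp add: left_diff_distrib)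
    ultimately show ?thesis by simp
  qed
  have "(\<integral>x. (z x - c) * indicator {\<alpha><..<\<beta>} x \<partial>unit_lebesgue) = 0" if ab: "0 \<le> \<alpha>" "\<alpha> < \<beta>" "\<beta> \<le> 1" for \<alpha> \<beta>
  proof -
    define B where "B n = bump (real (Suc n)) (\<alpha> + (\<beta> - \<alpha>) / (n + 3)) (\<beta> - (\<beta> - \<alpha>) / (n + 3))" for n
    have "(\<lambda>n. \<integral>x. (z x - c) * B n x \<partial>unit_lebesgue) \<longlonglongrightarrow> (\<integral>x. (z x - c) * indicator {\<alpha><..<\<beta>} x \<partial>unit_lebesgue)"
    proof (rule integral_dominated_convergence[where w = "\<lambda>x. \<bar>z x - c\<bar>"])
      show "(\<lambda>x. (z x - c) * indicator {\<alpha><..<\<beta>} x) \<in> borel_measurable unit_lebesgue"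
      proof (intro borel_measurable_times borel_measurable_diff borel_measurable_integrable[OF zi] borel_measurable_const)
        show "indicator {\<alpha><..<\<beta>} \<in> borel_measurable unit_lebesgue"
          by (intro measurable_restrict_space1 measurable_completion) simp
      qed
      show "(\<lambda>x. (z x - c) * B n x) \<in> borel_measurable unit_lebesgue" for n
        unfolding B_def using zi bi by (intro borel_measurable_times borel_measurable_diff borel_measurable_integrable) auto
      show "integrable unit_lebesgue (\<lambda>x. \<bar>z x - c\<bar>)" using zi by auto
      show "AE x in unit_lebesgue. (\<lambda>n. (z x - c) * B n x) \<longlonglongrightarrow> (z x - c) * indicator {\<alpha><..<\<beta>} x"
        unfolding B_def using bump_tendsto_indicator[OF ab(2)] by (intro AE_I2 tendsto_mult tendsto_const)
      show "AE x in unit_lebesgue. norm ((z x - c) * B n x) \<le> \<bar>z x - c\<bar>" for n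
        unfolding B_def using bump_bounds by (intro AE_I2) (simp add: abs_mult mult_left_le)
    qed
    moreover have "(\<integral>x. (z x - c) * B n x \<partial>unit_lebesgue) = 0" for n
    proof -
      define d where "d = (\<beta> - \<alpha>) / (n + 3)"
      have d: "0 < d" using ab by (simp add: d_def)
      have "d < (\<beta> - \<alpha>) / 2" unfolding d_def using ab by (intro divide_strict_left_mono) auto
      then have "2 * d < \<beta> - \<alpha>" by simp
      then show ?thesis unfolding B_def d_def[symmetric] using d ab by (intro bump0) auto
    qed
    ultimately show ?thesis by (simp add: LIMSEQ_const_iff)
  qed
  then show ?thesis by blast
qed

lemma integral_interval_unit_lebesgue:
  fixes w :: "real \<Rightarrow> real"
  assumes w: "w absolutely_integrable_on {0..1}" and ab: "0 \<le> \<alpha>" "\<alpha> \<le> \<beta>" "\<beta> \<le> 1"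
  shows "(\<integral>x. w x * indicator {\<alpha><..<\<beta>} x \<partial>unit_lebesgue) = integral {\<alpha>..\<beta>} w"
proof -
  have "(\<integral>x. w x * indicator {\<alpha><..<\<beta>} x \<partial>unit_lebesgue)
      = (\<integral>x. indicator {0<..<1} x *\<^sub>R (w x * indicator {\<alpha><..<\<beta>} x) \<partial>lebesgue)"
    by (rule integral_restrict_space) simp
  also have "\<dots> = (\<integral>x. indicator {\<alpha><..<\<beta>} x *\<^sub>R w x \<partial>lebesgue)"
    using ab by (intro Bochner_Integration.integral_cong) (auto simp: indicator_def)
  also have "\<dots> = integral {\<alpha><..<\<beta>} w"
  proof -
    have "w absolutely_integrable_on {\<alpha>..\<beta>}"
      using absolutely_integrable_on_subinterval[OF w] ab by auto
    then have "w absolutely_integrable_on {\<alpha><..<\<beta>}"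
      by (simp add: absolutely_integrable_on_def integrable_on_open_interval_real)
    then show ?thesis using set_lebesgue_integral_eq_integral(2)[of "{\<alpha><..<\<beta>}" w] by (simp add: set_lebesgue_integral_def)
  qed
  finally show ?thesis by (simp add: integral_open_interval_real)
qed

text \<open>The primitive of z - c vanishes identically and can be differentiated at each point of
  [0,1]. Equality everywhere is what is wanted here, because \<open>\<rho>\<close> can charge
  Lebesgue null sets.\<close>

lemma du_bois_reymond_continuous:
  assumes z: "continuous_on {0..1} z"
    and orth: "\<And>\<phi>. test_function \<phi> \<Longrightarrow> (\<integral>x. z x * deriv \<phi> x \<partial>unit_lebesgue) = 0"
    and x: "x \<in> {0..1}"
  shows "z x = z 0"
proof -
  obtain c where c: "\<And>\<alpha> \<beta>. 0 \<le> \<alpha> \<Longrightarrow> \<alpha> < \<beta> \<Longrightarrow> \<beta> \<le> 1 \<Longrightarrow>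
    (\<integral>x. (z x - c) * indicator {\<alpha><..<\<beta>} x \<partial>unit_lebesgue) = 0"
    using du_bois_reymond_intervals[OF continuous_absolutely_integrable_unit[OF z] orth] by blast
  have wc: "continuous_on {0..1} (\<lambda>x. z x - c)" by (intro continuous_intros z)
  have zero: "integral {0..x} (\<lambda>x. z x - c) = 0" if "x \<in> {0..1}" for x
  proof (cases "x = 0")
    case False
    then show ?thesis
      using integral_interval_unit_lebesgue[OF continuous_absolutely_integrable_unit[OF wc], of 0 x] c[of 0 x] that
      by auto
  qed simp
  have "z x = c" if x: "x \<in> {0..1}" for x
  proof -
    have "((\<lambda>x. integral {0..x} (\<lambda>x. z x - c)) has_vector_derivative (z x - c)) (at x within {0..1})"
      using integral_has_vector_derivative[OF wc x] .
    moreover have "((\<lambda>x. integral {0..x} (\<lambda>x. z x - c)) has_vector_derivative 0) (at x within {0..1})"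
      by (rule has_vector_derivative_transform[OF x _ has_vector_derivative_const]) (use zero in auto)
    ultimately have "z x - c = 0"
      using vector_derivative_unique_within_closed_interval[of 0 1 x _ "z x - c" 0] x by simp
    then show ?thesis by simp
  qed
  then show ?thesis using x by simp
qed

text \<open>The measures whose densities are the positive and the negative part of z - c are finite
  and agree on all rays, hence coincide; so the two parts agree almost everywhere and both
  vanish.\<close>

lemma du_bois_reymond:
  fixes z :: "real \<Rightarrow> real"
  assumes z: "z absolutely_integrable_on {0..1}"
    and orth: "\<And>\<phi>. test_function \<phi> \<Longrightarrow> (\<integral>x. z x * deriv \<phi> x \<partial>unit_lebesgue) = 0"
  shows "\<exists>c. AE x in unit_lebesgue. z x = c"
proof -
  interpret finite_measure unit_lebesgue by (rule finite_measure_unit_lebesgue)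
  obtain c where c: "\<And>\<alpha> \<beta>. 0 \<le> \<alpha> \<Longrightarrow> \<alpha> < \<beta> \<Longrightarrow> \<beta> \<le> 1 \<Longrightarrow>
    (\<integral>x. (z x - c) * indicator {\<alpha><..<\<beta>} x \<partial>unit_lebesgue) = 0"
    using du_bois_reymond_intervals[OF z orth] by blast
  have "integrable unit_lebesgue (\<lambda>x. z x - c)" using z unit_lebesgue_integrable_iff by auto
  then have w0: "integrable lebesgue (\<lambda>x. indicator {0<..<1} x * (z x - c))"
    by (simp add: integrable_restrict_space)
  define w where "w x = indicator {0<..<1} x * (z x - c)" for x
  have wi: "integrable lebesgue w" using w0 by (simp add: w_def[abs_def])
  \<comment> \<open>The uniqueness theorems for measures and densities are applied on Borel sets, so
    the Lebesgue measurable w is exchanged for a Borel version.\<close>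
  obtain v where v: "v \<in> borel_measurable lborel" "AE x in lborel. w x = v x"
    using completion_ex_borel_measurable_real[OF borel_measurable_integrable[OF wi]] by blast
  have vm: "v \<in> borel_measurable lebesgue" using v(1) by (rule measurable_completion)
  have vi: "integrable lborel v"
  proof -
    have "integrable lebesgue v"
      using integrable_cong_AE[OF borel_measurable_integrable[OF wi] vm AE_completion[OF v(2)]] wi by simp
    then show ?thesis using v(1) by (simp add: integrable_completion)
  qed
  have int0: "(\<integral>x. v x * indicator {t<..} x \<partial>lborel) = 0" for t
  proof -
    have "(\<integral>x. v x * indicator {t<..} x \<partial>lborel) = (\<integral>x. v x * indicator {t<..} x \<partial>lebesgue)"
      using v(1) by (intro integral_completion[symmetric]) simp
    also have "\<dots> = (\<integral>x. w x * indicator {t<..} x \<partial>lebesgue)"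
    proof (rule integral_cong_AE)
      show "AE x in lebesgue. v x * indicator {t<..} x = w x * indicator {t<..} x"
        using AE_completion[OF v(2)] by eventually_elim simp
    qed (intro borel_measurable_times borel_measurable_indicator vm borel_measurable_integrable[OF wi], simp_all)+
    also have "\<dots> = (\<integral>x. indicator {0<..<1} x *\<^sub>R ((z x - c) * indicator {max 0 t<..<1} x) \<partial>lebesgue)"
      by (intro Bochner_Integration.integral_cong) (auto simp: w_def indicator_def)
    also have "\<dots> = (\<integral>x. (z x - c) * indicator {max 0 t<..<1} x \<partial>unit_lebesgue)"
      by (rule integral_restrict_space[symmetric]) simp
    also have "\<dots> = 0"
      using c[of "max 0 t" 1] by (cases "max 0 t < 1") auto
    finally show ?thesis .
  qed
  let ?P = "\<lambda>x. ennreal (max 0 (v x))" and ?N = "\<lambda>x. ennreal (max 0 (- v x))"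
  have Pi: "integrable lborel (\<lambda>x. max 0 (v x) * indicator {t<..} x)" "integrable lborel (\<lambda>x. max 0 (- v x) * indicator {t<..} x)" for t
    using vi by (auto intro!: integrable_real_mult_indicator)
  have eP: "emeasure (density lborel ?P) {t<..} = ennreal (\<integral>x. max 0 (v x) * indicator {t<..} x \<partial>lborel)" for t
  proof -
    have "emeasure (density lborel ?P) {t<..} = (\<integral>\<^sup>+x. ennreal (max 0 (v x) * indicator {t<..} x) \<partial>lborel)"
      using v(1) by (subst emeasure_density) (auto intro!: nn_integral_cong simp: indicator_def)
    then show ?thesis using nn_integral_eq_integral[OF Pi(1)] by simp
  qed
  have eN: "emeasure (density lborel ?N) {t<..} = ennreal (\<integral>x. max 0 (- v x) * indicator {t<..} x \<partial>lborel)" for t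
  proof -
    have "emeasure (density lborel ?N) {t<..} = (\<integral>\<^sup>+x. ennreal (max 0 (- v x) * indicator {t<..} x) \<partial>lborel)"
      using v(1) by (subst emeasure_density) (auto intro!: nn_integral_cong simp: indicator_def)
    then show ?thesis using nn_integral_eq_integral[OF Pi(2)] by simp
  qed
  have "density lborel ?P = density lborel ?N"
  proof (rule measure_eqI_lessThan)
    fix t :: real
    have "(\<integral>x. max 0 (v x) * indicator {t<..} x \<partial>lborel) - (\<integral>x. max 0 (- v x) * indicator {t<..} x \<partial>lborel)
       = (\<integral>x. v x * indicator {t<..} x \<partial>lborel)"
      by (subst Bochner_Integration.integral_diff[symmetric, OF Pi])
        (auto intro!: Bochner_Integration.integral_cong simp: max_def)
    then have eq: "(\<integral>x. max 0 (v x) * indicator {t<..} x \<partial>lborel) = (\<integral>x. max 0 (- v x) * indicator {t<..} x \<partial>lborel)"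
      using int0[of t] by simp
    show "emeasure (density lborel ?P) {t<..} = emeasure (density lborel ?N) {t<..}"
      unfolding eP eN eq ..
    show "emeasure (density lborel ?P) {t<..} < \<infinity>" unfolding eP by simp
  qed auto
  moreover have "integral\<^sup>N lborel ?P \<noteq> \<infinity>"
    using vi nn_integral_eq_integral[of lborel "\<lambda>x. max 0 (v x)"] by simp
  ultimately have "AE x in lborel. ?P x = ?N x"
    using v(1) by (subst finite_density_unique[symmetric]) auto
  then have "AE x in lborel. w x = 0" using v(2)
    by eventually_elim (auto simp: max_def split: if_splits)
  then have "AE x in lebesgue. w x = 0" by (rule AE_completion)
  then have "AE x in unit_lebesgue. z x = c"
    by (subst AE_restrict_space_iff) (auto simp: w_def elim!: eventually_mono)
  then show ?thesis by blast
qed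

section \<open>Sobolev functions as absolutely continuous functions\<close>

lemma test_function_integral:
  assumes "test_function \<phi>" "0 \<le> x" "x \<le> y"
  shows "(deriv \<phi> has_integral (\<phi> y - \<phi> x)) {x..y}"
  using assms test_functionD(1)[OF assms(1)]
  by (intro fundamental_theorem_of_calculus) (auto simp: has_real_derivative_iff_has_vector_derivative[symmetric]
      intro: has_field_derivative_at_within)

text \<open>An instance of \<open>fubini_tail\<close> for Lebesgue measure and h = \<phi>': the tail
  of \<phi>' is \<phi> itself, and the term with G 1 disappears because \<phi> vanishes at both
  ends.\<close>

lemma integration_by_parts_test:
  assumes phi: "test_function \<phi>" and g: "g absolutely_integrable_on {0..1}"
    and G: "\<And>x. x \<in> {0..1} \<Longrightarrow> (g has_integral (G x - G 0)) {0..x}" and Gc: "continuous_on {0..1} G"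
  shows "integral {0..1} (\<lambda>x. G x * deriv \<phi> x) = - integral {0..1} (\<lambda>x. g x * \<phi> x)"
proof -
  let ?M = "lebesgue_on {0..1::real}"
  note D = test_functionD[OF phi]
  have gi: "g integrable_on {0..1}" using G[of 1] by auto
  have G': "(g has_integral (G 1 - G s)) {s..1}" if s: "s \<in> {0..1}" for s
  proof -
    have "integral {0..s} g + integral {s..1} g = integral {0..1} g"
      using s gi by (intro Henstock_Kurzweil_Integration.integral_combine) auto
    moreover have "integral {0..s} g = G s - G 0" "integral {0..1} g = G 1 - G 0"
      using G s by (auto intro!: integral_unique)
    moreover have "g integrable_on {s..1}" using gi s integrable_on_subinterval[of g "{0..1}" s 1] by auto
    ultimately show ?thesis by (simp add: has_integral_iff)
  qed
  obtain B where B: "\<And>s. s \<in> {0..1} \<Longrightarrow> \<bar>deriv \<phi> s\<bar> \<le> B"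
    using compact_imp_bounded[OF compact_continuous_image[OF D(3)[of "{0..1}"]]]
    by (auto simp: bounded_iff simp del: atLeastAtMost_iff)
  have "integral {0..1} (\<lambda>x. g x * (\<integral>s. deriv \<phi> s * indicator {..x} s \<partial>?M))
      = (\<integral>s. deriv \<phi> s * (G 1 - G s) \<partial>?M)"
  proof (rule fubini_tail[OF finite_measure_lebesgue_on _ _ _ B g G'])
    show "(\<lambda>s. s) \<in> borel_measurable ?M"
      by (intro measurable_restrict_space1 measurable_completion) simp
    show "deriv \<phi> \<in> borel_measurable ?M"
      by (intro continuous_imp_measurable_on_sets_lebesgue D(3)) auto
  qed auto
  moreover have "(\<integral>s. deriv \<phi> s * indicator {..x} s \<partial>?M) = \<phi> x" if x: "x \<in> {0..1}" for x
  proof -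
    have "(\<integral>s. deriv \<phi> s * indicator {..x} s \<partial>?M)
        = (\<integral>s. indicator {0..1} s *\<^sub>R (deriv \<phi> s * indicator {..x} s) \<partial>lebesgue)"
      by (rule integral_restrict_space) simp
    also have "\<dots> = (\<integral>s. indicator {0..x} s *\<^sub>R deriv \<phi> s \<partial>lebesgue)"
      using x by (intro Bochner_Integration.integral_cong) (auto simp: indicator_def)
    also have "\<dots> = integral {0..x} (deriv \<phi>)"
      using set_lebesgue_integral_eq_integral(2)[OF absolutely_integrable_continuous_real[OF D(3)]]
      by (simp add: set_lebesgue_integral_def)
    also have "\<dots> = \<phi> x" using test_function_integral[OF phi, of 0 x] x D(4) by (auto intro: integral_unique)
    finally show ?thesis .
  qed
  then have "integral {0..1} (\<lambda>x. g x * (\<integral>s. deriv \<phi> s * indicator {..x} s \<partial>?M)) = integral {0..1} (\<lambda>x. g x * \<phi> x)"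
    by (intro integral_cong) simp
  moreover have "(\<integral>s. deriv \<phi> s * (G 1 - G s) \<partial>?M) = - integral {0..1} (\<lambda>x. G x * deriv \<phi> x)"
  proof -
    have c: "continuous_on {0..1} (\<lambda>s. deriv \<phi> s * (G 1 - G s))"
      by (intro continuous_intros D(3) Gc)
    have "(\<integral>s. deriv \<phi> s * (G 1 - G s) \<partial>?M) = integral {0..1} (\<lambda>s. deriv \<phi> s * (G 1 - G s))"
      using continuous_absolutely_integrable_unit[OF c] lebesgue_on_Icc_integrable_iff
      by (intro lebesgue_integral_eq_integral) auto
    also have "\<dots> = integral {0..1} (\<lambda>s. G 1 * deriv \<phi> s - G s * deriv \<phi> s)" by (simp add: algebra_simps)
    also have "\<dots> = integral {0..1} (\<lambda>s. G 1 * deriv \<phi> s) - integral {0..1} (\<lambda>x. G x * deriv \<phi> x)"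
      by (intro integral_diff integrable_continuous_interval continuous_intros D(3) Gc)
    also have "integral {0..1} (\<lambda>s. G 1 * deriv \<phi> s) = 0"
      using integral_unique[OF test_function_integral[OF phi, of 0 1]] D(4,5) by simp
    finally show ?thesis by simp
  qed
  ultimately show ?thesis by simp
qed

lemma L_2_integrable:
  assumes "L_2 g"
  shows "g absolutely_integrable_on {0..1}" "(\<lambda>x. (g x)\<^sup>2) integrable_on {0..1}"
proof -
  interpret finite_measure unit_lebesgue by (rule finite_measure_unit_lebesgue)
  have g: "g \<in> borel_measurable unit_lebesgue" "integrable unit_lebesgue (\<lambda>x. (g x)\<^sup>2)"
    using assms by (auto simp: L_2_def)
  have "integrable unit_lebesgue g"
  proof (rule Bochner_Integration.integrable_bound[where f = "\<lambda>x. 1 + (g x)\<^sup>2"])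
    have "\<bar>y\<bar> \<le> 1 + y\<^sup>2" for y :: real
      using sum_squares_bound[of 1 "\<bar>y\<bar>"] by simp
    then show "AE x in unit_lebesgue. norm (g x) \<le> norm (1 + (g x)\<^sup>2)"
      by (intro AE_I2) (smt (verit) real_norm_def zero_le_power2)
  qed (use g in auto)
  then show "g absolutely_integrable_on {0..1}" by (simp add: unit_lebesgue_integrable_iff)
  show "(\<lambda>x. (g x)\<^sup>2) integrable_on {0..1}"
    using g(2) unit_lebesgue_integrable_iff set_lebesgue_integral_eq_integral(1) by blast
qed

lemma ac_on_square_absolutely_integrable:
  assumes "ac_on 0 1 f f'"
  shows "f' absolutely_integrable_on {0..1}"
proof (rule measurable_bounded_by_integrable_imp_absolutely_integrable)
  show "f' \<in> borel_measurable (lebesgue_on {0..1})" using assms by (intro ac_on_measurable) auto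
  show "(\<lambda>x. 1 + (f' x)\<^sup>2) integrable_on {0..1}"
    using assms by (intro integrable_add integrable_const_ivl) (auto simp: ac_on_def)
  show "norm (f' x) \<le> 1 + (f' x)\<^sup>2" for x
    using sum_squares_bound[of 1 "\<bar>f' x\<bar>"] by simp
qed auto

text \<open>If f' is a weak derivative of f, then f minus the primitive of f' has weak derivative 0
  and is constant by du Bois-Reymond; by continuity this holds at every point. The converse is
  integration by parts. From here on weak derivatives are replaced by integrals.\<close>

lemma sobolev_iff_ac_on: "sobolev f f' \<longleftrightarrow> ac_on 0 1 f f'"
proof
  assume f: "ac_on 0 1 f f'"
  have a: "f' absolutely_integrable_on {0..1}" by (rule ac_on_square_absolutely_integrable[OF f])
  have c: "continuous_on {0..1} f" using ac_on_continuous[OF f] by simp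
  have "L_2 f'"
    unfolding L_2_def
  proof
    show "f' \<in> borel_measurable unit_lebesgue" using a unit_lebesgue_integrable_iff by auto
    have "(\<lambda>x. (f' x)\<^sup>2) absolutely_integrable_on {0..1}"
      using f by (intro nonnegative_absolutely_integrable_1) (auto simp: ac_on_def)
    then show "integrable unit_lebesgue (\<lambda>x. (f' x)\<^sup>2)" by (simp add: unit_lebesgue_integrable_iff)
  qed
  moreover have "weak_derivative f f'"
    unfolding weak_derivative_def
  proof (intro allI impI)
    fix \<phi> assume phi: "test_function \<phi>"
    note D = test_functionD[OF phi]
    have "(\<integral>x. f x * deriv \<phi> x \<partial>unit_lebesgue) = integral {0..1} (\<lambda>x. f x * deriv \<phi> x)"
      by (intro unit_lebesgue_integral continuous_absolutely_integrable_unit continuous_intros c D)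
    also have "\<dots> = - integral {0..1} (\<lambda>x. f' x * \<phi> x)"
      using f by (intro integration_by_parts_test phi a c) (auto simp: ac_on_def)
    also have "integral {0..1} (\<lambda>x. f' x * \<phi> x) = (\<integral>x. f' x * \<phi> x \<partial>unit_lebesgue)"
      using continuous_mult_absolutely_integrable[OF D(2) a]
      by (intro unit_lebesgue_integral[symmetric]) (simp add: mult.commute)
    finally show "(\<integral>x. f x * deriv \<phi> x \<partial>unit_lebesgue) = - (\<integral>x. f' x * \<phi> x \<partial>unit_lebesgue)" .
  qed
  ultimately show "sobolev f f'" using c by (simp add: sobolev_def)
next
  assume f: "sobolev f f'"
  then have c: "continuous_on {0..1} f" and L2: "L_2 f'" and wd: "weak_derivative f f'"
    by (auto simp: sobolev_def)
  note a = L_2_integrable[OF L2]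
  define G where "G x = integral {0..x} f'" for x
  have i: "f' integrable_on {0..1}" using a(1) set_lebesgue_integral_eq_integral(1) by blast
  have G: "(f' has_integral (G x - G 0)) {0..x}" if "x \<in> {0..1}" for x
    using integrable_on_subinterval[OF i, of 0 x] that by (auto simp: G_def integrable_integral)
  have Gc: "continuous_on {0..1} G" unfolding G_def by (intro indefinite_integral_continuous_1 i)
  have z: "f x - G x = f 0 - G 0" if x: "x \<in> {0..1}" for x
  proof (rule du_bois_reymond_continuous[OF _ _ x])
    show "continuous_on {0..1} (\<lambda>x. f x - G x)" by (intro continuous_intros c Gc)
    fix \<phi> assume phi: "test_function \<phi>"
    note D = test_functionD[OF phi]
    have fG: "integrable unit_lebesgue (\<lambda>x. f x * deriv \<phi> x)" "integrable unit_lebesgue (\<lambda>x. G x * deriv \<phi> x)"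
      unfolding unit_lebesgue_integrable_iff
      by (intro continuous_absolutely_integrable_unit continuous_intros c Gc D)+
    have "(\<integral>x. G x * deriv \<phi> x \<partial>unit_lebesgue) = integral {0..1} (\<lambda>x. G x * deriv \<phi> x)"
      using fG(2) unit_lebesgue_integrable_iff unit_lebesgue_integral by blast
    also have "\<dots> = - integral {0..1} (\<lambda>x. f' x * \<phi> x)"
      by (intro integration_by_parts_test phi a Gc G)
    also have "integral {0..1} (\<lambda>x. f' x * \<phi> x) = (\<integral>x. f' x * \<phi> x \<partial>unit_lebesgue)"
      using continuous_mult_absolutely_integrable[OF D(2) a(1)]
      by (intro unit_lebesgue_integral[symmetric]) (simp add: mult.commute)
    also have "- (\<integral>x. f' x * \<phi> x \<partial>unit_lebesgue) = (\<integral>x. f x * deriv \<phi> x \<partial>unit_lebesgue)"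
      using wd phi by (simp add: weak_derivative_def)
    finally show "(\<integral>x. (f x - G x) * deriv \<phi> x \<partial>unit_lebesgue) = 0"
      using fG by (simp add: left_diff_distrib)
  qed
  have "(f' has_integral (f x - f 0)) {0..x}" if "x \<in> {0..1}" for x
  proof -
    have "f x - f 0 = G x - G 0" using z[OF that] by simp
    then show ?thesis using G[OF that] by simp
  qed
  then show "ac_on 0 1 f f'" using a by (simp add: ac_on_def)
qed

section \<open>Self-similarity of the measure\<close>

locale cantor_string =
  fixes m :: nat and a b w :: "nat \<Rightarrow> real" and \<tau> :: real and C :: "real \<Rightarrow> real"
    and \<rho> :: "real measure"
  assumes m2: "m \<ge> 2"
    and a_less_b: "\<And>k. k \<in> {1..m} \<Longrightarrow> a k < b k"
    and sub01: "\<And>k. k \<in> {1..m} \<Longrightarrow> {a k..b k} \<subseteq> {0..1}"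
    and a_1: "a 1 = 0" and b_m: "b m = 1"
    and gap: "\<And>k. k \<in> {2..m} \<Longrightarrow> b (k - 1) < a k"
    and w_pos: "\<And>k. k \<in> {1..m} \<Longrightarrow> 0 < w k"
    and w_sum: "(\<Sum>k = 1..m. w k) = 1"
    and w_tau: "\<And>k. k \<in> {1..m} \<Longrightarrow> w k * (b k - a k) = \<tau>"
    and ladder: "cantor_ladder m a b w C"
    and prob: "prob_space \<rho>"
    and sets_rho: "sets \<rho> = sets (restrict_space borel {0..1})"
    and rho_derivative: "distributional_derivative C \<rho>"
begin

sublocale prob_space \<rho> by (rule prob)

definition r :: "nat \<Rightarrow> real" where "r k = b k - a k"

text \<open>The map S_k of the ladder, in the slope-intercept form that
  \<open>ac_on_affinity\<close> takes.\<close>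

definition sim :: "nat \<Rightarrow> real \<Rightarrow> real" where "sim k x = r k * x + a k"

lemma r_pos: "k \<in> {1..m} \<Longrightarrow> 0 < r k"
  using a_less_b by (simp add: r_def)

lemma in_1m: "1 \<in> {1..m}" "m \<in> {1..m}"
  using m2 by auto

lemma sim_01: "k \<in> {1..m} \<Longrightarrow> x \<in> {0..1} \<Longrightarrow> sim k x \<in> {a k..b k}"
proof -
  assume k: "k \<in> {1..m}" and x: "x \<in> {0..1}"
  have "0 \<le> r k * x" "r k * x \<le> r k" using r_pos[OF k] x by (auto simp: mult_left_le)
  then show ?thesis by (simp add: sim_def) (simp add: r_def)
qed

lemma a_nonneg: "k \<in> {1..m} \<Longrightarrow> 0 \<le> a k" and b_le_1: "k \<in> {1..m} \<Longrightarrow> b k \<le> 1"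
  using sub01[of k] a_less_b[of k] by auto

lemma sim_01': "k \<in> {1..m} \<Longrightarrow> x \<in> {0..1} \<Longrightarrow> sim k x \<in> {0..1}"
  using sim_01 sub01 by blast

lemma b_less_a: "\<lbrakk>1 \<le> k; k < l; l \<le> m\<rbrakk> \<Longrightarrow> b k < a l"
proof (induction l)
  case (Suc l)
  show ?case
  proof (cases "k = l")
    case True
    then show ?thesis using gap[of "Suc l"] Suc.prems by auto
  next
    case False
    then have "b k < a l" using Suc by auto
    also have "a l < b l" using Suc.prems False by (intro a_less_b) auto
    also have "b l < a (Suc l)" using gap[of "Suc l"] Suc.prems False by auto
    finally show ?thesis .
  qed
qed simp

lemma r_le_1: "k \<in> {1..m} \<Longrightarrow> r k \<le> 1"
  using a_nonneg[of k] b_le_1[of k] by (simp add: r_def)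

lemma w_less_1: "k \<in> {1..m} \<Longrightarrow> w k < 1"
proof -
  assume k: "k \<in> {1..m}"
  obtain l where l: "l \<in> {1..m}" "l \<noteq> k" using m2 that[of 1] that[of 2] by force
  have "w k < (\<Sum>k\<in>{k, l}. w k)" using l w_pos by simp
  also have "\<dots> \<le> (\<Sum>k = 1..m. w k)" using k l w_pos by (intro sum_mono2) (auto intro: less_imp_le)
  finally show ?thesis using w_sum by simp
qed

lemma space_rho: "space \<rho> = {0..1}"
  using sets_eq_imp_space_eq[OF sets_rho] by (simp add: space_restrict_space)

lemma continuous_measurable_rho: "continuous_on {0..1} f \<Longrightarrow> f \<in> borel_measurable \<rho>" for f :: "real \<Rightarrow> real"
  using borel_measurable_continuous_on_restrict[of "{0..1}" f] measurable_cong_sets[OF sets_rho refl, of borel]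
  by blast

lemma continuous_integrable_rho:
  fixes f :: "real \<Rightarrow> real"
  assumes "continuous_on {0..1} f"
  shows "integrable \<rho> f"
proof -
  obtain B where "\<And>x. x \<in> {0..1} \<Longrightarrow> \<bar>f x\<bar> \<le> B"
    using compact_imp_bounded[OF compact_continuous_image[OF assms]]
    by (auto simp: bounded_iff simp del: atLeastAtMost_iff)
  then show ?thesis
    by (intro integrable_const_bound[of _ B] AE_I2 continuous_measurable_rho assms) (auto simp: space_rho)
qed

section \<open>The distribution function of the measure and the fixed point equation\<close>

lemma ident_measurable_rho: "(\<lambda>s. s) \<in> borel_measurable \<rho>"
  by (intro continuous_measurable_rho continuous_on_id)

lemma indicator_measurable_rho:
  "A \<in> sets borel \<Longrightarrow> (indicator A :: real \<Rightarrow> real) \<in> borel_measurable \<rho>"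
  using measurable_compose[OF ident_measurable_rho borel_measurable_indicator[of A borel]] by simp

text \<open>Written as an integral so that it is the tail occurring in \<open>fubini_tail\<close>
  for h = 1.\<close>

definition cdf :: "real \<Rightarrow> real" where "cdf x = (\<integral>s. indicator {..x} s \<partial>\<rho>)"

lemma indicator_integrable_rho:
  "A \<in> sets borel \<Longrightarrow> integrable \<rho> (indicator A :: real \<Rightarrow> real)"
  by (intro integrable_const_bound[of _ 1] AE_I2 indicator_measurable_rho) (auto simp: indicator_def)

lemma cdf_bounds: "0 \<le> cdf x" "cdf x \<le> 1"
proof -
  show "0 \<le> cdf x" unfolding cdf_def by (intro integral_nonneg_AE AE_I2) simp
  have "cdf x \<le> (\<integral>s. 1 \<partial>\<rho>)"
    unfolding cdf_def by (intro integral_mono indicator_integrable_rho) (auto simp: indicator_def)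
  then show "cdf x \<le> 1" by (simp add: prob_space)
qed

lemma integral_derivative_cdf:
  assumes g: "g absolutely_integrable_on {0..1}"
    and G: "\<And>s. s \<in> {0..1} \<Longrightarrow> (g has_integral (G 1 - G s)) {s..1}" and Gc: "continuous_on {0..1} G"
  shows "(\<lambda>x. g x * cdf x) absolutely_integrable_on {0..1}"
    and "integral {0..1} (\<lambda>x. g x * cdf x) = G 1 - (\<integral>s. G s \<partial>\<rho>)"
proof -
  have f: "finite_measure \<rho>" by unfold_locales
  note T = fubini_tail[OF f ident_measurable_rho _ _ _ g G, of "\<lambda>_. 1" 1]
  show "(\<lambda>x. g x * cdf x) absolutely_integrable_on {0..1}"
    using T(1) by (simp add: cdf_def space_rho)
  have "integral {0..1} (\<lambda>x. g x * cdf x) = (\<integral>s. G 1 - G s \<partial>\<rho>)"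
    using T(2) by (simp add: cdf_def space_rho)
  also have "\<dots> = G 1 - (\<integral>s. G s \<partial>\<rho>)"
    using continuous_integrable_rho[OF Gc] by (simp add: prob_space)
  finally show "integral {0..1} (\<lambda>x. g x * cdf x) = G 1 - (\<integral>s. G s \<partial>\<rho>)" .
qed

lemma cdf_integrable: "cdf absolutely_integrable_on {0..1}"
proof -
  have "((\<lambda>x. 1) has_integral (1 - s)) {s..1}" if "s \<in> {0..1::real}" for s :: real
    using has_integral_const_real[of "1::real" s 1] that by simp
  from integral_derivative_cdf(1)[OF absolutely_integrable_continuous_real[OF continuous_on_const] this continuous_on_id]
  show ?thesis by simp
qed

text \<open>Both functions have the same distributional derivative on (0,1). The constant remains
  open at this stage: test functions vanish near 0 and 1 and cannot tell whether an end point
  carries mass.\<close>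

lemma ladder_eq_cdf: "\<exists>c. AE x in unit_lebesgue. C x = cdf x + c"
proof -
  have CL: "integrable unit_lebesgue C"
  proof -
    interpret L: finite_measure unit_lebesgue by (rule finite_measure_unit_lebesgue)
    obtain B where "C \<in> borel_measurable unit_lebesgue" "AE x in unit_lebesgue. \<bar>C x\<bar> \<le> B"
      using ladder unfolding cantor_ladder_def L_infinity_def by blast
    then show ?thesis by (intro L.integrable_const_bound[of C B]) simp_all
  qed
  have cL: "integrable unit_lebesgue cdf"
    using cdf_integrable by (simp add: unit_lebesgue_integrable_iff)
  have "\<exists>c. AE x in unit_lebesgue. C x - cdf x = c"
  proof (rule du_bois_reymond)
    show "(\<lambda>x. C x - cdf x) absolutely_integrable_on {0..1}"
      using Bochner_Integration.integrable_diff[OF CL cL] by (simp only: unit_lebesgue_integrable_iff)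
    fix \<phi> assume phi: "test_function \<phi>"
    note D = test_functionD[OF phi]
    have da: "deriv \<phi> absolutely_integrable_on {0..1}" by (intro continuous_absolutely_integrable_unit D)
    note I = integral_derivative_cdf[OF da test_function_integral[OF phi] D(2)]
    have I1: "integrable unit_lebesgue (\<lambda>x. cdf x * deriv \<phi> x)"
      using I(1) by (simp add: unit_lebesgue_integrable_iff mult.commute)
    have "(\<integral>x. cdf x * deriv \<phi> x \<partial>unit_lebesgue) = integral {0..1} (\<lambda>x. cdf x * deriv \<phi> x)"
      by (rule unit_lebesgue_integral[OF I1[unfolded unit_lebesgue_integrable_iff]])
    also have "\<dots> = - (\<integral>s. \<phi> s \<partial>\<rho>)" using I(2) D(5) by (simp add: mult.commute)
    also have "\<dots> = (\<integral>x. C x * deriv \<phi> x \<partial>unit_lebesgue)"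
      using rho_derivative phi by (simp add: distributional_derivative_def)
    finally have eq: "(\<integral>x. cdf x * deriv \<phi> x \<partial>unit_lebesgue) = (\<integral>x. C x * deriv \<phi> x \<partial>unit_lebesgue)" .
    have "integrable unit_lebesgue (\<lambda>x. C x * deriv \<phi> x)"
      using continuous_mult_absolutely_integrable[OF D(3) CL[unfolded unit_lebesgue_integrable_iff]]
      by (simp add: unit_lebesgue_integrable_iff mult.commute)
    then show "(\<integral>x. (C x - cdf x) * deriv \<phi> x \<partial>unit_lebesgue) = 0"
      using I1 eq by (simp add: left_diff_distrib)
  qed
  then obtain c where "AE x in unit_lebesgue. C x - cdf x = c" by (elim exE)
  then have "AE x in unit_lebesgue. C x = cdf x + c" by eventually_elim simp
  then show ?thesis by (rule exI)
qed

lemma inv_sim: "k \<in> {1..m} \<Longrightarrow> inv (affine_map (a k) (b k)) x = (x - a k) / r k"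
proof -
  assume k: "k \<in> {1..m}"
  have "inj (affine_map (a k) (b k))"
    using a_less_b[OF k] by (auto simp: inj_on_def affine_map_def)
  moreover have "affine_map (a k) (b k) ((x - a k) / r k) = x"
    using r_pos[OF k] by (simp add: affine_map_def r_def)
  ultimately show ?thesis by (metis inv_f_f)
qed

lemma ladder_fixpoint_shifted_cdf:
  "\<exists>c N. negligible N \<and> (\<forall>x\<in>{0<..<1} - N. ladder_operator m a b w (\<lambda>y. cdf y + c) x = cdf x + c)"
proof -
  obtain c where c: "AE x in unit_lebesgue. C x = cdf x + c" using ladder_eq_cdf by blast
  have to_negl: "\<exists>N. negligible N \<and> (\<forall>x\<in>{0<..<1} - N. P x)" if "AE x in unit_lebesgue. P x" for P
  proof -
    have "AE x in lebesgue. x \<in> {0<..<1} \<longrightarrow> P x"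
      using that by (subst (asm) AE_restrict_space_iff) auto
    then obtain N where "N \<in> null_sets lebesgue" "\<And>x. x \<notin> N \<Longrightarrow> x \<in> {0<..<1} \<longrightarrow> P x"
      by (auto elim!: AE_E3)
    then show ?thesis by (intro exI[of _ N]) (auto simp: negligible_iff_null_sets)
  qed
  obtain N1 where N1: "negligible N1" "\<And>x. x \<in> {0<..<1} - N1 \<Longrightarrow> C x = cdf x + c"
    using to_negl[OF c] by blast
  have "AE x in unit_lebesgue. ladder_operator m a b w C x = C x" using ladder by (simp add: cantor_ladder_def)
  from to_negl[OF this]
  obtain N2 where N2: "negligible N2" "\<And>x. x \<in> {0<..<1} - N2 \<Longrightarrow> ladder_operator m a b w C x = C x"
    by blast
  \<comment> \<open>The operator evaluates C at preimages under \<open>sim k\<close>, so the images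
    of the exceptional set are removed too. Removing the end points \<open>a k\<close> and
    \<open>b k\<close> keeps the preimages inside the open interval (0,1).\<close>
  define N where "N = N1 \<union> N2 \<union> (\<Union>k\<in>{1..m}. sim k ` N1) \<union> (\<Union>k\<in>{1..m}. {a k, b k})"
  have "negligible (sim k ` N1)" for k
    by (rule negligible_differentiable_image_negligible[OF _ N1(1)])
      (auto simp: sim_def[abs_def] intro!: derivative_intros)
  then have "negligible N" unfolding N_def using N1(1) N2(1)
    by (intro negligible_Un negligible_Union) auto
  moreover have "ladder_operator m a b w (\<lambda>y. cdf y + c) x = cdf x + c" if x: "x \<in> {0<..<1} - N" for x
  proof -
    have eq: "C (inv (affine_map (a k) (b k)) x) = cdf (inv (affine_map (a k) (b k)) x) + c"
      if k: "k \<in> {1..m}" and xk: "x \<in> {a k..b k}" for k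
    proof (rule N1(2))
      let ?y = "(x - a k) / r k"
      have "x \<noteq> a k" "x \<noteq> b k" using x k by (auto simp: N_def)
      then have "?y \<in> {0<..<1}" using xk r_pos[OF k] by (auto simp: r_def field_simps)
      moreover have "?y \<notin> N1"
      proof
        assume "?y \<in> N1"
        then have "sim k ?y \<in> N" using k by (auto simp: N_def)
        then show False using x r_pos[OF k] by (simp add: sim_def)
      qed
      ultimately show "inv (affine_map (a k) (b k)) x \<in> {0<..<1} - N1" by (simp add: inv_sim[OF k])
    qed
    have "ladder_operator m a b w (\<lambda>y. cdf y + c) x = ladder_operator m a b w C x"
      unfolding ladder_operator_def using eq by (intro sum.cong refl) (auto simp: indicator_def)
    also have "\<dots> = cdf x + c" using x N1(2) N2(2) by (auto simp: N_def)
    finally show ?thesis .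
  qed
  ultimately show ?thesis by blast
qed

lemma cdf_tendsto:
  assumes "\<And>s. s \<in> {0..1} \<Longrightarrow> (\<lambda>n. indicator {..X n} s :: real) \<longlonglongrightarrow> indicator A s" "A \<in> sets borel"
  shows "(\<lambda>n. cdf (X n)) \<longlonglongrightarrow> (\<integral>s. indicator A s \<partial>\<rho>)"
  unfolding cdf_def
proof (rule integral_dominated_convergence[where w = "\<lambda>_. 1"])
  show "AE s in \<rho>. (\<lambda>n. indicator {..X n} s :: real) \<longlonglongrightarrow> indicator A s"
    using assms(1) by (intro AE_I2) (simp add: space_rho)
qed (use assms(2) in \<open>auto intro: indicator_measurable_rho\<close>)

text \<open>The fixed point equation near 0 and near 1 determines the additive constant, and shows that
  the end points carry no mass.\<close>

lemma ladder_fixpoint_cdf: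
  "\<exists>N. negligible N \<and> (\<forall>x\<in>{0<..<1} - N. ladder_operator m a b w cdf x = cdf x)"
proof -
  from ladder_fixpoint_shifted_cdf obtain c N where cN: "negligible N \<and>
      (\<forall>x\<in>{0<..<1} - N. ladder_operator m a b w (\<lambda>y. cdf y + c) x = cdf x + c)"
    by (elim exE)
  note N = conjunct1[OF cN] and fp = bspec[OF conjunct2[OF cN]]
  \<comment> \<open>The complement of a negligible set is dense, so both ends can be approached
    through points where the equation holds.\<close>
  have avoid: "\<exists>x. p < x \<and> x < q \<and> x \<notin> N" if "p < q" for p q
  proof (rule ccontr)
    assume "\<not> ?thesis"
    then have "{p<..<q} \<subseteq> N" by auto
    then have "negligible {p<..<q}" using negligible_subset[OF N] by simp
    then show False using that negligible_interval(2)[of p q] by (simp add: box_real)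
  qed
  have lim_const: "x = y" if "(\<lambda>n::nat. f n) \<longlonglongrightarrow> x" "(\<lambda>n. f n) \<longlonglongrightarrow> y" for f :: "nat \<Rightarrow> real" and x y
    using that by (rule LIMSEQ_unique)
  let ?p = "(\<integral>s. (indicator {..0} s :: real) \<partial>\<rho>)" and ?q = "(\<integral>s. (indicator {..<1} s :: real) \<partial>\<rho>)"
  \<comment> \<open>Close to 0 only the first segment contributes: cdf x + c = (cdf (x / b 1) + c) w
    1. As x decreases to 0 this becomes (p + c)(1 - w 1) = 0, where p is the mass of the point
    0.\<close>
  have left: "?p + c = 0"
  proof -
    have b1: "0 < b 1" using a_less_b[OF in_1m(1)] a_1 by simp
    have "\<exists>x. 0 < x \<and> x < b 1 / real (n + 2) \<and> x \<notin> N" for n using b1 by (intro avoid) auto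
    then obtain X where X: "\<And>n. 0 < X n" "\<And>n. X n < b 1 / real (n + 2)" "\<And>n. X n \<notin> N" by metis
    have X0: "X \<longlonglongrightarrow> 0"
    proof (rule real_tendsto_sandwich[of "\<lambda>_. 0" _ _ "\<lambda>n. b 1 / real (n + 2)"])
      show "(\<lambda>n. b 1 / real (n + 2)) \<longlonglongrightarrow> 0" by real_asymp
    qed (use X in \<open>auto intro!: always_eventually less_imp_le\<close>)
    have lim: "(\<lambda>n. cdf (Y n)) \<longlonglongrightarrow> ?p" if Y: "Y \<longlonglongrightarrow> 0" "\<And>n. 0 < Y n" for Y
    proof (rule cdf_tendsto)
      fix s :: real assume s: "s \<in> {0..1}"
      show "(\<lambda>n. indicator {..Y n} s :: real) \<longlonglongrightarrow> indicator {..0} s"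
      proof (cases "s = 0")
        case True
        then show ?thesis using Y(2) by (simp add: less_imp_le indicator_def)
      next
        case False
        then have "\<forall>\<^sub>F n in sequentially. Y n < s" using Y(1) s by (intro order_tendstoD) auto
        then have "\<forall>\<^sub>F n in sequentially. (0::real) = indicator {..Y n} s"
          by eventually_elim simp
        then show ?thesis using s False by (auto intro: Lim_transform_eventually[OF tendsto_const])
      qed
    qed simp
    have "cdf (X n) + c = (cdf (X n / b 1) + c) * w 1" for n
    proof -
      have bn: "b 1 / real (n + 2) < b 1 / 1" using b1 by (intro divide_strict_left_mono) auto
      have xb: "X n < b 1" using X(2)[of n] bn by simp
      then have x01: "X n \<in> {0<..<1} - N" using X b_le_1[OF in_1m(1)] by (auto intro: less_le_trans)
      have "ladder_operator m a b w (\<lambda>y. cdf y + c) (X n)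
          = (\<Sum>k = 1..m. if k = 1 then (cdf (X n / b 1) + c) * w 1 else 0)"
        unfolding ladder_operator_def
      proof (rule sum.cong[OF refl])
        fix k assume k: "k \<in> {1..m}"
        show "(indicator {a k..b k} (X n) * (cdf (inv (affine_map (a k) (b k)) (X n)) + c) + indicator {x. b k < x} (X n)) * w k
          = (if k = 1 then (cdf (X n / b 1) + c) * w 1 else 0)"
        proof (cases "k = 1")
          case True
          then show ?thesis using X(1)[of n] xb inv_sim[OF in_1m(1)] a_1 by (simp add: r_def)
        next
          case False
          then have "b 1 < a k" "a k < b k" using k a_less_b by (auto intro: b_less_a)
          then show ?thesis using False xb by simp
        qed
      qed
      then show ?thesis using fp[OF x01] in_1m by simp
    qed
    then have "(\<lambda>n. cdf (X n) + c) \<longlonglongrightarrow> (?p + c) * w 1"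
      using tendsto_mult[OF tendsto_add[OF lim[of "\<lambda>n. X n / b 1"] tendsto_const] tendsto_const, of c "w 1"]
        X(1) b1 tendsto_divide[OF X0 tendsto_const, of "b 1"] by auto
    moreover have "(\<lambda>n. cdf (X n) + c) \<longlonglongrightarrow> ?p + c" by (intro tendsto_add lim X0 X tendsto_const)
    ultimately have "?p + c = (?p + c) * w 1" by (rule lim_const[rotated])
    then show ?thesis using w_less_1[OF in_1m(1)] by (metis less_irrefl mult_cancel_left1)
  qed
  \<comment> \<open>Close to 1 all segments but the last lie to the left and contribute their full
    weight 1 - w m. As x increases to 1 this gives q + c = (1 - w m) + (q + c) w m, where q is the
    mass of [0,1).\<close>
  have right: "?q + c = 1"
  proof -
    have rm: "0 < r m" using r_pos in_1m by blast
    have am: "a m = 1 - r m" by (simp add: r_def b_m)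
    have "\<exists>x. 1 - r m / real (n + 2) < x \<and> x < 1 \<and> x \<notin> N" for n using rm by (intro avoid) auto
    then obtain X where X: "\<And>n. X n < 1" "\<And>n. 1 - r m / real (n + 2) < X n" "\<And>n. X n \<notin> N" by metis
    have X0: "X \<longlonglongrightarrow> 1"
    proof (rule real_tendsto_sandwich[of "\<lambda>n. 1 - r m / real (n + 2)" _ _ "\<lambda>_. 1"])
      have "(\<lambda>n. 1 / real (n + 2)) \<longlonglongrightarrow> 0" by real_asymp
      from tendsto_diff[OF tendsto_const tendsto_mult[OF tendsto_const this], of 1 "r m"]
      show "(\<lambda>n. 1 - r m / real (n + 2)) \<longlonglongrightarrow> 1" by simp
    qed (use X in \<open>auto intro!: always_eventually less_imp_le\<close>)
    have lim: "(\<lambda>n. cdf (Y n)) \<longlonglongrightarrow> ?q" if Y: "Y \<longlonglongrightarrow> 1" "\<And>n. Y n < 1" for Y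
    proof (rule cdf_tendsto)
      fix s :: real assume s: "s \<in> {0..1}"
      show "(\<lambda>n. indicator {..Y n} s :: real) \<longlonglongrightarrow> indicator {..<1} s"
      proof (cases "s = 1")
        case True
        then have "(indicator {..Y n} s :: real) = indicator {..<1} s" for n
          using Y(2)[of n] by (simp add: indicator_def)
        then show ?thesis by simp
      next
        case False
        then have "\<forall>\<^sub>F n in sequentially. s < Y n" using Y(1) s by (intro order_tendstoD) auto
        then have "\<forall>\<^sub>F n in sequentially. (1::real) = indicator {..Y n} s"
          by eventually_elim simp
        then show ?thesis using s False by (auto intro: Lim_transform_eventually[OF tendsto_const])
      qed
    qed simp
    have "cdf (X n) + c = (1 - w m) + (cdf ((X n - a m) / r m) + c) * w m" for n
    proof -
      have bn: "r m / real (n + 2) < r m / 1" using rm by (intro divide_strict_left_mono) auto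
      have xb: "a m < X n" using X(2)[of n] bn am by simp
      then have x01: "X n \<in> {0<..<1} - N" using X a_nonneg[OF in_1m(2)] by (auto intro: le_less_trans)
      have "ladder_operator m a b w (\<lambda>y. cdf y + c) (X n)
          = (\<Sum>k = 1..m. w k + (if k = m then (cdf ((X n - a m) / r m) + c) * w m - w m else 0))"
        unfolding ladder_operator_def
      proof (rule sum.cong[OF refl])
        fix k assume k: "k \<in> {1..m}"
        show "(indicator {a k..b k} (X n) * (cdf (inv (affine_map (a k) (b k)) (X n)) + c) + indicator {x. b k < x} (X n)) * w k
          = w k + (if k = m then (cdf ((X n - a m) / r m) + c) * w m - w m else 0)"
        proof (cases "k = m")
          case True
          then show ?thesis using X(1)[of n] xb inv_sim[OF in_1m(2)] b_m by simp
        next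
          case False
          then have "b k < a m" using k by (auto intro: b_less_a)
          then show ?thesis using False xb by simp
        qed
      qed
      also have "\<dots> = 1 + ((cdf ((X n - a m) / r m) + c) * w m - w m)"
        using in_1m(2) w_sum by (simp add: sum.distrib)
      finally show ?thesis using fp[OF x01] by simp
    qed
    moreover have "(\<lambda>n. (1 - w m) + (cdf ((X n - a m) / r m) + c) * w m) \<longlonglongrightarrow> (1 - w m) + (?q + c) * w m"
    proof (intro tendsto_add tendsto_mult tendsto_const lim)
      show "(\<lambda>n. (X n - a m) / r m) \<longlonglongrightarrow> 1"
        using tendsto_divide[OF tendsto_diff[OF X0 tendsto_const] tendsto_const, of "r m" "a m"] rm am by simp
      show "(X n - a m) / r m < 1" for n using X(1)[of n] rm am by (simp add: field_simps)
    qed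
    ultimately have "(\<lambda>n. cdf (X n) + c) \<longlonglongrightarrow> (1 - w m) + (?q + c) * w m" by simp
    moreover have "(\<lambda>n. cdf (X n) + c) \<longlonglongrightarrow> ?q + c" by (intro tendsto_add lim X0 X tendsto_const)
    ultimately have "?q + c = (1 - w m) + (?q + c) * w m" by (rule lim_const[rotated])
    moreover have "x = 1" if "x = (1 - v) + x * v" "v < 1" for x v :: real
    proof -
      have "(x - 1) * (1 - v) = 0" using that(1) by (simp add: algebra_simps)
      then show ?thesis using that(2) by simp
    qed
    ultimately show ?thesis using w_less_1[OF in_1m(2)] by blast
  qed
  \<comment> \<open>From p >= 0 follows c <= 0, and from q <= 1 follows c >= 0.\<close>
  have "0 \<le> ?p" using cdf_bounds(1)[of 0] by (simp only: cdf_def)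
  moreover have "?q \<le> 1"
  proof -
    have "?q \<le> (\<integral>s. 1 \<partial>\<rho>)" by (intro integral_mono indicator_integrable_rho) (auto simp: indicator_def)
    then show ?thesis by (simp add: prob_space)
  qed
  ultimately have "c = 0" using left right by linarith
  then show ?thesis using N fp by auto
qed

section \<open>Self-similarity of integrals\<close>

lemma integral_rho_C1:
  assumes f: "\<And>x. (f has_real_derivative f' x) (at x)" and f': "continuous_on UNIV f'"
  shows "(\<lambda>x. f' x * cdf x) integrable_on {0..1}"
    and "(\<integral>s. f s \<partial>\<rho>) = f 1 - integral {0..1} (\<lambda>x. f' x * cdf x)"
proof -
  have fc: "continuous_on {0..1} f" using f by (meson DERIV_continuous_on has_field_derivative_at_within)
  have I: "(f' has_integral (f 1 - f s)) {s..1}" if "s \<in> {0..1}" for s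
    using that f by (intro fundamental_theorem_of_calculus)
      (auto simp: has_real_derivative_iff_has_vector_derivative[symmetric] intro: has_field_derivative_at_within)
  have a: "f' absolutely_integrable_on {0..1}"
    using f' by (intro continuous_absolutely_integrable_unit) (rule continuous_on_subset, auto)
  note T = integral_derivative_cdf[OF a I fc]
  show "(\<lambda>x. f' x * cdf x) integrable_on {0..1}" using T(1) set_lebesgue_integral_eq_integral(1) by blast
  show "(\<integral>s. f s \<partial>\<rho>) = f 1 - integral {0..1} (\<lambda>x. f' x * cdf x)" using T(2) by simp
qed

text \<open>Integration by parts expresses the integral of f through the distribution function, into
  which the fixed point equation is inserted. After an affine substitution each segment yields an
  integral of the same type for f o S_k, and the jump term for x > b k restores the boundary value f
  (b k) = (f o S_k) 1.\<close>

lemma self_similar_C1: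
  assumes f: "\<And>x. (f has_real_derivative f' x) (at x)" and f': "continuous_on UNIV f'"
  shows "(\<integral>s. f s \<partial>\<rho>) = (\<Sum>k = 1..m. w k * (\<integral>s. f (sim k s) \<partial>\<rho>))"
proof -
  obtain N where N: "negligible N" "\<And>x. x \<in> {0<..<1} - N \<Longrightarrow> ladder_operator m a b w cdf x = cdf x"
    using ladder_fixpoint_cdf by blast
  define J where "J k = integral {0..1} (\<lambda>t. (r k * f' (sim k t)) * cdf t)" for k
  have sim_der: "((\<lambda>t. f (sim k t)) has_real_derivative r k * f' (sim k t)) (at t)" for k t
  proof -
    have "(sim k has_real_derivative r k) (at t)"
      unfolding sim_def[abs_def] by (auto intro!: derivative_eq_intros)
    from DERIV_chain2[OF f this] show ?thesis by (simp add: mult.commute)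
  qed
  have sim_cont: "continuous_on UNIV (\<lambda>t. r k * f' (sim k t))" for k
    by (intro continuous_intros continuous_on_compose2[OF f'])
      (auto simp: sim_def[abs_def] intro!: continuous_intros)
  note SC = integral_rho_C1[OF sim_der sim_cont]
  have piece: "((\<lambda>x. f' x * ((indicator {a k..b k} x * cdf (inv (affine_map (a k) (b k)) x)
      + indicator {x. x > b k} x) * w k)) has_integral (J k + (f 1 - f (b k))) * w k) {0..1}"
    if k: "k \<in> {1..m}" for k
  proof -
    have rk: "0 < r k" by (rule r_pos[OF k])
    have "((\<lambda>t. (r k * f' (sim k t)) * cdf t) has_integral J k) {0..1}"
      using SC(1) by (simp add: J_def integrable_integral)
    then have "((\<lambda>t. (r k * f' (sim k t)) * cdf t) has_integral J k) (cbox 0 1)" by simp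
    \<comment> \<open>Substitution t = (x - a k) / r k. The Jacobian supplies a factor
      \<open>r k\<close> that cancels the one coming from the derivative of f o S_k.\<close>
    from has_integral_affinity'[OF this, of "1 / r k" "- a k / r k"]
    have "((\<lambda>x. (r k * f' (sim k (1 / r k * x + - a k / r k))) * cdf (1 / r k * x + - a k / r k))
        has_integral (J k * r k)) {a k..a k + r k}"
      using rk by (simp add: field_simps) (simp add: add_divide_distrib)
    moreover have "sim k (1 / r k * x + - a k / r k) = x" for x
      using rk by (simp add: sim_def field_simps)
    moreover have "1 / r k * x + - a k / r k = inv (affine_map (a k) (b k)) x" for x
      using rk by (simp add: inv_sim[OF k] diff_divide_distrib)
    ultimately have "((\<lambda>x. (r k * f' x) * cdf (inv (affine_map (a k) (b k)) x)) has_integral (J k * r k)) {a k..b k}"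
      by (simp add: r_def)
    from has_integral_mult_right[OF this, of "1 / r k"]
    have "((\<lambda>x. f' x * cdf (inv (affine_map (a k) (b k)) x)) has_integral J k) {a k..b k}"
      using rk by simp
    then have "((\<lambda>x. if x \<in> {a k..b k} then f' x * cdf (inv (affine_map (a k) (b k)) x) else 0) has_integral J k) {0..1}"
      using sub01[OF k] by (subst has_integral_restrict) auto
    then have 1: "((\<lambda>x. f' x * (indicator {a k..b k} x * cdf (inv (affine_map (a k) (b k)) x))) has_integral J k) {0..1}"
      by (rule has_integral_eq[rotated]) (simp add: indicator_def)
    have "(f' has_integral (f 1 - f (b k))) {b k..1}"
      using b_le_1[OF k] f by (intro fundamental_theorem_of_calculus)
        (auto simp: has_real_derivative_iff_has_vector_derivative[symmetric] intro: has_field_derivative_at_within)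
    then have "((\<lambda>x. if x \<in> {b k..1} then f' x else 0) has_integral (f 1 - f (b k))) {0..1}"
      using sub01[OF k] a_less_b[OF k] by (subst has_integral_restrict) auto
    then have 2: "((\<lambda>x. f' x * indicator {x. x > b k} x) has_integral (f 1 - f (b k))) {0..1}"
      by (rule has_integral_spike_finite[of "{b k}", rotated 2]) (auto simp: indicator_def)
    show ?thesis
      using has_integral_mult_left[OF has_integral_add[OF 1 2], of "w k"] by (simp add: algebra_simps)
  qed
  have "((\<lambda>x. f' x * ladder_operator m a b w cdf x) has_integral (\<Sum>k = 1..m. (J k + (f 1 - f (b k))) * w k)) {0..1}"
    unfolding ladder_operator_def sum_distrib_left by (intro has_integral_sum piece) auto
  then have "((\<lambda>x. f' x * cdf x) has_integral (\<Sum>k = 1..m. (J k + (f 1 - f (b k))) * w k)) {0..1}"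
    by (rule has_integral_spike[of "N \<union> {0, 1}", rotated 2]) (use N in \<open>auto simp: negligible_Un_eq\<close>)
  then have "(\<integral>s. f s \<partial>\<rho>) = f 1 - (\<Sum>k = 1..m. (J k + (f 1 - f (b k))) * w k)"
    using integral_rho_C1(2)[OF f f'] by (simp add: integral_unique)
  \<comment> \<open>Distributing f 1 over the weights lets it cancel against the f 1 of the jump
    terms.\<close>
  also have "\<dots> = (\<Sum>k = 1..m. w k * f 1) - (\<Sum>k = 1..m. (J k + (f 1 - f (b k))) * w k)"
    by (simp only: sum_distrib_right[symmetric] w_sum)
  also have "\<dots> = (\<Sum>k = 1..m. w k * (f (b k) - J k))"
    by (simp add: sum_subtractf[symmetric] algebra_simps)
  also have "\<dots> = (\<Sum>k = 1..m. w k * (\<integral>s. f (sim k s) \<partial>\<rho>))"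
  proof (intro sum.cong refl)
    fix k
    have "sim k 1 = b k" by (simp add: sim_def r_def)
    then show "w k * (f (b k) - J k) = w k * (\<integral>s. f (sim k s) \<partial>\<rho>)"
      using SC(2)[of k] by (simp add: J_def)
  qed
  finally show ?thesis .
qed

lemma sim_continuous: "continuous_on A (sim k)"
  unfolding sim_def[abs_def] by (intro continuous_intros)

lemma comp_sim_continuous:
  "k \<in> {1..m} \<Longrightarrow> continuous_on {0..1} f \<Longrightarrow> continuous_on {0..1} (\<lambda>x. f (sim k x))"
  using sim_01' by (intro continuous_on_compose2[OF _ sim_continuous]) blast+

lemma integral_diff_le:
  fixes f g :: "real \<Rightarrow> real"
  assumes "continuous_on {0..1} f" "continuous_on {0..1} g" "\<And>x. x \<in> {0..1} \<Longrightarrow> \<bar>f x - g x\<bar> \<le> e"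
  shows "\<bar>(\<integral>s. f s \<partial>\<rho>) - (\<integral>s. g s \<partial>\<rho>)\<bar> \<le> e"
proof -
  have "\<bar>(\<integral>s. f s \<partial>\<rho>) - (\<integral>s. g s \<partial>\<rho>)\<bar> = \<bar>\<integral>s. f s - g s \<partial>\<rho>\<bar>"
    using continuous_integrable_rho[OF assms(1)] continuous_integrable_rho[OF assms(2)] by simp
  also have "\<dots> \<le> (\<integral>s. \<bar>f s - g s\<bar> \<partial>\<rho>)" by (rule integral_abs_bound)
  also have "\<dots> \<le> (\<integral>s. e \<partial>\<rho>)"
    using assms by (intro integral_mono continuous_integrable_rho continuous_intros) (auto simp: space_rho)
  finally show ?thesis by (simp add: prob_space)
qed

text \<open>Both sides change by at most the sup norm when f is perturbed, because
  \<open>\<rho>\<close> is a probability measure and the weights sum to 1. So the polynomial case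
  and Stone-Weierstrass suffice.\<close>

lemma self_similar:
  fixes f :: "real \<Rightarrow> real"
  assumes f: "continuous_on {0..1} f"
  shows "(\<integral>s. f s \<partial>\<rho>) = (\<Sum>k = 1..m. w k * (\<integral>s. f (sim k s) \<partial>\<rho>))"
proof -
  have "\<bar>(\<integral>s. f s \<partial>\<rho>) - (\<Sum>k = 1..m. w k * (\<integral>s. f (sim k s) \<partial>\<rho>))\<bar> \<le> e" if "0 < e" for e
  proof -
    have e2: "0 < e / 2" using that by simp
    obtain g where g: "real_polynomial_function g" "\<And>x. x \<in> {0..1} \<Longrightarrow> \<bar>f x - g x\<bar> < e / 2"
      using Stone_Weierstrass_real_polynomial_function[OF compact_Icc f e2] by metis
    obtain g' where g': "real_polynomial_function g'" "\<And>x. (g has_real_derivative g' x) (at x)"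
      using has_real_derivative_polynomial_function[OF g(1)] by blast
    have gc: "continuous_on A g" "continuous_on A g'" for A
      using g(1) g'(1) continuous_on_polymonial_function real_polynomial_function_eq by blast+
    have 1: "\<bar>(\<integral>s. f s \<partial>\<rho>) - (\<integral>s. g s \<partial>\<rho>)\<bar> \<le> e / 2"
      using g(2) by (intro integral_diff_le f gc) (auto intro: less_imp_le)
    have "\<bar>(\<Sum>k = 1..m. w k * (\<integral>s. f (sim k s) \<partial>\<rho>)) - (\<Sum>k = 1..m. w k * (\<integral>s. g (sim k s) \<partial>\<rho>))\<bar>
        = \<bar>\<Sum>k = 1..m. w k * ((\<integral>s. f (sim k s) \<partial>\<rho>) - (\<integral>s. g (sim k s) \<partial>\<rho>))\<bar>"
      by (simp add: sum_subtractf right_diff_distrib)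
    also have "\<dots> \<le> (\<Sum>k = 1..m. \<bar>w k * ((\<integral>s. f (sim k s) \<partial>\<rho>) - (\<integral>s. g (sim k s) \<partial>\<rho>))\<bar>)"
      by (rule sum_abs)
    also have "\<dots> \<le> (\<Sum>k = 1..m. w k * (e / 2))"
    proof (intro sum_mono)
      fix k assume k: "k \<in> {1..m}"
      have "\<bar>(\<integral>s. f (sim k s) \<partial>\<rho>) - (\<integral>s. g (sim k s) \<partial>\<rho>)\<bar> \<le> e / 2"
        using g(2) sim_01'[OF k] by (intro integral_diff_le comp_sim_continuous k f gc) (auto intro: less_imp_le)
      then show "\<bar>w k * ((\<integral>s. f (sim k s) \<partial>\<rho>) - (\<integral>s. g (sim k s) \<partial>\<rho>))\<bar> \<le> w k * (e / 2)"
        using w_pos[OF k] by (simp add: abs_mult)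
    qed
    also have "\<dots> = e / 2" by (simp only: sum_distrib_right[symmetric] w_sum mult_1)
    finally show ?thesis using 1 self_similar_C1[OF g'(2) gc(2)] by linarith
  qed
  note close = this
  have "\<bar>(\<integral>s. f s \<partial>\<rho>) - (\<Sum>k = 1..m. w k * (\<integral>s. f (sim k s) \<partial>\<rho>))\<bar> \<le> 0"
  proof (rule field_le_epsilon)
    show "\<bar>(\<integral>s. f s \<partial>\<rho>) - (\<Sum>k = 1..m. w k * (\<integral>s. f (sim k s) \<partial>\<rho>))\<bar> \<le> 0 + e" if "0 < e" for e
      using close[OF that] by simp
  qed
  then show ?thesis by simp
qed

end

section \<open>Transplanting functions into the pieces of the string\<close>

lemma ac_on_linear:
  assumes "p \<le> q"
  shows "ac_on p q (\<lambda>x. c * (x - d)) (\<lambda>_. c)" "integral {p..q} (\<lambda>_. c\<^sup>2) = c\<^sup>2 * (q - p)"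
proof -
  have "((\<lambda>_. c) has_integral (c * (x - d) - c * (p - d))) {p..x}" if "x \<in> {p..q}" for x
    using has_integral_const_real[of c p x] that by (simp add: algebra_simps)
  then show "ac_on p q (\<lambda>x. c * (x - d)) (\<lambda>_. c)" by (auto simp: ac_on_def)
  show "integral {p..q} (\<lambda>_. c\<^sup>2) = c\<^sup>2 * (q - p)" using assms by simp
qed

text \<open>The function u is squeezed into [\<alpha>, \<beta>], which divides its energy by the
  length, and continued by linear ramps of length g, whose energies are u(0)^2 / g and u(1)^2 / g.
  Where a ramp sticks out of [0,1] its energy is simply lost, whence only an inequality.\<close>

lemma transplant_exists:
  assumes u: "ac_on 0 1 u u'" and ab: "0 \<le> \<alpha>" "\<alpha> < \<beta>" "\<beta> \<le> 1" and g: "0 < g" "g \<le> 1"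
  shows "\<exists>e e'. ac_on 0 1 e e' \<and> (\<forall>t\<in>{0..1}. e (\<alpha> + (\<beta> - \<alpha>) * t) = u t) \<and>
     (\<forall>x. x \<le> \<alpha> - g \<or> \<beta> + g \<le> x \<longrightarrow> e x = 0) \<and>
     energy e' e' \<le> energy u' u' / (\<beta> - \<alpha>) + ((u 0)\<^sup>2 + (u 1)\<^sup>2) / g"
proof -
  define r where "r = \<beta> - \<alpha>"
  have r: "0 < r" using ab by (simp add: r_def)
  define e where "e x = (if x \<le> \<alpha> - g then 0 else if x \<le> \<alpha> then u 0 / g * (x - (\<alpha> - g))
    else if x \<le> \<beta> then u (1 / r * x + - \<alpha> / r) else if x \<le> \<beta> + g then - u 1 / g * (x - (\<beta> + g)) else 0)" for x
  define e' where "e' x = (if x \<le> \<alpha> - g then 0 else if x \<le> \<alpha> then u 0 / g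
    else if x \<le> \<beta> then 1 / r * u' (1 / r * x + - \<alpha> / r) else if x \<le> \<beta> + g then - u 1 / g else 0)" for x
  let ?I = "\<lambda>p q. integral {p..q} (\<lambda>x. (e' x)\<^sup>2)"
  have at\<alpha>: "1 / r * \<alpha> + - \<alpha> / r = 0" by simp
  have "1 / r * \<beta> + - \<alpha> / r = (\<beta> - \<alpha>) / r" by (simp add: diff_divide_distrib)
  then have at\<beta>: "1 / r * \<beta> + - \<alpha> / r = 1" using r by (simp add: r_def)
  \<comment> \<open>Working on \<open>[-1,2]\<close> keeps all five pieces present when \<open>\<alpha> = 0\<close> or \<open>\<beta> = 1\<close>.\<close>
  have 1: "ac_on (-1) (\<alpha> - g) e e'" "?I (-1) (\<alpha> - g) = 0"
    using ac_on_cong[OF ac_on_const[of "-1" "\<alpha> - g" 0], of e e'] ab g by (auto simp: e_def e'_def)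
  have 2: "ac_on (\<alpha> - g) \<alpha> e e'" "?I (\<alpha> - g) \<alpha> = (u 0)\<^sup>2 / g"
  proof -
    have pq: "\<alpha> - g \<le> \<alpha>" using g by simp
    note L = ac_on_linear[OF pq, of "u 0 / g"]
    note Cg = ac_on_cong[OF L(1) pq, of e "\<alpha> - g" e']
    show "ac_on (\<alpha> - g) \<alpha> e e'" using g by (intro Cg(1)) (auto simp: e_def e'_def)
    have "?I (\<alpha> - g) \<alpha> = integral {\<alpha> - g..\<alpha>} (\<lambda>_. (u 0 / g)\<^sup>2)"
      using g by (intro Cg(2)) (auto simp: e_def e'_def)
    then show "?I (\<alpha> - g) \<alpha> = (u 0)\<^sup>2 / g" using L(2) g by (simp add: power2_eq_square)
  qed
  have 3: "ac_on \<alpha> \<beta> e e'" "?I \<alpha> \<beta> = energy u' u' / r"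
  proof -
    have rr: "0 < 1 / r" using r by simp
    note A = ac_on_affinity[OF u rr, of "- \<alpha> / r"]
    have "(1 - - \<alpha> / r) / (1 / r) = r + \<alpha>" using r by (simp add: distrib_right)
    then have ends: "(0 - - \<alpha> / r) / (1 / r) = \<alpha>" "(1 - - \<alpha> / r) / (1 / r) = \<beta>"
      using r by (simp_all add: r_def)
    have pq: "\<alpha> \<le> \<beta>" using ab by simp
    have A1: "ac_on \<alpha> \<beta> (\<lambda>x. u (1 / r * x + - \<alpha> / r)) (\<lambda>x. 1 / r * u' (1 / r * x + - \<alpha> / r))"
      using A(1) unfolding ends by simp
    have A2: "integral {\<alpha>..\<beta>} (\<lambda>x. (1 / r * u' (1 / r * x + - \<alpha> / r))\<^sup>2) = 1 / r * integral {0..1} (\<lambda>x. (u' x)\<^sup>2)"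
      using A(2) unfolding ends by simp
    note Cg = ac_on_cong[OF A1 pq, of e e']
    have eq: "e x = u (1 / r * x + - \<alpha> / r)" if "x \<in> {\<alpha>..\<beta>}" for x
    proof (cases "x = \<alpha>")
      case True
      then show ?thesis using g at\<alpha> by (simp add: e_def)
    next
      case False
      then show ?thesis using that g by (simp add: e_def)
    qed
    show "ac_on \<alpha> \<beta> e e'" using g eq by (intro Cg(1)) (auto simp: e'_def)
    have "?I \<alpha> \<beta> = integral {\<alpha>..\<beta>} (\<lambda>x. (1 / r * u' (1 / r * x + - \<alpha> / r))\<^sup>2)"
      using g eq by (intro Cg(2)) (auto simp: e'_def)
    then show "?I \<alpha> \<beta> = energy u' u' / r" using A2 by (simp add: energy_eq_square)
  qed
  have 4: "ac_on \<beta> (\<beta> + g) e e'" "?I \<beta> (\<beta> + g) = (u 1)\<^sup>2 / g"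
  proof -
    have pq: "\<beta> \<le> \<beta> + g" using g by simp
    note L = ac_on_linear[OF pq, of "- u 1 / g"]
    note Cg = ac_on_cong[OF L(1) pq, of e "\<beta> + g" e']
    have eq: "e x = - u 1 / g * (x - (\<beta> + g))" if "x \<in> {\<beta>..\<beta> + g}" for x
    proof (cases "x = \<beta>")
      case True
      then show ?thesis using ab g at\<beta> by (simp add: e_def)
    next
      case False
      then show ?thesis using that ab g by (simp add: e_def)
    qed
    show "ac_on \<beta> (\<beta> + g) e e'" using ab g eq by (intro Cg(1)) (auto simp: e'_def)
    have "?I \<beta> (\<beta> + g) = integral {\<beta>..\<beta> + g} (\<lambda>_. (- u 1 / g)\<^sup>2)"
      using ab g eq by (intro Cg(2)) (auto simp: e'_def)
    then show "?I \<beta> (\<beta> + g) = (u 1)\<^sup>2 / g" using L(2) g by (simp add: power2_eq_square)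
  qed
  have 5: "ac_on (\<beta> + g) 2 e e'" "?I (\<beta> + g) 2 = 0"
    using ac_on_cong[OF ac_on_const[of "\<beta> + g" 2 0], of e e'] ab g by (auto simp: e_def e'_def)
  have o: "-1 \<le> \<alpha> - g" "\<alpha> - g \<le> \<alpha>" "\<alpha> \<le> \<beta>" "\<beta> \<le> \<beta> + g" "\<beta> + g \<le> 2" using ab g by auto
  note c4 = ac_on_combine[OF 4(1) 5(1) o(4,5)]
  note c3 = ac_on_combine[OF 3(1) c4(1) o(3)]
  note c2 = ac_on_combine[OF 2(1) c3(1) o(2)]
  note c1 = ac_on_combine[OF 1(1) c2(1) o(1)]
  have ac: "ac_on (-1) 2 e e'" using c1(1) o by simp
  have tot: "?I (-1) 2 = energy u' u' / r + ((u 0)\<^sup>2 + (u 1)\<^sup>2) / g"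
    using c1(2) c2(2) c3(2) c4(2) o 1(2) 2(2) 3(2) 4(2) 5(2) by (simp add: add_divide_distrib)
  have ac01: "ac_on 0 1 e e'" using ac_on_subinterval[OF ac, of 0 1] by simp
  have "energy e' e' \<le> ?I (-1) 2"
    unfolding energy_eq_square using ac ac01
    by (intro integral_subset_le) (auto simp: ac_on_def)
  moreover have "e (\<alpha> + r * t) = u t" if t: "t \<in> {0..1}" for t
  proof -
    have i: "1 / r * (\<alpha> + r * t) + - \<alpha> / r = t" using r by (simp add: field_simps)
    have "r * t \<le> r" using t r by (simp add: mult_left_le)
    moreover have "\<alpha> + r = \<beta>" by (simp add: r_def)
    ultimately have le: "\<alpha> + r * t \<le> \<beta>" by linarith
    show ?thesis
    proof (cases "t = 0")
      case True
      then show ?thesis using g by (simp add: e_def)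
    next
      case False
      then have "0 < r * t" using t r by simp
      then show ?thesis using le i g by (simp add: e_def)
    qed
  qed
  moreover have "e x = 0" if "x \<le> \<alpha> - g \<or> \<beta> + g \<le> x" for x
    using that o g by (auto simp: e_def)
  ultimately show ?thesis using ac01 tot unfolding r_def[symmetric]
    by (intro exI[of _ e] exI[of _ e']) auto
qed

section \<open>Orthonormal families produced by transplantation\<close>

context cantor_string
begin

definition ip :: "(real \<Rightarrow> real) \<Rightarrow> (real \<Rightarrow> real) \<Rightarrow> real" where "ip f g = (\<integral>s. f s * g s \<partial>\<rho>)"

lemma ip_self_similar:
  assumes "continuous_on {0..1} f" "continuous_on {0..1} g"
  shows "ip f g = (\<Sum>k = 1..m. w k * ip (\<lambda>t. f (sim k t)) (\<lambda>t. g (sim k t)))"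
  unfolding ip_def by (rule self_similar[OF continuous_on_mult[OF assms]])

lemma ip_cong: "\<lbrakk>\<And>x. x \<in> {0..1} \<Longrightarrow> f x = f' x; \<And>x. x \<in> {0..1} \<Longrightarrow> g x = g' x\<rbrakk> \<Longrightarrow> ip f g = ip f' g'"
  unfolding ip_def by (intro Bochner_Integration.integral_cong) (auto simp: space_rho)

lemma gap_bound_exists: "\<exists>g. 0 < g \<and> g \<le> 1 \<and> (\<forall>k l. 1 \<le> k \<longrightarrow> k < l \<longrightarrow> l \<le> m \<longrightarrow> b k + g \<le> a l)"
proof -
  define X where "X = insert 1 ((\<lambda>(k, l). a l - b k) ` {(k, l). k \<in> {1..m} \<and> l \<in> {1..m} \<and> k < l})"
  have "finite {(k, l). k \<in> {1..m} \<and> l \<in> {1..m} \<and> k < l}"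
    by (rule finite_subset[of _ "{1..m} \<times> {1..m}"]) auto
  then have fin: "finite X" unfolding X_def by simp
  have "0 < Min X" using fin b_less_a by (subst Min_gr_iff) (auto simp: X_def)
  moreover have "Min X \<le> 1" using fin by (intro Min_le) (auto simp: X_def)
  moreover have "b k + Min X \<le> a l" if "1 \<le> k" "k < l" "l \<le> m" for k l
  proof -
    have "Min X \<le> a l - b k" using that fin by (intro Min_le) (auto simp: X_def)
    then show ?thesis by simp
  qed
  ultimately show ?thesis by blast
qed

text \<open>A common ramp length for all segments: ramps of this length do not enter a neighbouring
  segment, and the bound 1 keeps them inside [-1,2] in \<open>transplant_exists\<close>.\<close>

definition gp :: real where
  "gp = (SOME g. 0 < g \<and> g \<le> 1 \<and> (\<forall>k l. 1 \<le> k \<longrightarrow> k < l \<longrightarrow> l \<le> m \<longrightarrow> b k + g \<le> a l))"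

lemma gp: "0 < gp" "gp \<le> 1" "\<lbrakk>1 \<le> k; k < l; l \<le> m\<rbrakk> \<Longrightarrow> b k + gp \<le> a l"
  using someI_ex[OF gap_bound_exists] unfolding gp_def by blast+

text \<open>The segment I_k has weight \<open>w k\<close>, so division by its square root preserves
  the norm. The energy then acquires the factor 1 / (w k r k) = 1 / \<tau>, the same for every k;
  this is where the assumption on \<tau> makes all segments equivalent.\<close>

lemma transplant:
  assumes k: "k \<in> {1..m}" and u: "ac_on 0 1 u u'"
  shows "\<exists>e e'. ac_on 0 1 e e' \<and>
     (\<forall>l\<in>{1..m}. \<forall>t\<in>{0..1}. e (sim l t) = (if l = k then u t / sqrt (w k) else 0)) \<and>
     energy e' e' \<le> energy u' u' / \<tau> + ((u 0)\<^sup>2 + (u 1)\<^sup>2) / (gp * w k)"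
proof -
  obtain e e' where e: "ac_on 0 1 e e'" "\<And>t. t \<in> {0..1} \<Longrightarrow> e (a k + (b k - a k) * t) = u t"
    "\<And>x. x \<le> a k - gp \<or> b k + gp \<le> x \<Longrightarrow> e x = 0"
    "energy e' e' \<le> energy u' u' / (b k - a k) + ((u 0)\<^sup>2 + (u 1)\<^sup>2) / gp"
    using transplant_exists[OF u a_nonneg[OF k] a_less_b[OF k] b_le_1[OF k] gp(1,2)] by metis
  define c where "c = 1 / sqrt (w k)"
  have wk: "0 < w k" by (rule w_pos[OF k])
  have c2: "c\<^sup>2 = 1 / w k" using wk by (simp add: c_def power_divide)
  have "c * e (sim l t) = (if l = k then u t / sqrt (w k) else 0)" if l: "l \<in> {1..m}" and t: "t \<in> {0..1}" for l t
  proof (cases "l = k")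
    case True
    then show ?thesis using e(2)[OF t] by (simp add: c_def sim_def r_def algebra_simps)
  next
    case False
    have s: "sim l t \<in> {a l..b l}" by (rule sim_01[OF l t])
    have "e (sim l t) = 0"
      using gp(3)[of l k] gp(3)[of k l] False l k s by (intro e(3)) (cases "l < k", auto)
    then show ?thesis using False by simp
  qed
  moreover have "energy (\<lambda>x. c * e' x) (\<lambda>x. c * e' x) \<le> energy u' u' / \<tau> + ((u 0)\<^sup>2 + (u 1)\<^sup>2) / (gp * w k)"
  proof -
    have "energy (\<lambda>x. c * e' x) (\<lambda>x. c * e' x) = c\<^sup>2 * energy e' e'"
      by (simp add: energy_eq_square power_mult_distrib)
    also have "\<dots> \<le> c\<^sup>2 * (energy u' u' / (b k - a k) + ((u 0)\<^sup>2 + (u 1)\<^sup>2) / gp)"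
      using e(4) by (intro mult_left_mono) auto
    also have "\<dots> = energy u' u' / (w k * (b k - a k)) + ((u 0)\<^sup>2 + (u 1)\<^sup>2) / (gp * w k)"
      by (simp add: c2 distrib_left add_divide_distrib mult.commute)
    finally show ?thesis by (simp add: w_tau[OF k])
  qed
  ultimately show ?thesis using ac_on_scale[OF e(1), of c] by blast
qed

text \<open>The index n encodes the copy of \<open>u (n div m)\<close> living in segment
  \<open>n mod m + 1\<close>. Copies in different segments are orthogonal because each vanishes on
  all other segments and, by self-similarity, only the segments enter \<open>ip\<close>.\<close>

lemma transplanted_orthonormal_family:
  assumes u: "\<And>j. j < M \<Longrightarrow> ac_on 0 1 (u j) (u' j)"
    and orth: "\<And>i j. i < M \<Longrightarrow> j < M \<Longrightarrow> ip (u i) (u j) = of_bool (i = j)"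
  shows "\<exists>e e'. (\<forall>n<m * M. ac_on 0 1 (e n) (e' n)) \<and>
     (\<forall>i<m * M. \<forall>j<m * M. ip (e i) (e j) = of_bool (i = j)) \<and>
     (\<forall>n<m * M. energy (e' n) (e' n) \<le> energy (u' (n div m)) (u' (n div m)) / \<tau> +
        ((u (n div m) 0)\<^sup>2 + (u (n div m) 1)\<^sup>2) / (gp * w (n mod m + 1)))"
proof -
  have m0: "0 < m" using m2 by simp
  let ?k = "\<lambda>n. n mod m + 1"
  have k: "?k n \<in> {1..m}" for n using m0 by (simp add: Suc_leI)
  have dv: "n div m < M" if "n < m * M" for n
    using that m0 by (simp add: div_less_iff_less_mult mult.commute)
  define Q where "Q n e e' \<longleftrightarrow> ac_on 0 1 e e' \<and>
     (\<forall>l\<in>{1..m}. \<forall>t\<in>{0..1}. e (sim l t) = (if l = ?k n then u (n div m) t / sqrt (w (?k n)) else 0)) \<and>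
     energy e' e' \<le> energy (u' (n div m)) (u' (n div m)) / \<tau> + ((u (n div m) 0)\<^sup>2 + (u (n div m) 1)\<^sup>2) / (gp * w (?k n))"
    for n e e'
  have "\<exists>e e'. Q n e e'" if "n < m * M" for n
    unfolding Q_def by (rule transplant[OF k u[OF dv[OF that]]])
  then obtain e e' where eQ: "\<And>n. n < m * M \<Longrightarrow> Q n (e n) (e' n)" by metis
  have e: "\<And>n. n < m * M \<Longrightarrow> ac_on 0 1 (e n) (e' n)"
     "\<And>n l t. n < m * M \<Longrightarrow> l \<in> {1..m} \<Longrightarrow> t \<in> {0..1} \<Longrightarrow>
        e n (sim l t) = (if l = ?k n then u (n div m) t / sqrt (w (?k n)) else 0)"
     "\<And>n. n < m * M \<Longrightarrow> energy (e' n) (e' n) \<le> energy (u' (n div m)) (u' (n div m)) / \<tau> + ((u (n div m) 0)\<^sup>2 + (u (n div m) 1)\<^sup>2) / (gp * w (?k n))"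
    using eQ unfolding Q_def by blast+
  have "ip (e i) (e j) = of_bool (i = j)" if ij: "i < m * M" "j < m * M" for i j
  proof -
    have "ip (e i) (e j) = (\<Sum>l = 1..m. w l * ip (\<lambda>t. e i (sim l t)) (\<lambda>t. e j (sim l t)))"
      using ij e(1) ac_on_continuous[of 0 1] by (intro ip_self_similar) auto
    also have "\<dots> = (\<Sum>l = 1..m. if l = ?k i then (if ?k i = ?k j then ip (u (i div m)) (u (j div m)) else 0) else 0)"
    proof (intro sum.cong refl)
      fix l assume l: "l \<in> {1..m}"
      have "ip (\<lambda>t. e i (sim l t)) (\<lambda>t. e j (sim l t))
        = ip (\<lambda>t. if l = ?k i then u (i div m) t / sqrt (w (?k i)) else 0) (\<lambda>t. if l = ?k j then u (j div m) t / sqrt (w (?k j)) else 0)"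
        using e(2) ij l by (intro ip_cong) auto
      then show "w l * ip (\<lambda>t. e i (sim l t)) (\<lambda>t. e j (sim l t))
        = (if l = ?k i then (if ?k i = ?k j then ip (u (i div m)) (u (j div m)) else 0) else 0)"
        using w_pos[OF l] by (auto simp: ip_def)
    qed
    also have "\<dots> = (if ?k i = ?k j then ip (u (i div m)) (u (j div m)) else 0)"
      using k[of i] by (subst sum.delta) auto
    also have "\<dots> = of_bool (i = j)"
    proof -
      have "i = j \<longleftrightarrow> i mod m = j mod m \<and> i div m = j div m"
        by (metis div_mult_mod_eq)
      then show ?thesis using orth[OF dv dv, OF ij] by auto
    qed
    finally show ?thesis .
  qed
  then show ?thesis using e(1,3) by (intro exI[of _ e] exI[of _ e'] conjI allI impI)
qed

text \<open>Starting from the constant 1, each round of transplantation multiplies the number of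
  functions by m. In \<open>spectral_step\<close> such families ensure that finitely many
  orthogonality conditions never exhaust the space.\<close>

lemma orthonormal_family_exists:
  fixes N :: nat
  shows "\<exists>e e'. (\<forall>n<N. ac_on 0 1 (e n) (e' n)) \<and> (\<forall>i<N. \<forall>j<N. ip (e i) (e j) = of_bool (i = j))"
proof -
  have "\<exists>e e'. (\<forall>n<m ^ p. ac_on 0 1 (e n) (e' n)) \<and> (\<forall>i<m ^ p. \<forall>j<m ^ p. ip (e i) (e j) = of_bool (i = j))" for p
  proof (induction p)
    case 0
    show ?case
      by (intro exI[of _ "\<lambda>_ _. 1"] exI[of _ "\<lambda>_ _. 0"]) (simp add: ac_on_const ip_def prob_space)
  next
    case (Suc p)
    then obtain e e' where "\<And>n. n < m ^ p \<Longrightarrow> ac_on 0 1 (e n) (e' n)"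
      "\<And>i j. i < m ^ p \<Longrightarrow> j < m ^ p \<Longrightarrow> ip (e i) (e j) = of_bool (i = j)" by blast
    from transplanted_orthonormal_family[OF this] show ?case unfolding power_Suc by blast
  qed
  from this[of N] obtain e e' where E:
    "\<And>n. n < m ^ N \<Longrightarrow> ac_on 0 1 (e n) (e' n)"
    "\<And>i j. i < m ^ N \<Longrightarrow> j < m ^ N \<Longrightarrow> ip (e i) (e j) = of_bool (i = j)" by blast
  have "N < m ^ N" by (rule power_gt_expt) (use m2 in simp)
  then have less: "i < m ^ N" if "i < N" for i using that by (rule less_trans[rotated])
  show ?thesis by (intro exI[of _ e] exI[of _ e'] conjI allI impI E less)
qed

end

section \<open>The spectral sequence of the string\<close>

text \<open>Functions, and hence pairs of functions, become vectors to which
  \<open>semi_inner\<close> and \<open>eigen_system\<close> apply.\<close>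

instantiation "fun" :: (type, real_vector) real_vector
begin

definition scaleR_fun :: "real \<Rightarrow> ('a \<Rightarrow> 'b) \<Rightarrow> 'a \<Rightarrow> 'b" where
  "scaleR_fun c f = (\<lambda>x. c *\<^sub>R f x)"

instance
  by standard (auto simp: scaleR_fun_def plus_fun_def fun_eq_iff scaleR_add_right scaleR_add_left)

end

lemma scaleR_fun_apply [simp]: "(c *\<^sub>R f) x = c *\<^sub>R f x"
  by (simp add: scaleR_fun_def)

section \<open>The vector space carrying both quadratic forms\<close>

lemma (in semi_inner) semi_inner_subspace:
  "subspace W \<Longrightarrow> W \<subseteq> H \<Longrightarrow> semi_inner W ip"
  by standard (auto simp: subsetD ip_add_left ip_scale_left ip_nonneg intro: ip_sym)

text \<open>Keeping a function together with a chosen derivative lets both forms live on one vector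
  space: \<open>ip\<close> acts on the first component, the energy on the second.\<close>

definition ac_space :: "((real \<Rightarrow> real) \<times> (real \<Rightarrow> real)) set" where
  "ac_space = {(f, f'). ac_on 0 1 f f'}"

lemma energy_add_left:
  assumes "ac_on 0 1 f f'" "ac_on 0 1 g g'" "ac_on 0 1 h h'"
  shows "energy (\<lambda>x. f' x + g' x) h' = energy f' h' + energy g' h'"
  unfolding energy_def using assms ac_on_mult_integrable'[of 0 1]
  by (subst Henstock_Kurzweil_Integration.integral_add[symmetric]) (auto simp: distrib_right)

lemma energy_scale_left: "energy (\<lambda>x. c * f' x) h' = c * energy f' h'"
  by (simp add: energy_def mult.assoc)

lemma energy_sym: "energy f' g' = energy g' f'"
  by (simp add: energy_def mult.commute)

lemma subspace_ac_space: "subspace ac_space"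
  unfolding subspace_def
proof (intro conjI ballI allI)
  show "0 \<in> ac_space" using ac_on_const[of 0 1 0] by (simp add: ac_space_def zero_prod_def zero_fun_def)
  fix x y assume "x \<in> ac_space" "y \<in> ac_space"
  then show "x + y \<in> ac_space"
    using ac_on_add[of 0 1] by (auto simp: ac_space_def plus_prod_def plus_fun_def)
next
  fix c x assume "x \<in> ac_space"
  then show "c *\<^sub>R x \<in> ac_space"
    using ac_on_scale[of 0 1] by (auto simp: ac_space_def scaleR_prod_def scaleR_fun_def)
qed

lemma energy_semi_inner: "semi_inner ac_space (\<lambda>x y. energy (snd x) (snd y))"
proof
  show "subspace ac_space" by (rule subspace_ac_space)
  fix x y z :: "(real \<Rightarrow> real) \<times> (real \<Rightarrow> real)"
  assume xyz: "x \<in> ac_space" "y \<in> ac_space" 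
  show "energy (snd x) (snd y) = energy (snd y) (snd x)" by (rule energy_sym)
  show "energy (snd (c *\<^sub>R x)) (snd y) = c * energy (snd x) (snd y)" for c
    by (simp add: scaleR_fun_def energy_scale_left)
  assume "z \<in> ac_space"
  then show "energy (snd (x + y)) (snd z) = energy (snd x) (snd z) + energy (snd y) (snd z)"
    using xyz energy_add_left by (auto simp: ac_space_def plus_fun_def)
next
  fix x :: "(real \<Rightarrow> real) \<times> (real \<Rightarrow> real)"
  assume "x \<in> ac_space"
  then have "(\<lambda>t. snd x t * snd x t) integrable_on {0..1}"
    by (auto simp: ac_space_def intro!: ac_on_mult_integrable')
  then show "0 \<le> energy (snd x) (snd x)"
    unfolding energy_def by (intro Henstock_Kurzweil_Integration.integral_nonneg) auto
qed

lemma energy_cauchy_schwarz: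
  assumes "ac_on 0 1 f f'" "ac_on 0 1 g g'"
  shows "(energy f' g')\<^sup>2 \<le> energy f' f' * energy g' g'"
  using semi_inner.cauchy_schwarz[OF energy_semi_inner, of "(f, f')" "(g, g')"] assms
  by (simp add: ac_space_def)

lemma energy_nonneg: "ac_on 0 1 f f' \<Longrightarrow> 0 \<le> energy f' f'"
  using semi_inner.ip_nonneg[OF energy_semi_inner, of "(f, f')"] by (simp add: ac_space_def)

section \<open>The Green operator of the Neumann problem\<close>

context cantor_string
begin

text \<open>Stands in for L_2(rho). It is not complete for \<open>ip\<close>, but \<open>K\<close>
  maps it to itself and the limits supplied by Arzela-Ascoli are continuous.\<close>

definition V :: "(real \<Rightarrow> real) set" where "V = {h. continuous_on {0..1} h}"

lemma V_I: "ac_on 0 1 f f' \<Longrightarrow> f \<in> V"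
  using ac_on_continuous[of 0 1 f f'] by (simp add: V_def)

lemma subspace_V: "subspace V"
  by (auto simp: subspace_def V_def plus_fun_def scaleR_fun_def zero_fun_def intro!: continuous_intros)

lemma mult_integrable_rho: "f \<in> V \<Longrightarrow> g \<in> V \<Longrightarrow> integrable \<rho> (\<lambda>s. f s * g s)"
  by (intro continuous_integrable_rho) (auto simp: V_def intro!: continuous_intros)

sublocale V: semi_inner V ip
proof
  show "subspace V" by (rule subspace_V)
  show "ip (x + y) z = ip x z + ip y z" if "x \<in> V" "y \<in> V" "z \<in> V" for x y z
    using that mult_integrable_rho by (simp add: ip_def distrib_right)
  show "ip (c *\<^sub>R x) z = c * ip x z" for c x z by (simp add: ip_def mult.assoc)
  show "ip x y = ip y x" for x y by (simp add: ip_def mult.commute)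
  show "0 \<le> ip x x" for x by (simp add: ip_def)
qed

lemma one_V: "(\<lambda>_. 1) \<in> V" by (simp add: V_def)

lemma ip_one_one: "ip (\<lambda>_. 1) (\<lambda>_. 1) = 1" by (simp add: ip_def prob_space)

text \<open>Up to sign the derivative of a solution: -y'' = h rho with y'(0) = 0 integrates to y' =
  - \<open>tail h\<close>.\<close>

definition tail :: "(real \<Rightarrow> real) \<Rightarrow> real \<Rightarrow> real" where
  "tail h x = (\<integral>s. h s * indicator {..x} s \<partial>\<rho>)"

lemma tail_integrable_rho:
  assumes h: "h \<in> V"
  shows "integrable \<rho> (\<lambda>s. h s * indicator {..x} s)"
proof (rule Bochner_Integration.integrable_bound)
  show i: "integrable \<rho> h" using h by (simp add: V_def continuous_integrable_rho)
  show "(\<lambda>s. h s * indicator {..x} s) \<in> borel_measurable \<rho>"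
    by (intro borel_measurable_times borel_measurable_integrable[OF i] indicator_measurable_rho) simp
  show "AE s in \<rho>. norm (h s * indicator {..x} s) \<le> norm (h s)"
    by (intro AE_I2) (simp add: indicator_def)
qed

lemma tail_bound:
  assumes h: "h \<in> V"
  shows "\<bar>tail h x\<bar> \<le> V.nrm h"
proof -
  have ah: "(\<lambda>s. \<bar>h s\<bar>) \<in> V" using h by (auto simp: V_def intro!: continuous_intros)
  have "\<bar>tail h x\<bar> \<le> (\<integral>s. \<bar>h s * indicator {..x} s\<bar> \<partial>\<rho>)" unfolding tail_def by (rule integral_abs_bound)
  also have "\<dots> \<le> (\<integral>s. \<bar>h s\<bar> * 1 \<partial>\<rho>)"
    using tail_integrable_rho[OF h] mult_integrable_rho[OF ah one_V]
    by (intro integral_mono) (auto simp: indicator_def)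
  also have "\<dots> = ip (\<lambda>s. \<bar>h s\<bar>) (\<lambda>_. 1)" by (simp add: ip_def)
  also have "\<dots> \<le> V.nrm (\<lambda>s. \<bar>h s\<bar>) * V.nrm (\<lambda>_. 1)" using V.ip_le_nrm[OF ah one_V] by simp
  also have "\<dots> = V.nrm h" by (simp add: V.nrm_def ip_one_one) (simp add: ip_def)
  finally show ?thesis .
qed

lemma tail_add: "\<lbrakk>h \<in> V; g \<in> V\<rbrakk> \<Longrightarrow> tail (h + g) x = tail h x + tail g x"
  using tail_integrable_rho[of h x] tail_integrable_rho[of g x] by (simp add: tail_def distrib_right)

lemma tail_scale: "tail (c *\<^sub>R h) x = c * tail h x"
  by (simp add: tail_def mult.assoc)

lemma tail_fubini:
  assumes h: "h \<in> V" and G: "ac_on 0 1 \<eta> \<eta>'"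
  shows "(\<lambda>x. \<eta>' x * tail h x) absolutely_integrable_on {0..1}"
    and "integral {0..1} (\<lambda>x. \<eta>' x * tail h x) = \<eta> 1 * ip h (\<lambda>_. 1) - ip h \<eta>"
proof -
  have f: "finite_measure \<rho>" by unfold_locales
  have hm: "h \<in> borel_measurable \<rho>" using h by (intro continuous_measurable_rho) (simp add: V_def)
  obtain B where B: "\<And>x. x \<in> {0..1} \<Longrightarrow> \<bar>h x\<bar> \<le> B"
    using compact_imp_bounded[OF compact_continuous_image[of "{0..1}" h]] h
    by (auto simp: V_def bounded_iff simp del: atLeastAtMost_iff)
  have Gi: "(\<eta>' has_integral (\<eta> 1 - \<eta> s)) {s..1}" if "s \<in> {0..1}" for s
    using ac_on_has_integral[OF G, of s 1] that by auto
  have sp: "space \<rho> \<subseteq> {0..1}" by (simp add: space_rho)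
  have B': "\<bar>h s\<bar> \<le> B" if "s \<in> space \<rho>" for s using B that by (simp add: space_rho)
  note T = fubini_tail[OF f ident_measurable_rho sp hm B' ac_on_square_absolutely_integrable[OF G] Gi]
  show "(\<lambda>x. \<eta>' x * tail h x) absolutely_integrable_on {0..1}"
    using T(1) by (simp add: tail_def)
  have "integral {0..1} (\<lambda>x. \<eta>' x * tail h x) = (\<integral>s. h s * (\<eta> 1 - \<eta> s) \<partial>\<rho>)"
    using T(2) by (simp add: tail_def)
  also have "\<dots> = (\<integral>s. \<eta> 1 * (h s * 1) - h s * \<eta> s \<partial>\<rho>)" by (simp add: algebra_simps)
  also have "\<dots> = \<eta> 1 * ip h (\<lambda>_. 1) - ip h \<eta>"
    unfolding ip_def using mult_integrable_rho[OF h one_V] mult_integrable_rho[OF h V_I[OF G]]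
    by (subst Bochner_Integration.integral_diff) auto
  finally show "integral {0..1} (\<lambda>x. \<eta>' x * tail h x) = \<eta> 1 * ip h (\<lambda>_. 1) - ip h \<eta>" .
qed

lemma ac_on_ident: "ac_on 0 1 (\<lambda>x. x) (\<lambda>_. 1)"
  using ac_on_linear(1)[of 0 1 1 0] by simp

lemma tail_integrable: "h \<in> V \<Longrightarrow> tail h absolutely_integrable_on {0..1}"
  using tail_fubini(1)[OF _ ac_on_ident, of h] by simp

lemma tail_integrable_on: "h \<in> V \<Longrightarrow> x \<le> 1 \<Longrightarrow> tail h integrable_on {0..x}"
  using integrable_on_subinterval[of "tail h" "{0..1}" 0 x] tail_integrable[of h]
    set_lebesgue_integral_eq_integral(1) by auto

definition potential :: "(real \<Rightarrow> real) \<Rightarrow> real \<Rightarrow> real" where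
  "potential h x = - integral {0..x} (tail h)"

text \<open>Clamping the argument makes \<open>K\<close> linear as an operator on functions on the whole line.\<close>

definition K :: "(real \<Rightarrow> real) \<Rightarrow> real \<Rightarrow> real" where
  "K h x = potential h (max 0 (min 1 x)) - (\<integral>s. potential h s \<partial>\<rho>)"

lemma potential_ac:
  assumes h: "h \<in> V"
  shows "ac_on 0 1 (potential h) (\<lambda>x. - tail h x)"
proof -
  have "((\<lambda>x. - tail h x) has_integral (potential h x - potential h 0)) {0..x}" if "x \<in> {0..1}" for x
    using tail_integrable_on[OF h, of x] that by (auto simp: potential_def intro!: has_integral_neg integrable_integral)
  moreover have "(\<lambda>x. (- tail h x)\<^sup>2) integrable_on {0..1}"
  proof (rule measurable_bounded_by_integrable_imp_integrable)
    have "tail h \<in> borel_measurable (lebesgue_on {0..1})"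
      using tail_integrable[OF h] lebesgue_on_Icc_integrable_iff by auto
    then show "(\<lambda>x. (- tail h x)\<^sup>2) \<in> borel_measurable (lebesgue_on {0..1})" by simp
    show "(\<lambda>_::real. (V.nrm h)\<^sup>2) integrable_on {0..1}" by (rule integrable_const_ivl)
    show "norm ((- tail h x)\<^sup>2) \<le> (V.nrm h)\<^sup>2" for x
      using tail_bound[OF h, of x] by (simp add: abs_le_square_iff[symmetric] V.nrm_def)
  qed auto
  ultimately show ?thesis by (simp add: ac_on_def)
qed

lemma K_ac:
  assumes h: "h \<in> V"
  shows "ac_on 0 1 (K h) (\<lambda>x. - tail h x)"
proof -
  have "ac_on 0 1 (\<lambda>x. potential h x + - (\<integral>s. potential h s \<partial>\<rho>)) (\<lambda>x. - tail h x + 0)"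
    by (intro ac_on_add potential_ac[OF h] ac_on_const) simp
  from ac_on_cong(1)[OF this, of "K h" "\<lambda>x. - tail h x"] show ?thesis by (auto simp: K_def)
qed

lemma K_V: "h \<in> V \<Longrightarrow> K h \<in> V"
  using K_ac V_I by blast

lemma K_mean: 
  assumes h: "h \<in> V"
  shows "ip (K h) (\<lambda>_. 1) = 0"
proof -
  have "ip (K h) (\<lambda>_. 1) = (\<integral>s. potential h s - (\<integral>s. potential h s \<partial>\<rho>) \<partial>\<rho>)"
    unfolding ip_def by (intro Bochner_Integration.integral_cong) (auto simp: K_def space_rho)
  also have "\<dots> = 0"
    using continuous_integrable_rho[of "potential h"] V_I[OF potential_ac[OF h]]
    by (simp add: V_def prob_space)
  finally show ?thesis .
qed

text \<open>Functions at \<open>ip\<close>-distance 0 have the same tail by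
  \<open>tail_null\<close>, so \<open>K\<close> sends them to literally the same function. This
  turns an eigenvalue equation modulo null vectors into an exact one.\<close>

lemma K_tail_cong: "(\<And>x. tail h x = tail g x) \<Longrightarrow> K h = K g"
proof -
  assume "\<And>x. tail h x = tail g x"
  then have "tail h = tail g" by (rule ext)
  then show ?thesis by (intro ext) (simp only: K_def potential_def)
qed

lemma potential_add:
  assumes "h \<in> V" "g \<in> V" "x \<le> 1"
  shows "potential (h + g) x = potential h x + potential g x"
proof -
  have "tail (h + g) = (\<lambda>x. tail h x + tail g x)" using assms by (simp add: fun_eq_iff tail_add)
  then show ?thesis using assms tail_integrable_on
    by (simp add: potential_def Henstock_Kurzweil_Integration.integral_add)
qed

lemma potential_scale: "potential (c *\<^sub>R h) x = c * potential h x"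
proof -
  have "tail (c *\<^sub>R h) = (\<lambda>x. c * tail h x)" by (simp add: fun_eq_iff tail_scale)
  then show ?thesis by (simp add: potential_def)
qed

lemma K_add:
  assumes "h \<in> V" "g \<in> V"
  shows "K (h + g) = K h + K g"
proof -
  have "(\<integral>s. potential (h + g) s \<partial>\<rho>) = (\<integral>s. potential h s + potential g s \<partial>\<rho>)"
    using assms by (intro Bochner_Integration.integral_cong) (auto simp: space_rho potential_add)
  also have "\<dots> = (\<integral>s. potential h s \<partial>\<rho>) + (\<integral>s. potential g s \<partial>\<rho>)"
    using continuous_integrable_rho V_I[OF potential_ac] assms
    by (intro Bochner_Integration.integral_add) (auto simp: V_def)
  finally show ?thesis using assms by (simp add: K_def fun_eq_iff potential_add)
qed

lemma K_scale: "K (c *\<^sub>R h) = c *\<^sub>R K h"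
  by (simp add: K_def fun_eq_iff potential_scale right_diff_distrib)

text \<open>The vanishing mean of h removes the boundary term at 1, which is the condition y'(1) =
  0. So on functions of mean 0 the operator \<open>K\<close> inverts the Neumann problem.\<close>

lemma K_weak:
  assumes h: "h \<in> V" "ip h (\<lambda>_. 1) = 0" and G: "ac_on 0 1 \<eta> \<eta>'"
  shows "energy (\<lambda>x. - tail h x) \<eta>' = ip h \<eta>"
  using tail_fubini(2)[OF h(1) G] h(2) by (simp add: energy_def mult.commute)

lemma K_lipschitz:
  assumes h: "h \<in> V" and xy: "x \<in> {0..1}" "y \<in> {0..1}"
  shows "\<bar>K h x - K h y\<bar> \<le> V.nrm h * \<bar>x - y\<bar>"
proof -
  have main: "\<bar>K h y - K h x\<bar> \<le> V.nrm h * \<bar>x - y\<bar>" if "0 \<le> x" "x \<le> y" "y \<le> 1" for x y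
  proof -
    have "((\<lambda>x. - tail h x) has_integral (K h y - K h x)) {x..y}"
      using ac_on_has_integral[OF K_ac[OF h]] that by auto
    then have "norm (K h y - K h x) \<le> V.nrm h * measure lborel {x..y}"
      using tail_bound[OF h] V.nrm_nonneg[OF h] by (intro has_integral_bound_real) auto
    then show ?thesis using that by (simp add: abs_minus_commute)
  qed
  show ?thesis using main[of x y] main[of y x] xy by (cases "x \<le> y") (auto simp: abs_minus_commute)
qed

text \<open>\<open>K h\<close> has mean 0, so its value at x is the mean over y of
  \<open>K h x - K h y\<close>, and the Lipschitz bound applies to these differences.\<close>

lemma K_sup_bound:
  assumes h: "h \<in> V" and x: "x \<in> {0..1}"
  shows "\<bar>K h x\<bar> \<le> V.nrm h"
proof -
  have Ki: "integrable \<rho> (K h)" using K_V[OF h] by (simp add: V_def continuous_integrable_rho)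
  have "(\<integral>y. K h x - K h y \<partial>\<rho>) = K h x"
    using Ki K_mean[OF h] by (simp add: ip_def prob_space)
  then have "\<bar>K h x\<bar> = \<bar>\<integral>y. K h x - K h y \<partial>\<rho>\<bar>" by simp
  also have "\<dots> \<le> (\<integral>y. \<bar>K h x - K h y\<bar> \<partial>\<rho>)" by (rule integral_abs_bound)
  also have "\<dots> \<le> (\<integral>y. V.nrm h \<partial>\<rho>)"
  proof (rule integral_mono)
    show "integrable \<rho> (\<lambda>y. \<bar>K h x - K h y\<bar>)" using Ki by auto
    show "\<bar>K h x - K h y\<bar> \<le> V.nrm h" if "y \<in> space \<rho>" for y
    proof -
      have y: "y \<in> {0..1}" using that by (simp add: space_rho)
      have "V.nrm h * \<bar>x - y\<bar> \<le> V.nrm h * 1"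
        using x y V.nrm_nonneg[OF h] by (intro mult_left_mono) auto
      then show ?thesis using K_lipschitz[OF h x y] by simp
    qed
  qed simp
  finally show ?thesis by (simp add: prob_space)
qed

lemma ip_self_le:
  assumes f: "f \<in> V" and B: "\<And>x. x \<in> {0..1} \<Longrightarrow> \<bar>f x\<bar> \<le> B"
  shows "ip f f \<le> B\<^sup>2"
proof -
  have "ip f f \<le> (\<integral>s. B\<^sup>2 \<partial>\<rho>)"
    unfolding ip_def
  proof (rule integral_mono[OF mult_integrable_rho[OF f f]])
    fix s assume "s \<in> space \<rho>"
    then have "\<bar>f s\<bar> \<le> \<bar>B\<bar>" using B by (fastforce simp: space_rho)
    then show "f s * f s \<le> B\<^sup>2" by (simp add: abs_le_square_iff power2_eq_square)
  qed simp
  then show ?thesis by (simp add: prob_space)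
qed

text \<open>The sup bound and the Lipschitz constant of \<open>K h\<close> are controlled by the
  seminorm of h, so Arzela-Ascoli yields a uniformly convergent subsequence, and uniform convergence
  implies convergence in \<open>ip\<close>.\<close>

lemma K_compact:
  assumes h: "\<And>n. h n \<in> V \<and> ip (h n) (h n) \<le> 1"
  shows "\<exists>f r. continuous_on {0..1} f \<and> strict_mono (r :: nat \<Rightarrow> nat) \<and>
     (\<lambda>n. ip (K (h (r n)) - f) (K (h (r n)) - f)) \<longlonglongrightarrow> 0"
proof -
  have n1: "V.nrm (h n) \<le> 1" for n using h[of n] by (simp add: V.nrm_def)
  obtain g k where g: "continuous_on {0..1} g" and k: "strict_mono (k :: nat \<Rightarrow> nat)"
    and lim: "\<And>e. 0 < e \<Longrightarrow> \<exists>N. \<forall>n x. n \<ge> N \<and> x \<in> {0..1} \<longrightarrow> norm (K (h (k n)) x - g x) < e"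
  proof (rule Arzela_Ascoli[of "{0..1::real}" "\<lambda>n. K (h n)" 1])
    show "norm (K (h n) x) \<le> 1" if "x \<in> {0..1}" for n x
      using K_sup_bound[of "h n" x] h[of n] n1[of n] that by simp
    show "\<exists>d>0. \<forall>n y. y \<in> {0..1} \<and> norm (x - y) < d \<longrightarrow> norm (K (h n) x - K (h n) y) < e"
      if x: "x \<in> {0..1}" and e: "0 < e" for x e :: real
    proof (intro exI[of _ e] conjI e allI impI)
      fix n y assume y: "y \<in> {0..1} \<and> norm (x - y) < e"
      have "V.nrm (h n) * \<bar>x - y\<bar> \<le> 1 * \<bar>x - y\<bar>" using n1 by (intro mult_right_mono) auto
      then show "norm (K (h n) x - K (h n) y) < e"
        using K_lipschitz[of "h n" x y] h[of n] x y by simp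
    qed
  qed auto
  have "(\<lambda>n. ip (K (h (k n)) - g) (K (h (k n)) - g)) \<longlonglongrightarrow> 0"
  proof (rule LIMSEQ_I)
    fix e :: real assume e: "0 < e"
    \<comment> \<open>With d <= 1 and d < e the square satisfies d^2 <= d < e.\<close>
    define d where "d = min 1 (e / 2)"
    have d: "0 < d" "d \<le> 1" "d < e" using e by (auto simp: d_def)
    obtain N where N: "\<And>n x. n \<ge> N \<Longrightarrow> x \<in> {0..1} \<Longrightarrow> norm (K (h (k n)) x - g x) < d"
      using lim[OF d(1)] by blast
    have "norm (ip (K (h (k n)) - g) (K (h (k n)) - g) - 0) < e" if n: "n \<ge> N" for n
    proof -
      have fV: "K (h (k n)) - g \<in> V" using K_V h g by (intro V.H_diff) (auto simp: V_def)
      have "ip (K (h (k n)) - g) (K (h (k n)) - g) \<le> d\<^sup>2"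
        using N[OF n] by (intro ip_self_le fV) (auto intro: less_imp_le)
      also have "\<dots> \<le> d" using d by (simp add: power2_eq_square mult_left_le)
      finally show ?thesis using d V.ip_nonneg[OF fV] by simp
    qed
    then show "\<exists>N. \<forall>n\<ge>N. norm (ip (K (h (k n)) - g) (K (h (k n)) - g) - 0) < e" by blast
  qed
  then show ?thesis using g k by blast
qed

lemma tail_null:
  assumes f: "f \<in> V" "ip f f = 0"
  shows "tail f x = 0"
  using tail_bound[OF f(1), of x] f(2) by (simp add: V.nrm_def)

end

section \<open>Construction of the eigenfunctions\<close>

context cantor_string
begin

text \<open>Maximizing (K h, h) on the complement W of the functions found so far gives the next
  eigenvalue as l = 1 / mu. The constant \<open>U 0\<close> belongs to the eigenvalue 0 and is not
  obtained from \<open>K\<close>; hence \<open>UK\<close> speaks only of positive indices.\<close>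

lemma spectral_step:
  fixes U :: "nat \<Rightarrow> real \<Rightarrow> real"
  assumes n: "0 < n" and U0: "U 0 = (\<lambda>_. 1)"
    and UV: "\<And>i. i < n \<Longrightarrow> U i \<in> V"
    and UK: "\<And>i. 0 < i \<Longrightarrow> i < n \<Longrightarrow> \<exists>l>0. K (U i) = (1 / l) *\<^sub>R U i"
  shows "\<exists>u u' l. ac_on 0 1 u u' \<and> ip u u = 1 \<and> (\<forall>i<n. ip u (U i) = 0) \<and> 0 < l \<and>
     K u = (1 / l) *\<^sub>R u \<and> (\<forall>x. u' x = - l * tail u x) \<and>
     (\<forall>\<eta> \<eta>'. ac_on 0 1 \<eta> \<eta>' \<longrightarrow> energy u' \<eta>' = l * ip u \<eta>) \<and>
     (\<forall>h h'. ac_on 0 1 h h' \<longrightarrow> (\<forall>i<n. ip h (U i) = 0) \<longrightarrow> l * ip h h \<le> energy h' h')"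
proof -
  define W where "W = {h \<in> V. \<forall>i<n. ip h (U i) = 0}"
  have WV: "h \<in> V" if "h \<in> W" for h using that by (auto simp: W_def)
  have W1: "ip h (\<lambda>_. 1) = 0" if "h \<in> W" for h using that n U0 by (auto simp: W_def)
  have sW: "subspace W"
    unfolding subspace_def
  proof (intro conjI ballI allI)
    show "0 \<in> W" using UV V.ip_zero_left V.H_zero by (simp add: W_def)
    show "x + y \<in> W" if "x \<in> W" "y \<in> W" for x y
      using that UV V.ip_add_left V.H_add by (simp add: W_def)
    show "c *\<^sub>R x \<in> W" if "x \<in> W" for c x
      using that UV V.ip_scale_left V.H_scale by (simp add: W_def)
  qed
  interpret W: semi_inner W ip
    by (rule V.semi_inner_subspace[OF sW]) (use WV in blast)
  have KE: "ip g (K h) = energy (\<lambda>x. - tail g x) (\<lambda>x. - tail h x)"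
    if "h \<in> V" "g \<in> V" "ip g (\<lambda>_. 1) = 0" for h g
    using K_weak[OF that(2,3) K_ac[OF that(1)]] by simp
  have K_sym: "ip (K h) g = ip h (K g)" if "h \<in> V" "g \<in> V" "ip h (\<lambda>_. 1) = 0" "ip g (\<lambda>_. 1) = 0" for h g
    using KE[OF that(1,2,4)] KE[OF that(2,1,3)] V.ip_sym[OF K_V[OF that(1)] that(2)]
      energy_sym[of "\<lambda>x. - tail g x"] by simp
  have Kh: "ip (K h) h = energy (\<lambda>x. - tail h x) (\<lambda>x. - tail h x)" if "h \<in> W" for h
    using KE[OF WV WV W1, OF that that that] V.ip_sym[OF K_V[OF WV] WV, OF that that] by simp
  have KW: "K h \<in> W" if h: "h \<in> W" for h
  proof -
    have hV: "h \<in> V" using h by (rule WV)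
    have "ip (K h) (U i) = 0" if i: "i < n" for i
    proof (cases "i = 0")
      case True
      then show ?thesis using K_mean[OF hV] U0 by simp
    next
      case False
      \<comment> \<open>\<open>K\<close> is symmetric only on functions of mean 0, so first
        \<open>U i\<close> is recognised as one: it is a multiple of its image under
        \<open>K\<close>.\<close>
      then obtain l where l: "0 < l" "K (U i) = (1 / l) *\<^sub>R U i" using UK[of i] i by auto
      have "ip (K (U i)) (\<lambda>_. 1) = 0" using K_mean[OF UV[OF i]] .
      then have "ip (U i) (\<lambda>_. 1) = 0"
        using l V.ip_scale_left[OF UV[OF i] one_V] by simp
      then have "ip (K h) (U i) = ip h (K (U i))" using W1[OF h] UV[OF i] hV by (intro K_sym)
      also have "\<dots> = (1 / l) * ip h (U i)" using l V.ip_scale_right[OF UV[OF i] hV] by simp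
      finally show ?thesis using h i by (simp add: W_def)
    qed
    then show ?thesis using K_V[OF hV] by (simp add: W_def)
  qed
  have "\<exists>f\<in>W. \<exists>\<mu>>0. ip f f = 1 \<and> ip (K f - \<mu> *\<^sub>R f) (K f - \<mu> *\<^sub>R f) = 0 \<and>
           (\<forall>h\<in>W. ip (K h) h \<le> \<mu> * ip h h)"
  proof (rule W.compact_operator_max[OF KW])
    show "K (x + y) = K x + K y" if "x \<in> W" "y \<in> W" for x y using K_add[OF WV WV, OF that] .
    show "K (c *\<^sub>R x) = c *\<^sub>R K x" for x c by (rule K_scale)
    show "ip (K x) y = ip x (K y)" if "x \<in> W" "y \<in> W" for x y
      using K_sym[OF WV WV W1 W1, OF that that] .
    show "0 \<le> ip (K x) x" if "x \<in> W" for x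
      using Kh[OF that] energy_nonneg[OF K_ac[OF WV[OF that]]] by simp
    show "ip (K x) (K x) \<le> ip x x" if "x \<in> W" for x
      using ip_self_le[OF K_V[OF WV[OF that]] K_sup_bound[OF WV[OF that]]] V.nrm_sq[OF WV[OF that]] by simp
    show "\<exists>f\<in>W. \<exists>r. strict_mono (r :: nat \<Rightarrow> nat) \<and>
        (\<lambda>n. ip (K (h (r n)) - f) (K (h (r n)) - f)) \<longlonglongrightarrow> 0"
      if h: "\<And>n. h n \<in> W \<and> ip (h n) (h n) \<le> 1" for h
    proof -
      have hV: "h n \<in> V \<and> ip (h n) (h n) \<le> 1" for n using h WV by blast
      obtain f r where f: "continuous_on {0..1} f" and r: "strict_mono (r :: nat \<Rightarrow> nat)"
        and lim: "(\<lambda>n. ip (K (h (r n)) - f) (K (h (r n)) - f)) \<longlonglongrightarrow> 0"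
        using K_compact[of h, OF hV] by blast
      have fV: "f \<in> V" using f by (simp add: V_def)
      have dV: "K (h (r k)) - f \<in> V" for k using K_V hV fV by (intro V.H_diff) auto
      \<comment> \<open>W is closed: by Cauchy-Schwarz orthogonality passes to limits in the
        seminorm.\<close>
      have "ip f (U i) = 0" if i: "i < n" for i
      proof -
        have "(ip f (U i))\<^sup>2 \<le> ip (K (h (r k)) - f) (K (h (r k)) - f) * ip (U i) (U i)" for k
        proof -
          have "ip (K (h (r k)) - f) (U i) = - ip f (U i)"
            using V.ip_diff_left[OF K_V[OF hV[THEN conjunct1]] fV UV[OF i], of "r k"] KW[of "h (r k)"] h i
            by (simp add: W_def)
          then show ?thesis using V.cauchy_schwarz[OF dV UV[OF i], of k] by simp
        qed
        moreover have "(\<lambda>k. ip (K (h (r k)) - f) (K (h (r k)) - f) * ip (U i) (U i)) \<longlonglongrightarrow> 0"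
          using tendsto_mult[OF lim tendsto_const] by simp
        ultimately have "(ip f (U i))\<^sup>2 \<le> 0" by (intro LIMSEQ_le_const) auto
        then show ?thesis by simp
      qed
      then have "f \<in> W" using fV by (simp add: W_def)
      then show ?thesis using r lim by blast
    qed
    show "\<exists>h\<in>W. 0 < ip (K h) h"
    proof -
      \<comment> \<open>Among n + 1 orthonormal functions some non-zero combination h meets the n
        conditions defining W. Then (h, h) is the energy product of \<open>K h\<close> and h, and
        Cauchy-Schwarz for the energy makes (K h, h) positive.\<close>
      obtain e e' where e: "\<And>i. i < Suc n \<Longrightarrow> ac_on 0 1 (e i) (e' i)"
        "\<And>i j. i < Suc n \<Longrightarrow> j < Suc n \<Longrightarrow> ip (e i) (e j) = of_bool (i = j)"
        using orthonormal_family_exists[of "Suc n"] by metis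
      have eV: "e i \<in> V" if "i < Suc n" for i using V_I[OF e(1)[OF that]] .
      have eV': "e i \<in> V" if "i \<le> n" for i using eV that by simp
      obtain c where c: "\<exists>i\<le>n. c i \<noteq> 0" "\<forall>k<n. (\<Sum>i\<le>n. c i * ip (e i) (U k)) = 0"
        using homogeneous_system_nontrivial[of n "\<lambda>k i. ip (e i) (U k)"] by blast
      define h where "h = (\<Sum>i\<le>n. c i *\<^sub>R e i)"
      define h' where "h' = (\<Sum>i\<le>n. c i *\<^sub>R e' i)"
      have "(\<Sum>i\<le>n. c i *\<^sub>R (e i, e' i)) \<in> ac_space"
        using e(1) by (intro subspace_sum[OF subspace_ac_space] subspace_scale[OF subspace_ac_space])
          (simp add: ac_space_def)
      moreover have "(\<Sum>i\<le>n. c i *\<^sub>R (e i, e' i)) = (h, h')"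
        by (simp add: h_def h'_def sum_prod[symmetric] prod_eq_iff fst_sum snd_sum)
      ultimately have hac: "ac_on 0 1 h h'" by (simp add: ac_space_def)
      have hV: "h \<in> V" by (rule V_I[OF hac])
      have hU: "ip h (U k) = 0" if k: "k < n" for k
      proof -
        have "ip h (U k) = (\<Sum>i\<le>n. ip (c i *\<^sub>R e i) (U k))"
          unfolding h_def using eV' UV[OF k] by (intro V.ip_sum_left V.H_scale) auto
        also have "\<dots> = (\<Sum>i\<le>n. c i * ip (e i) (U k))"
          using eV' UV[OF k] by (intro sum.cong refl V.ip_scale_left) auto
        finally show ?thesis using c(2) k by simp
      qed
      have eh: "ip (e i) h = c i" if i: "i \<le> n" for i
      proof -
        have "ip (e i) h = (\<Sum>j\<le>n. ip (e i) (c j *\<^sub>R e j))"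
          unfolding h_def using eV' i by (intro V.ip_sum_right V.H_scale) auto
        also have "\<dots> = (\<Sum>j\<le>n. if i = j then c j else 0)"
          using eV' i e(2) by (intro sum.cong refl) (simp add: V.ip_scale_right)
        finally show ?thesis using i by simp
      qed
      have "ip h h = (\<Sum>i\<le>n. ip (c i *\<^sub>R e i) h)"
        using V.ip_sum_left[of "{..n}" "\<lambda>i. c i *\<^sub>R e i" h] eV' hV V.H_scale by (simp add: h_def[symmetric])
      also have "\<dots> = (\<Sum>i\<le>n. (c i)\<^sup>2)"
        using eV' hV eh by (intro sum.cong refl) (simp add: V.ip_scale_left power2_eq_square)
      finally have "ip h h = (\<Sum>i\<le>n. (c i)\<^sup>2)" .
      then have hpos: "0 < ip h h" using c(1) by (auto intro!: sum_pos2)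
      have hW: "h \<in> W" using hV hU by (simp add: W_def)
      have "(ip h h)\<^sup>2 \<le> ip (K h) h * energy h' h'"
        using energy_cauchy_schwarz[OF K_ac[OF hV] hac] K_weak[OF hV W1[OF hW] hac] Kh[OF hW] by simp
      then have "0 < ip (K h) h * energy h' h'" using hpos by (smt (verit) zero_less_power)
      then have "0 < ip (K h) h"
        using energy_nonneg[OF hac] by (simp add: zero_less_mult_iff)
      then show ?thesis using hW by blast
    qed
  qed
  then obtain f \<mu> where f: "f \<in> W" "0 < \<mu>" "ip f f = 1"
    "ip (K f - \<mu> *\<^sub>R f) (K f - \<mu> *\<^sub>R f) = 0" and max: "\<And>h. h \<in> W \<Longrightarrow> ip (K h) h \<le> \<mu> * ip h h" by blast
  define l where "l = 1 / \<mu>"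
  \<comment> \<open>The maximizer f solves the equation only up to a null vector. Its image u = l K
    f has the same tail as f, so K u = K f = u / l holds at every point.\<close>
  define u where "u = l *\<^sub>R K f"
  define u' where "u' x = - l * tail u x" for x
  have fV: "f \<in> V" by (rule WV[OF f(1)])
  have l: "0 < l" using f by (simp add: l_def)
  have uW: "u \<in> W" unfolding u_def using KW[OF f(1)] W.H_scale by blast
  have uV: "u \<in> V" by (rule WV[OF uW])
  have tail_u: "tail u x = tail f x" for x
  proof -
    have d: "K f - \<mu> *\<^sub>R f \<in> V" using K_V[OF fV] fV by (intro V.H_diff V.H_scale)
    have "tail (K f) x = tail ((K f - \<mu> *\<^sub>R f) + \<mu> *\<^sub>R f) x" by simp
    also have "\<dots> = \<mu> * tail f x"
      using tail_null[OF d f(4)] by (subst tail_add[OF d V.H_scale[OF fV]]) (simp add: tail_scale)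
    finally show ?thesis using f(2) by (simp add: u_def tail_scale l_def)
  qed
  have Ku: "K u = K f" by (rule K_tail_cong) (rule tail_u)
  have Keq: "K u = (1 / l) *\<^sub>R u" unfolding Ku using l by (simp add: u_def)
  have uu: "ip u u = 1"
  proof -
    have d: "K f - \<mu> *\<^sub>R f \<in> V" using K_V[OF fV] fV by (intro V.H_diff V.H_scale)
    have ud: "u - f = l *\<^sub>R (K f - \<mu> *\<^sub>R f)" using f(2) by (simp add: u_def l_def scaleR_diff_right)
    have "ip (u - f) (u - f) = 0"
      unfolding ud using V.ip_scale_left[OF d V.H_scale[OF d]] V.ip_scale_right[OF d d] f(4) by simp
    then have n0: "V.nrm (u - f) = 0" "V.nrm (f - u) = 0"
      using V.nrm_minus[OF uV fV] by (simp_all add: V.nrm_def)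
    have "V.nrm u \<le> V.nrm f" using V.nrm_triangle[OF fV V.H_diff[OF uV fV]] n0 by simp
    moreover have "V.nrm f \<le> V.nrm u" using V.nrm_triangle[OF uV V.H_diff[OF fV uV]] n0 by simp
    ultimately have "V.nrm u = 1" using f(3) by (simp add: V.nrm_def)
    then show ?thesis using V.nrm_sq[OF uV] by simp
  qed
  have ac: "ac_on 0 1 u u'"
  proof -
    have "ac_on 0 1 (\<lambda>x. l * K u x) (\<lambda>x. l * - tail u x)" by (intro ac_on_scale K_ac uV)
    moreover have "u x = l * K u x" for x using l by (simp add: Keq)
    moreover have "u' x = l * - tail u x" for x by (simp add: u'_def)
    ultimately show ?thesis by (metis (no_types, lifting) ext)
  qed
  have weak: "energy u' \<eta>' = l * ip u \<eta>" if "ac_on 0 1 \<eta> \<eta>'" for \<eta> \<eta>'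
  proof -
    have "energy u' \<eta>' = energy (\<lambda>x. l * - tail u x) \<eta>'" by (simp add: u'_def[abs_def])
    also have "\<dots> = l * energy (\<lambda>x. - tail u x) \<eta>'" by (rule energy_scale_left)
    finally show ?thesis using K_weak[OF uV W1[OF uW] that] by simp
  qed
  \<comment> \<open>Cauchy-Schwarz for the energy gives (h, h)^2 <= (K h, h) energy(h), and
    maximality bounds (K h, h) by mu (h, h).\<close>
  have var: "l * ip h h \<le> energy h' h'" if hac: "ac_on 0 1 h h'" and "\<forall>i<n. ip h (U i) = 0" for h h'
  proof -
    have hV: "h \<in> V" by (rule V_I[OF hac])
    have hW: "h \<in> W" using hV that by (simp add: W_def)
    have "(ip h h)\<^sup>2 \<le> ip (K h) h * energy h' h'"
      using energy_cauchy_schwarz[OF K_ac[OF hV] hac] K_weak[OF hV W1[OF hW] hac] Kh[OF hW] by simp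
    also have "\<dots> \<le> \<mu> * ip h h * energy h' h'"
      using max[OF hW] energy_nonneg[OF hac] by (intro mult_right_mono)
    finally have "ip h h * ip h h \<le> ip h h * (\<mu> * energy h' h')" by (simp add: power2_eq_square algebra_simps)
    then have "ip h h \<le> \<mu> * energy h' h'"
      using V.ip_nonneg[OF hV] energy_nonneg[OF hac] f(2)
      by (cases "ip h h = 0") (auto simp: mult_le_cancel_left)
    then show ?thesis using f(2) by (simp add: l_def field_simps)
  qed
  show ?thesis
    using ac uu uW l Keq weak var
    by (intro exI[of _ u] exI[of _ u'] exI[of _ l]) (auto simp: W_def u'_def)
qed

text \<open>Step n refers to all earlier eigenfunctions, which calls for choice along the
  well-founded order of the indices. The predicate \<open>P\<close> records for n = 0 the constant
  function and for n > 0 the equation for \<open>K\<close>, as needed to continue with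
  \<open>spectral_step\<close>.\<close>

lemma spectral_sequence_exists:
  "\<exists>(u :: nat \<Rightarrow> real \<Rightarrow> real) u' lam. \<forall>n. ac_on 0 1 (u n) (u' n) \<and> ip (u n) (u n) = 1 \<and>
     (\<forall>i<n. ip (u n) (u i) = 0) \<and> (\<forall>x. u' n x = - lam n * tail (u n) x) \<and>
     (\<forall>\<eta> \<eta>'. ac_on 0 1 \<eta> \<eta>' \<longrightarrow> energy (u' n) \<eta>' = lam n * ip (u n) \<eta>) \<and>
     (\<forall>h h'. ac_on 0 1 h h' \<longrightarrow> (\<forall>i<n. ip h (u i) = 0) \<longrightarrow> lam n * ip h h \<le> energy h' h')"
proof -
  define G where "G u u' l \<longleftrightarrow> ac_on 0 1 u u' \<and> ip u u = 1 \<and> (\<forall>x. u' x = - l * tail u x) \<and>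
     (\<forall>\<eta> \<eta>'. ac_on 0 1 \<eta> \<eta>' \<longrightarrow> energy u' \<eta>' = l * ip u \<eta>)" for u u' l
  define P where "P F n t \<longleftrightarrow> (case t of (u, u', l) \<Rightarrow> G u u' l \<and> (\<forall>i<n. ip u (fst (F i)) = 0) \<and>
     (if n = 0 then u = (\<lambda>_. 1) else 0 < l \<and> K u = (1 / l) *\<^sub>R u) \<and>
     (\<forall>h h'. ac_on 0 1 h h' \<longrightarrow> (\<forall>i<n. ip h (fst (F i)) = 0) \<longrightarrow> l * ip h h \<le> energy h' h'))"
    for F :: "nat \<Rightarrow> (real \<Rightarrow> real) \<times> (real \<Rightarrow> real) \<times> real" and n t
  have "\<exists>F. \<forall>n. P F n (F n)"
  proof (rule dependent_wf_choice[of "{(x, y). x < y}"])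
    show "wf {(x, y). (x::nat) < y}" by (rule wf)
    show "P f x t = P g x t" if "\<And>z. (z, x) \<in> {(x, y). x < y} \<Longrightarrow> f z = g z" for f g x t
      using that by (simp add: P_def)
    show "\<exists>t. P f n t" if prev: "\<And>i. (i, n) \<in> {(x, y). x < y} \<Longrightarrow> P f i (f i)" for n f
    proof (cases "n = 0")
      case True
      have "G (\<lambda>_. 1) (\<lambda>_. 0) 0"
        by (simp add: G_def ac_on_const ip_one_one) (simp add: energy_def)
      then have "P f n ((\<lambda>_. 1), (\<lambda>_. 0), 0)"
        using True energy_nonneg by (simp add: P_def)
      then show ?thesis by blast
    next
      case False
      have prev': "P f i (fst (f i), fst (snd (f i)), snd (snd (f i)))" if "i < n" for i using prev that by simp
      have "\<exists>u u' l. ac_on 0 1 u u' \<and> ip u u = 1 \<and> (\<forall>i<n. ip u (fst (f i)) = 0) \<and> 0 < l \<and>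
        K u = (1 / l) *\<^sub>R u \<and> (\<forall>x. u' x = - l * tail u x) \<and>
        (\<forall>\<eta> \<eta>'. ac_on 0 1 \<eta> \<eta>' \<longrightarrow> energy u' \<eta>' = l * ip u \<eta>) \<and>
        (\<forall>h h'. ac_on 0 1 h h' \<longrightarrow> (\<forall>i<n. ip h (fst (f i)) = 0) \<longrightarrow> l * ip h h \<le> energy h' h')"
      proof (rule spectral_step)
        show "0 < n" using False by simp
        show "fst (f 0) = (\<lambda>_. 1)" using prev'[of 0] False by (simp add: P_def case_prod_beta)
        show "fst (f i) \<in> V" if "i < n" for i
          using prev'[OF that] V_I by (auto simp: P_def G_def case_prod_beta)
        show "\<exists>l>0. K (fst (f i)) = (1 / l) *\<^sub>R fst (f i)" if "0 < i" "i < n" for i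
          using prev'[OF that(2)] that(1) by (auto simp: P_def case_prod_beta)
      qed
      then obtain u u' l where "ac_on 0 1 u u' \<and> ip u u = 1 \<and> (\<forall>i<n. ip u (fst (f i)) = 0) \<and> 0 < l \<and>
        K u = (1 / l) *\<^sub>R u \<and> (\<forall>x. u' x = - l * tail u x) \<and>
        (\<forall>\<eta> \<eta>'. ac_on 0 1 \<eta> \<eta>' \<longrightarrow> energy u' \<eta>' = l * ip u \<eta>) \<and>
        (\<forall>h h'. ac_on 0 1 h h' \<longrightarrow> (\<forall>i<n. ip h (fst (f i)) = 0) \<longrightarrow> l * ip h h \<le> energy h' h')"
        by (elim exE)
      then have "P f n (u, u', l)" using False unfolding P_def G_def prod.case by simp
      then show ?thesis by blast
    qed
  qed
  then obtain F where F: "\<And>n. P F n (fst (F n), fst (snd (F n)), snd (snd (F n)))" by auto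
  show ?thesis
    using F unfolding P_def G_def prod.case
    by (intro exI[of _ "\<lambda>n. fst (F n)"] exI[of _ "\<lambda>n. fst (snd (F n))"] exI[of _ "\<lambda>n. snd (snd (F n))"]) simp
qed

end

section \<open>Eigenvalue estimates\<close>

locale spectral_string = cantor_string +
  fixes u u' :: "nat \<Rightarrow> real \<Rightarrow> real" and lam :: "nat \<Rightarrow> real"
  assumes u_ac: "\<And>n. ac_on 0 1 (u n) (u' n)"
    and u_norm: "\<And>n. ip (u n) (u n) = 1"
    and u_orth: "\<And>i n. i < n \<Longrightarrow> ip (u n) (u i) = 0"
    and u_tail: "\<And>n x. u' n x = - lam n * tail (u n) x"
    and u_weak: "\<And>n \<eta> \<eta>'. ac_on 0 1 \<eta> \<eta>' \<Longrightarrow> energy (u' n) \<eta>' = lam n * ip (u n) \<eta>"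
    and u_var: "\<And>n h h'. ac_on 0 1 h h' \<Longrightarrow> (\<And>i. i < n \<Longrightarrow> ip h (u i) = 0) \<Longrightarrow> lam n * ip h h \<le> energy h' h'"
begin

lemma u_V: "u n \<in> V" by (rule V_I[OF u_ac])

lemma u_orthonormal: "ip (u i) (u j) = of_bool (i = j)"
  using u_norm[of i] u_orth[of i j] u_orth[of j i] V.ip_sym[OF u_V u_V, of i j]
  by (cases i j rule: linorder_cases) auto

sublocale E: eigen_system ac_space "\<lambda>x y. ip (fst x) (fst y)" "\<lambda>x y. energy (snd x) (snd y)"
  "\<lambda>n. (u n, u' n)" lam
proof (rule eigen_system.intro)
  have fst_V: "fst x \<in> V" if "x \<in> ac_space" for x using that V_I by (auto simp: ac_space_def)
  show "semi_inner ac_space (\<lambda>x y. ip (fst x) (fst y))"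
  proof
    show "subspace ac_space" by (rule subspace_ac_space)
    show "ip (fst (x + y)) (fst z) = ip (fst x) (fst z) + ip (fst y) (fst z)"
      if "x \<in> ac_space" "y \<in> ac_space" "z \<in> ac_space" for x y z
      using that fst_V V.ip_add_left by simp
    show "ip (fst (c *\<^sub>R x)) (fst z) = c * ip (fst x) (fst z)"
      if "x \<in> ac_space" "z \<in> ac_space" for c x z
      using that fst_V V.ip_scale_left by simp
    show "ip (fst x) (fst y) = ip (fst y) (fst x)" if "x \<in> ac_space" "y \<in> ac_space" for x y
      using that fst_V V.ip_sym by simp
    show "0 \<le> ip (fst x) (fst x)" if "x \<in> ac_space" for x
      using that fst_V V.ip_nonneg by simp
  qed
  show "semi_inner ac_space (\<lambda>x y. energy (snd x) (snd y))" by (rule energy_semi_inner)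
  show "eigen_system_axioms ac_space (\<lambda>x y. ip (fst x) (fst y)) (\<lambda>x y. energy (snd x) (snd y)) (\<lambda>n. (u n, u' n)) lam"
  proof
    show "(u i, u' i) \<in> ac_space" for i using u_ac by (simp add: ac_space_def)
    show "ip (fst (u i, u' i)) (fst (u j, u' j)) = of_bool (i = j)" for i j by (simp add: u_orthonormal)
    show "energy (snd (u i, u' i)) (snd f) = lam i * ip (fst (u i, u' i)) (fst f)" if "f \<in> ac_space" for f i
      using that u_weak by (auto simp: ac_space_def)
    show "lam n * ip (fst f) (fst f) \<le> energy (snd f) (snd f)"
      if "f \<in> ac_space" "\<And>i. i < n \<Longrightarrow> ip (fst (u i, u' i)) (fst f) = 0" for f n
    proof (rule u_var)
      show "ac_on 0 1 (fst f) (snd f)" using that(1) by (auto simp: ac_space_def)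
      show "ip (fst f) (u i) = 0" if "i < n" for i
        using \<open>\<And>i. i < n \<Longrightarrow> ip (fst (u i, u' i)) (fst f) = 0\<close>[OF that] V.ip_sym[OF u_V fst_V[OF \<open>f \<in> ac_space\<close>], of i]
        by simp
    qed
  qed
qed

end

section \<open>Initial values and point evaluations\<close>

context cantor_string
begin

text \<open>The tail at x depends only on values on [0, x]; this causality lets the iteration in
  \<open>initial_value_zero\<close> gain a power of x at each round.\<close>

lemma tail_local_bound:
  assumes v: "v \<in> V" and M: "\<And>s. \<lbrakk>0 \<le> s; s \<le> x; s \<le> 1\<rbrakk> \<Longrightarrow> \<bar>v s\<bar> \<le> M" "0 \<le> M"
  shows "\<bar>tail v x\<bar> \<le> M"
proof -
  have "\<bar>tail v x\<bar> \<le> (\<integral>s. \<bar>v s * indicator {..x} s\<bar> \<partial>\<rho>)" unfolding tail_def by (rule integral_abs_bound)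
  also have "\<dots> \<le> (\<integral>s. M \<partial>\<rho>)"
    using tail_integrable_rho[OF v] M by (intro integral_mono) (auto simp: indicator_def space_rho)
  finally show ?thesis by (simp add: prob_space)
qed

text \<open>Picard iteration: \<open>|v x| \<le> B (l x)\<^sup>n / n!\<close> for all \<open>n\<close>.\<close>

lemma initial_value_zero:
  assumes v: "ac_on 0 1 v (\<lambda>x. - l * tail v x)" and v0: "v 0 = 0" and l: "0 \<le> l" and x: "x \<in> {0..1}"
  shows "v x = 0"
proof -
  have vV: "v \<in> V" by (rule V_I[OF v])
  obtain B where B: "\<And>x. x \<in> {0..1} \<Longrightarrow> \<bar>v x\<bar> \<le> B"
    using compact_imp_bounded[OF compact_continuous_image[of "{0..1}" v]] vV
    by (auto simp: V_def bounded_iff simp del: atLeastAtMost_iff)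
  have B0: "0 \<le> B" using B[of 0] v0 by simp
  have bound: "\<bar>v x\<bar> \<le> B * (l * x) ^ n / fact n" if "x \<in> {0..1}" for n x
    using that
  proof (induction n arbitrary: x)
    case 0
    then show ?case using B by simp
  next
    case (Suc n)
    have t: "\<bar>tail v y\<bar> \<le> B * (l * y) ^ n / fact n" if y: "y \<in> {0..1}" for y
    proof (rule tail_local_bound[OF vV])
      fix s assume s: "0 \<le> s" "s \<le> y" "s \<le> (1::real)"
      have "\<bar>v s\<bar> \<le> B * (l * s) ^ n / fact n" using Suc.IH[of s] s by simp
      also have "\<dots> \<le> B * (l * y) ^ n / fact n"
        using s l B0 by (intro divide_right_mono mult_left_mono power_mono) auto
      finally show "\<bar>v s\<bar> \<le> B * (l * y) ^ n / fact n" .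
    qed (use y l B0 in simp)
    have i: "((\<lambda>y. - l * tail v y) has_integral (v x - v 0)) {0..x}"
      using v Suc.prems by (simp add: ac_on_def)
    have j: "((\<lambda>y. l * (B * (l * y) ^ n / fact n)) has_integral
        (B * (l * x) ^ Suc n / fact (Suc n) - B * (l * 0) ^ Suc n / fact (Suc n))) {0..x}"
    proof (rule fundamental_theorem_of_calculus)
      show "((\<lambda>y. B * (l * y) ^ Suc n / fact (Suc n)) has_vector_derivative l * (B * (l * y) ^ n / fact n)) (at y within {0..x})"
        for y
      proof -
        have "((\<lambda>y. B * (l * y) ^ Suc n / fact (Suc n)) has_real_derivative
            (B * (real (Suc n) * (l * y) ^ n * l) / fact (Suc n))) (at y within {0..x})"
          by (rule derivative_eq_intros refl | simp)+
        moreover have "B * (real (Suc n) * (l * y) ^ n * l) / fact (Suc n) = l * (B * (l * y) ^ n / fact n)"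
          by (simp add: field_simps del: of_nat_Suc)
        ultimately show ?thesis by (simp only: has_real_derivative_iff_has_vector_derivative)
      qed
    qed (use Suc.prems in simp)
    have "norm (integral {0..x} (\<lambda>y. - l * tail v y)) \<le> integral {0..x} (\<lambda>y. l * (B * (l * y) ^ n / fact n))"
    proof (rule integral_norm_bound_integral)
      show "norm (- l * tail v y) \<le> l * (B * (l * y) ^ n / fact n)" if "y \<in> {0..x}" for y
      proof -
        have "norm (- l * tail v y) = l * \<bar>tail v y\<bar>" using l by (simp add: abs_mult)
        also have "\<dots> \<le> l * (B * (l * y) ^ n / fact n)"
          using that Suc.prems by (intro mult_left_mono t l) auto
        finally show ?thesis .
      qed
    qed (use i j in auto)
    then show ?case using integral_unique[OF i] integral_unique[OF j] v0 by simp
  qed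
  have "(\<lambda>n. B * ((l * x) ^ n / fact n)) \<longlonglongrightarrow> B * 0"
    using summable_LIMSEQ_zero[OF summable_exp[of "l * x"]]
    by (intro tendsto_mult tendsto_const) (simp add: divide_inverse mult.commute)
  then have "(\<lambda>n. B * (l * x) ^ n / fact n) \<longlonglongrightarrow> 0" by simp
  then have "\<bar>v x\<bar> \<le> 0" using bound[OF x] by (intro LIMSEQ_le_const) auto
  then show ?thesis by simp
qed

text \<open>The inequality (v x)^2 <= 2 (v s)^2 + 2 (v x - v s)^2 is averaged over s with respect to
  \<open>\<rho>\<close>; the last term is bounded by the oscillation estimate.\<close>

lemma evaluation_bound:
  assumes v: "ac_on 0 1 v v'" and x: "x \<in> {0..1}"
  shows "(v x)\<^sup>2 \<le> 2 * ip v v + 2 * energy v' v'"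
proof -
  have vV: "v \<in> V" by (rule V_I[OF v])
  have "(\<integral>s. (v x)\<^sup>2 \<partial>\<rho>) \<le> (\<integral>s. 2 * (v s * v s) + 2 * energy v' v' \<partial>\<rho>)"
  proof (rule integral_mono)
    show "integrable \<rho> (\<lambda>s. 2 * (v s * v s) + 2 * energy v' v')"
      using mult_integrable_rho[OF vV vV] by simp
    fix s assume "s \<in> space \<rho>"
    then have "(v x - v s)\<^sup>2 \<le> energy v' v'" using ac_on_oscillation[OF v x] by (simp add: space_rho)
    moreover have "(v x)\<^sup>2 \<le> 2 * (v s * v s) + 2 * (v x - v s)\<^sup>2"
      using zero_le_power2[of "2 * v s - v x"] by (simp add: power2_eq_square algebra_simps)
    ultimately show "(v x)\<^sup>2 \<le> 2 * (v s * v s) + 2 * energy v' v'" by linarith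
  qed simp
  then show ?thesis using mult_integrable_rho[OF vV vV] by (simp add: prob_space ip_def)
qed

lemma ac_on_sim:
  assumes v: "ac_on 0 1 v v'" and k: "k \<in> {1..m}"
  shows "ac_on 0 1 (\<lambda>t. v (sim k t)) (\<lambda>t. r k * v' (sim k t))"
    and "energy (\<lambda>t. r k * v' (sim k t)) (\<lambda>t. r k * v' (sim k t)) = r k * integral {a k..b k} (\<lambda>x. (v' x)\<^sup>2)"
proof -
  have sub: "ac_on (a k) (b k) v v'"
    by (rule ac_on_subinterval[OF v a_nonneg[OF k] b_le_1[OF k]])
  have le: "a k \<le> b k" using a_less_b[OF k] by simp
  have ends: "(a k - a k) / r k = 0" "(b k - a k) / r k = 1" using r_pos[OF k] by (auto simp: r_def)
  note A = ac_on_affinity[OF sub r_pos[OF k] le, of "a k", unfolded ends, folded sim_def]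
  show "ac_on 0 1 (\<lambda>t. v (sim k t)) (\<lambda>t. r k * v' (sim k t))" by (rule A(1))
  show "energy (\<lambda>t. r k * v' (sim k t)) (\<lambda>t. r k * v' (sim k t)) = r k * integral {a k..b k} (\<lambda>x. (v' x)\<^sup>2)"
    using A(2) by (simp add: energy_eq_square)
qed

lemma sum_energy_pieces:
  assumes v: "ac_on 0 1 v v'"
  shows "(\<Sum>k = 1..m. integral {a k..b k} (\<lambda>x. (v' x)\<^sup>2)) \<le> energy v' v'"
proof -
  have sq: "(\<lambda>x. (v' x)\<^sup>2) integrable_on {0..1}" using v by (simp add: ac_on_def)
  have "((\<lambda>x. if x \<in> {a k..b k} then (v' x)\<^sup>2 else 0) has_integral integral {a k..b k} (\<lambda>x. (v' x)\<^sup>2)) {0..1}"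
    if k: "k \<in> {1..m}" for k
  proof -
    have "(\<lambda>x. (v' x)\<^sup>2) integrable_on {a k..b k}" using sq sub01[OF k] by (rule integrable_on_subinterval)
    then show ?thesis using sub01[OF k] by (subst has_integral_restrict) (auto simp: integrable_integral)
  qed
  then have S: "((\<lambda>x. \<Sum>k = 1..m. if x \<in> {a k..b k} then (v' x)\<^sup>2 else 0) has_integral
      (\<Sum>k = 1..m. integral {a k..b k} (\<lambda>x. (v' x)\<^sup>2))) {0..1}" by (intro has_integral_sum) auto
  have le: "(\<Sum>k = 1..m. if x \<in> {a k..b k} then (v' x)\<^sup>2 else 0) \<le> (v' x)\<^sup>2" for x
  proof (cases "\<exists>k\<in>{1..m}. x \<in> {a k..b k}")
    case True
    then obtain k where k: "k \<in> {1..m}" "x \<in> {a k..b k}" by blast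
    have "x \<notin> {a l..b l}" if "l \<in> {1..m}" "l \<noteq> k" for l
      using that k b_less_a[of k l] b_less_a[of l k] by (cases "k < l") force+
    then have "(\<Sum>l = 1..m. if x \<in> {a l..b l} then (v' x)\<^sup>2 else 0) = (\<Sum>l = 1..m. if l = k then (v' x)\<^sup>2 else 0)"
      using k by (intro sum.cong refl if_cong) auto
    then show ?thesis using k by simp
  next
    case False
    then have "(\<Sum>k = 1..m. if x \<in> {a k..b k} then (v' x)\<^sup>2 else 0) = 0"
      by (intro sum.neutral) auto
    then show ?thesis by simp
  qed
  show ?thesis unfolding energy_eq_square
    by (rule has_integral_le[OF S integrable_integral[OF sq]]) (rule le)
qed

lemma ip_sim_le:
  assumes v: "ac_on 0 1 v v'" and k: "k \<in> {1..m}"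
  shows "w k * ip (\<lambda>t. v (sim k t)) (\<lambda>t. v (sim k t)) \<le> ip v v"
proof -
  have c: "continuous_on {0..1} v" using ac_on_continuous[OF v] by simp
  have "ip v v = (\<Sum>l = 1..m. w l * ip (\<lambda>t. v (sim l t)) (\<lambda>t. v (sim l t)))"
    by (rule ip_self_similar[OF c c])
  moreover have "w k * ip (\<lambda>t. v (sim k t)) (\<lambda>t. v (sim k t)) \<le> (\<Sum>l = 1..m. w l * ip (\<lambda>t. v (sim l t)) (\<lambda>t. v (sim l t)))"
  proof (rule member_le_sum[OF k])
    show "0 \<le> w l * ip (\<lambda>t. v (sim l t)) (\<lambda>t. v (sim l t))" if "l \<in> {1..m} - {k}" for l
      using that w_pos[of l] by (intro mult_nonneg_nonneg) (auto simp: ip_def)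
  qed simp
  ultimately show ?thesis by simp
qed

text \<open>As S_k fixes y, the value v y does not change when v is replaced by v o S_k. Each
  replacement costs at most a factor 1 / w k in the norm and gains a factor r k in the energy, and p
  of them precede the use of \<open>evaluation_bound\<close>.\<close>

lemma fixed_point_evaluation_bound:
  assumes k: "k \<in> {1..m}" and y: "y \<in> {0..1}" "sim k y = y" and v: "ac_on 0 1 v v'"
  shows "(v y)\<^sup>2 \<le> 2 * (1 / w k) ^ p * ip v v + 2 * r k ^ p * energy v' v'"
  using v
proof (induction p arbitrary: v v')
  case 0
  then show ?case using evaluation_bound y(1) by simp
next
  case (Suc p)
  note S = ac_on_sim[OF Suc.prems k]
  have wk: "0 < w k" and rk: "0 < r k" using w_pos[OF k] r_pos[OF k] by auto
  have "(v y)\<^sup>2 \<le> 2 * (1 / w k) ^ p * ip (\<lambda>t. v (sim k t)) (\<lambda>t. v (sim k t))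
      + 2 * r k ^ p * energy (\<lambda>t. r k * v' (sim k t)) (\<lambda>t. r k * v' (sim k t))"
    using Suc.IH[OF S(1)] y(2) by simp
  also have "\<dots> \<le> 2 * (1 / w k) ^ p * (ip v v / w k) + 2 * r k ^ p * (r k * energy v' v')"
  proof (intro add_mono mult_left_mono)
    show "ip (\<lambda>t. v (sim k t)) (\<lambda>t. v (sim k t)) \<le> ip v v / w k"
      using ip_sim_le[OF Suc.prems k] wk by (simp add: pos_le_divide_eq mult.commute)
    have "integral {a k..b k} (\<lambda>x. (v' x)\<^sup>2) \<le> energy v' v'"
      unfolding energy_eq_square
      using sub01[OF k] Suc.prems ac_on_subinterval[OF Suc.prems a_nonneg[OF k] b_le_1[OF k]]
      by (intro integral_subset_le) (auto simp: ac_on_def)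
    then show "energy (\<lambda>t. r k * v' (sim k t)) (\<lambda>t. r k * v' (sim k t)) \<le> r k * energy v' v'"
      using rk by (simp add: S(2))
  qed (use wk rk in auto)
  also have "\<dots> = 2 * (1 / w k) ^ Suc p * ip v v + 2 * r k ^ Suc p * energy v' v'"
    by (simp add: algebra_simps)
  finally show ?case .
qed

lemma sim_1_0: "sim 1 0 = 0" and sim_m_1: "sim m 1 = 1"
  using a_1 b_m by (simp_all add: sim_def r_def)

lemma tau_pos: "0 < \<tau>" and tau_le_w: "k \<in> {1..m} \<Longrightarrow> \<tau> \<le> w k"
proof -
  show "0 < \<tau>" using w_tau[OF in_1m(1)] w_pos[OF in_1m(1)] r_pos[OF in_1m(1)] by (metis mult_pos_pos r_def)
  show "\<tau> \<le> w k" if k: "k \<in> {1..m}"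
    using w_tau[OF k] w_pos[OF k] r_le_1[OF k] mult_left_le[of "r k" "w k"] by (simp add: r_def)
qed

end

section \<open>Simplicity, growth and gaps of the eigenvalues\<close>

context spectral_string
begin

text \<open>If two eigenvalues coincide, the combination of their eigenfunctions that vanishes at 0
  is zero by \<open>initial_value_zero\<close>. Pairing it with \<open>u j\<close> shows that u i 0
  = 0, so \<open>u i\<close> itself vanishes, against its norm 1.\<close>

lemma lam_strict_mono: "i < j \<Longrightarrow> lam i < lam j"
proof (rule ccontr)
  assume ij: "i < j" and "\<not> lam i < lam j"
  then have eq: "lam j = lam i" using E.lam_mono[of i j] by simp
  define c where "c = - u j 0"
  define q where "q = u i 0"
  define v where "v x = q * u j x + c * u i x" for x
  have vf: "v = q *\<^sub>R u j + c *\<^sub>R u i" by (simp add: v_def fun_eq_iff)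
  have "ac_on 0 1 v (\<lambda>x. q * u' j x + c * u' i x)"
    unfolding v_def[abs_def] by (intro ac_on_add ac_on_scale u_ac) simp
  moreover have "q * u' j x + c * u' i x = - lam i * tail v x" for x
    unfolding vf by (subst tail_add) (auto simp: u_V V.H_scale tail_scale u_tail eq algebra_simps)
  ultimately have v: "ac_on 0 1 v (\<lambda>x. - lam i * tail v x)" by simp
  have "v 0 = 0" by (simp add: v_def c_def q_def)
  then have v0: "v x = 0" if "x \<in> {0..1}" for x
    by (rule initial_value_zero[OF v _ E.lam_nonneg that])
  have "ip v (u j) = q"
    unfolding vf using u_orthonormal[of j j] u_orthonormal[of i j] ij
    by (simp add: V.ip_simps u_V V.H_scale V.H_add)
  moreover have "ip v (u j) = ip (\<lambda>_. 0) (u j)" by (rule ip_cong) (auto simp: v0)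
  ultimately have q0: "u i 0 = 0" by (simp add: ip_def q_def)
  have ui: "ac_on 0 1 (u i) (\<lambda>x. - lam i * tail (u i) x)"
    using u_ac[of i] u_tail[of i] by (metis (no_types, lifting) ext)
  have "u i x = 0" if "x \<in> {0..1}" for x
    by (rule initial_value_zero[where v = "u i", OF ui q0 E.lam_nonneg that])
  then have "ip (u i) (u i) = ip (\<lambda>_. 0) (\<lambda>_. 0)" by (intro ip_cong) auto
  then show False using u_norm[of i] by (simp add: ip_def)
qed

lemma evaluation_trace_bound:
  assumes y: "y \<in> {0..1}" and A: "0 \<le> A" and B: "0 \<le> B"
    and bound: "\<And>v v'. ac_on 0 1 v v' \<Longrightarrow> (v y)\<^sup>2 \<le> A * ip v v + B * energy v' v'"
  shows "(\<Sum>j<M. (u j y)\<^sup>2) \<le> A + B * lam (M - 1)"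
  using E.functional_trace_bound[of "\<lambda>v. fst v y" A B M] bound A B by (auto simp: ac_space_def)

text \<open>M is the integral of sum_j (u j)^2, and the trace bound for evaluation at a single
  point, with both constants equal to 2, estimates the integrand. It makes the counting function
  finite.\<close>

lemma lam_growth: "real M \<le> 2 + 2 * lam (M - 1)"
proof -
  have "real M = (\<Sum>j<M. ip (u j) (u j))" by (simp add: u_norm)
  also have "\<dots> = (\<integral>s. (\<Sum>j<M. (u j s)\<^sup>2) \<partial>\<rho>)"
    unfolding ip_def power2_eq_square using mult_integrable_rho[OF u_V u_V]
    by (intro Bochner_Integration.integral_sum[symmetric])
  also have "\<dots> \<le> (\<integral>s. 2 + 2 * lam (M - 1) \<partial>\<rho>)"
  proof (rule integral_mono)
    show "integrable \<rho> (\<lambda>s. \<Sum>j<M. (u j s)\<^sup>2)"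
      unfolding power2_eq_square using mult_integrable_rho[OF u_V u_V] by (intro Bochner_Integration.integrable_sum)
    show "(\<Sum>j<M. (u j s)\<^sup>2) \<le> 2 + 2 * lam (M - 1)" if "s \<in> space \<rho>" for s
      using that evaluation_bound by (intro evaluation_trace_bound) (auto simp: space_rho)
  qed simp
  finally show ?thesis by (simp add: prob_space)
qed

lemma finite_lam_le: "finite {n. lam n \<le> l}"
proof -
  have "{n. lam n \<le> l} \<subseteq> {..nat \<lceil>2 + 2 * l\<rceil>}"
  proof
    fix n assume "n \<in> {n. lam n \<le> l}"
    then have "real (Suc n) \<le> 2 + 2 * l" using lam_growth[of "Suc n"] by simp
    then show "n \<in> {..nat \<lceil>2 + 2 * l\<rceil>}" by simp linarith
  qed
  then show ?thesis by (rule finite_subset) simp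
qed

text \<open>Among \<open>u 0, \<dots>, u n\<close> some combination has all its \<open>m\<close> pullbacks \<open>v \<circ> sim k\<close> orthogonal to
  \<open>u i\<close>, \<open>i < n div m\<close>, since these are at most \<open>n\<close> conditions.\<close>

lemma lam_div: "lam (n div m) \<le> \<tau> * lam n"
proof -
  have m0: "0 < m" using m2 by simp
  define j where "j = n div m"
  have jn: "m * j \<le> n" by (simp add: j_def)
  \<comment> \<open>The number k encodes a condition on segment \<open>k mod m + 1\<close> against
    the eigenfunction \<open>k div m\<close>. The first m (n div m) <= n of them are the conditions
    wanted.\<close>
  define l where "l k v = ip (\<lambda>t. fst v (sim (k mod m + 1) t)) (u (k div m))"
    for k and v :: "(real \<Rightarrow> real) \<times> (real \<Rightarrow> real)"
  have kin: "k mod m + 1 \<in> {1..m}" for k using m0 by (simp add: Suc_leI)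
  have simV: "(\<lambda>t. fst v (sim k t)) \<in> V" if "v \<in> ac_space" "k \<in> {1..m}" for v k
    using that ac_on_sim(1)[THEN V_I] by (auto simp: ac_space_def)
  have "lam j / \<tau> \<le> lam n"
  proof (rule E.lam_lower_by_constraints[where l = l])
    show "l k (x + y) = l k x + l k y" if "x \<in> ac_space" "y \<in> ac_space" for k x y
      using V.ip_add_left[OF simV[OF that(1) kin] simV[OF that(2) kin] u_V]
      by (simp add: l_def plus_fun_def)
    show "l k (c *\<^sub>R x) = c * l k x" if "x \<in> ac_space" for k c x
      using V.ip_scale_left[OF simV[OF that kin] u_V] by (simp add: l_def scaleR_fun_def)
    fix f assume f: "f \<in> ac_space" and zero: "\<And>k. k < n \<Longrightarrow> l k f = 0"
    obtain v v' where fv: "f = (v, v')" and v: "ac_on 0 1 v v'" using f by (auto simp: ac_space_def)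
    have c: "continuous_on {0..1} v" using ac_on_continuous[OF v] by simp
    have "lam j / \<tau> * ip v v = (\<Sum>k = 1..m. lam j / \<tau> * (w k * ip (\<lambda>t. v (sim k t)) (\<lambda>t. v (sim k t))))"
      using ip_self_similar[OF c c] by (simp add: sum_distrib_left)
    also have "\<dots> \<le> (\<Sum>k = 1..m. integral {a k..b k} (\<lambda>x. (v' x)\<^sup>2))"
    proof (rule sum_mono)
      fix k assume k: "k \<in> {1..m}"
      have "ip (\<lambda>t. v (sim k t)) (u i) = 0" if i: "i < j" for i
      proof -
        obtain k0 where k0: "k = Suc k0" "k0 < m" using k by (cases k) auto
        have eq: "(m * i + (k - 1)) mod m + 1 = k" "(m * i + (k - 1)) div m = i"
          using k0 m0 by simp_all
        have "m * i + (k - 1) < m * i + m" using k by auto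
        also have "\<dots> = m * Suc i" by simp
        also have "\<dots> \<le> m * j" using i by (intro mult_le_mono2) simp
        finally have "m * i + (k - 1) < n" using jn by simp
        then show ?thesis using zero[of "m * i + (k - 1)"] unfolding l_def eq fv by simp
      qed
      then have "lam j * ip (\<lambda>t. v (sim k t)) (\<lambda>t. v (sim k t)) \<le> r k * integral {a k..b k} (\<lambda>x. (v' x)\<^sup>2)"
        using u_var[OF ac_on_sim(1)[OF v k]] ac_on_sim(2)[OF v k] by simp
      then have "lam j * (w k * ip (\<lambda>t. v (sim k t)) (\<lambda>t. v (sim k t))) \<le> (w k * r k) * integral {a k..b k} (\<lambda>x. (v' x)\<^sup>2)"
        using mult_left_mono[OF _ less_imp_le[OF w_pos[OF k]],
            of "lam j * ip (\<lambda>t. v (sim k t)) (\<lambda>t. v (sim k t))" "r k * integral {a k..b k} (\<lambda>x. (v' x)\<^sup>2)"]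
        by (simp add: mult.assoc mult.left_commute)
      then show "lam j / \<tau> * (w k * ip (\<lambda>t. v (sim k t)) (\<lambda>t. v (sim k t))) \<le> integral {a k..b k} (\<lambda>x. (v' x)\<^sup>2)"
        using w_tau[OF k] tau_pos by (simp add: r_def pos_divide_le_eq mult.commute)
    qed
    also have "\<dots> \<le> energy v' v'" by (rule sum_energy_pieces[OF v])
    finally show "lam j / \<tau> * ip (fst f) (fst f) \<le> energy (snd f) (snd f)" by (simp add: fv)
  qed
  then show ?thesis using tau_pos by (simp add: j_def pos_divide_le_eq mult.commute)
qed

text \<open>Ky Fan's principle for the transplanted family. In the constant, m counts the copies of
  each \<open>u j\<close>, 1 / gp is the price of the ramps, and 2 comes from
  \<open>fixed_point_evaluation_bound\<close>, applicable because 0 is fixed by S_1 and 1 by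
  S_m.\<close>

lemma gap_sum_bound:
  "(\<Sum>n<m * M. \<tau> * lam n - lam (n div m)) \<le>
     2 * real m / gp * ((1 / w 1) ^ p + (1 / w m) ^ p + (r 1 ^ p + r m ^ p) * lam (M - 1))"
proof -
  have m0: "0 < m" using m2 by simp
  obtain e e' where e: "\<And>n. n < m * M \<Longrightarrow> ac_on 0 1 (e n) (e' n)"
    "\<And>i j. i < m * M \<Longrightarrow> j < m * M \<Longrightarrow> ip (e i) (e j) = of_bool (i = j)"
    "\<And>n. n < m * M \<Longrightarrow> energy (e' n) (e' n) \<le> energy (u' (n div m)) (u' (n div m)) / \<tau> +
        ((u (n div m) 0)\<^sup>2 + (u (n div m) 1)\<^sup>2) / (gp * w (n mod m + 1))"
    using transplanted_orthonormal_family[of M u u', OF u_ac u_orthonormal] by blast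
  define s where "s j = (u j 0)\<^sup>2 + (u j 1)\<^sup>2" for j
  have "(\<Sum>n<m * M. lam n) \<le> (\<Sum>n<m * M. energy (e' n) (e' n))"
    using E.ky_fan[of "m * M" "\<lambda>n. (e n, e' n)"] e(1,2) by (simp add: ac_space_def)
  also have "\<dots> \<le> (\<Sum>n<m * M. lam (n div m) / \<tau> + s (n div m) / (gp * \<tau>))"
  proof (rule sum_mono)
    fix n assume n: "n \<in> {..<m * M}"
    have k: "n mod m + 1 \<in> {1..m}" using m0 by (simp add: Suc_leI)
    have "energy (u' (n div m)) (u' (n div m)) = lam (n div m)"
      using u_weak[OF u_ac] u_norm by simp
    \<comment> \<open>Replacing \<open>w k\<close> by the smaller \<tau> makes the bound independent
      of the segment; this \<tau> cancels when the inequality is multiplied by \<tau>.\<close>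
    moreover have "s (n div m) / (gp * w (n mod m + 1)) \<le> s (n div m) / (gp * \<tau>)"
      using tau_le_w[OF k] tau_pos gp(1) by (intro divide_left_mono mult_left_mono) (auto simp: s_def)
    ultimately show "energy (e' n) (e' n) \<le> lam (n div m) / \<tau> + s (n div m) / (gp * \<tau>)"
      using e(3)[of n] n by (simp add: s_def)
  qed
  finally have "\<tau> * (\<Sum>n<m * M. lam n) \<le> \<tau> * (\<Sum>n<m * M. lam (n div m) / \<tau> + s (n div m) / (gp * \<tau>))"
    using tau_pos by (intro mult_left_mono) auto
  also have "\<dots> = (\<Sum>n<m * M. lam (n div m)) + (\<Sum>n<m * M. s (n div m)) / gp"
    using tau_pos by (simp add: sum_distrib_left sum.distrib sum_divide_distrib distrib_left)
  finally have "(\<Sum>n<m * M. \<tau> * lam n - lam (n div m)) \<le> (\<Sum>n<m * M. s (n div m)) / gp"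
    by (simp add: sum_subtractf sum_distrib_left)
  \<comment> \<open>Each j is the value of \<open>n div m\<close> for a block of m consecutive
    n.\<close>
  also have "(\<Sum>n<m * M. s (n div m)) = m * (\<Sum>j<M. s j)"
  proof -
    have "(\<Sum>n<M * m. s (n div m)) = (\<Sum>j<M. \<Sum>n = j * m..<j * m + m. s (n div m))"
      by (rule sum.nat_group[symmetric])
    also have "\<dots> = (\<Sum>j<M. \<Sum>n = j * m..<j * m + m. s j)"
      by (intro sum.cong refl arg_cong[of _ _ s]) (auto simp: div_nat_eqI mult.commute)
    finally show ?thesis by (simp add: mult.commute sum_distrib_left)
  qed
  also have "m * (\<Sum>j<M. s j) / gp \<le> m * (2 * ((1 / w 1) ^ p + (1 / w m) ^ p + (r 1 ^ p + r m ^ p) * lam (M - 1))) / gp"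
  proof (intro divide_right_mono mult_left_mono)
    have w0: "0 < w 1" "0 < w m" "0 < r 1" "0 < r m" using w_pos r_pos in_1m by auto
    have "(\<Sum>j<M. (u j 0)\<^sup>2) \<le> 2 * (1 / w 1) ^ p + 2 * r 1 ^ p * lam (M - 1)"
      using w0 fixed_point_evaluation_bound[OF in_1m(1) _ sim_1_0] by (intro evaluation_trace_bound) auto
    moreover have "(\<Sum>j<M. (u j 1)\<^sup>2) \<le> 2 * (1 / w m) ^ p + 2 * r m ^ p * lam (M - 1)"
      using w0 fixed_point_evaluation_bound[OF in_1m(2) _ sim_m_1] by (intro evaluation_trace_bound) auto
    ultimately show "(\<Sum>j<M. s j) \<le> 2 * ((1 / w 1) ^ p + (1 / w m) ^ p + (r 1 ^ p + r m ^ p) * lam (M - 1))"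
      by (simp add: s_def sum.distrib algebra_simps)
  qed (use gp(1) in auto)
  also have "real m * (2 * X) / gp = 2 * real m / gp * X" for X by simp
  finally show ?thesis .
qed

lemma energy_eq_lebesgue:
  "\<lbrakk>ac_on 0 1 f f'; ac_on 0 1 g g'\<rbrakk> \<Longrightarrow> (\<integral>x. f' x * g' x \<partial>unit_lebesgue) = energy f' g'"
  unfolding energy_def by (intro unit_lebesgue_integral ac_on_mult_integrable) auto

text \<open>An eigenfunction y for any other number would be orthogonal to all \<open>u i\<close>,
  so \<open>lam n\<close> (y, y) <= \<mu> (y, y) for every n. Unboundedness of \<open>lam\<close>
  forces (y, y) = 0, then the energy is 0 as well, and \<open>evaluation_bound\<close> makes y
  vanish everywhere on [0,1].\<close>

lemma neumann_eigenvalue_iff: "neumann_eigenvalue \<rho> \<mu> \<longleftrightarrow> \<mu> \<in> range lam"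
proof
  assume "\<mu> \<in> range lam"
  then obtain n where n: "\<mu> = lam n" by blast
  have "\<exists>x\<in>{0..1}. u n x \<noteq> 0"
  proof (rule ccontr)
    assume "\<not> ?thesis"
    then have "ip (u n) (u n) = ip (\<lambda>_. 0) (\<lambda>_. 0)" by (intro ip_cong) auto
    then show False using u_norm[of n] by (simp add: ip_def)
  qed
  moreover have "(\<integral>x. u' n x * \<eta>' x \<partial>unit_lebesgue) = lam n * (\<integral>x. u n x * \<eta> x \<partial>\<rho>)"
    if "ac_on 0 1 \<eta> \<eta>'" for \<eta> \<eta>'
    using u_weak[OF that] energy_eq_lebesgue[OF u_ac that] by (simp add: ip_def)
  ultimately show "neumann_eigenvalue \<rho> \<mu>"
    unfolding neumann_eigenvalue_def sobolev_iff_ac_on n using u_ac by blast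
next
  assume "neumann_eigenvalue \<rho> \<mu>"
  then obtain y y' x0 where y: "ac_on 0 1 y y'" and x0: "x0 \<in> {0..1}" "y x0 \<noteq> 0"
    and weak0: "\<And>\<eta> \<eta>'. ac_on 0 1 \<eta> \<eta>' \<Longrightarrow>
      (\<integral>x. y' x * \<eta>' x \<partial>unit_lebesgue) = \<mu> * (\<integral>x. y x * \<eta> x \<partial>\<rho>)"
    unfolding neumann_eigenvalue_def sobolev_iff_ac_on by blast
  have weak: "energy y' \<eta>' = \<mu> * ip y \<eta>" if "ac_on 0 1 \<eta> \<eta>'" for \<eta> \<eta>'
    using weak0[OF that] energy_eq_lebesgue[OF y that] by (simp add: ip_def)
  have yV: "y \<in> V" by (rule V_I[OF y])
  show "\<mu> \<in> range lam"
  proof (rule ccontr)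
    assume no: "\<mu> \<notin> range lam"
    have orth: "ip y (u i) = 0" for i
    proof -
      have "\<mu> * ip y (u i) = lam i * ip (u i) y"
        using weak[OF u_ac] u_weak[OF y] energy_sym by metis
      then have "(\<mu> - lam i) * ip y (u i) = 0" using V.ip_sym[OF yV u_V] by (simp add: algebra_simps)
      then show ?thesis using no by auto
    qed
    have "lam n * ip y y \<le> \<mu> * ip y y" for n using u_var[OF y orth] weak[OF y] by simp
    have "ip y y = 0"
    proof (rule ccontr)
      assume "ip y y \<noteq> 0"
      then have "0 < ip y y" using V.ip_nonneg[OF yV] by simp
      then have "lam n \<le> \<mu>" for n using \<open>\<And>n. lam n * ip y y \<le> \<mu> * ip y y\<close> by simp
      then have "{n. lam n \<le> \<mu>} = UNIV" by auto
      then show False using finite_lam_le[of \<mu>] by simp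
    qed
    then have "(y x0)\<^sup>2 \<le> 0" using evaluation_bound[OF y x0(1)] weak[OF y] by simp
    then show False using x0(2) by simp
  qed
qed

lemma counting_function_eq: "counting_function \<rho> l = card {n. lam n \<le> l}"
proof -
  have "inj lam" using lam_strict_mono by (intro linorder_injI) (metis less_irrefl)
  then have "card {n. lam n \<le> l} = card (lam ` {n. lam n \<le> l})"
    by (intro card_image[symmetric]) (auto intro: inj_on_subset)
  moreover have "{\<mu>. neumann_eigenvalue \<rho> \<mu> \<and> \<mu> \<le> l} = lam ` {n. lam n \<le> l}"
    by (auto simp: neumann_eigenvalue_iff)
  ultimately show ?thesis by (simp add: counting_function_def)
qed

end

section \<open>Pure singularity from asymptotic self-similarity of the counting function\<close>

text \<open>By monotonicity f is constant between any two points of a level set, so the derivative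
  is 0 at every point strictly between two others of its level. Each level set has at most two
  further points, and only countably many levels matter.\<close>

lemma purely_singular_if_countable_values:
  fixes f :: "real \<Rightarrow> real"
  assumes mono: "mono_on {p..q} f" and Z: "negligible Z" and Q: "countable Q"
    and val: "\<And>t. t \<in> {p..q} - Z \<Longrightarrow> f t \<in> Q"
  shows "purely_singular_on {p..q} f"
proof -
  define E where "E c = {t \<in> {p..q}. f t = c}" for c
  \<comment> \<open>The least and the greatest element of the level set, as far as they
    exist.\<close>
  define P where "P c = {t \<in> E c. \<not> (\<exists>x\<in>E c. \<exists>y\<in>E c. x < t \<and> t < y)}" for c
  have countP: "countable (P c)" for c
  proof -
    have "P c \<subseteq> {Inf (E c), Sup (E c)}"
    proof
      fix t assume t: "t \<in> P c"
      then consider "\<forall>x\<in>E c. t \<le> x" | "\<forall>x\<in>E c. x \<le> t" by (auto simp: P_def not_less)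
      then show "t \<in> {Inf (E c), Sup (E c)}"
      proof cases
        case 1
        then have "Inf (E c) = t" using t by (intro cInf_eq_minimum) (auto simp: P_def)
        then show ?thesis by simp
      next
        case 2
        then have "Sup (E c) = t" using t by (intro cSup_eq_maximum) (auto simp: P_def)
        then show ?thesis by simp
      qed
    qed
    then show ?thesis by (rule countable_subset) simp
  qed
  have "negligible (\<Union>c\<in>Q. P c)"
    using countable_UN[OF Q countP] by (simp add: countable_imp_null_set_lborel negligible_iff_null_sets null_sets_completionI)
  then have neg: "negligible (Z \<union> (\<Union>c\<in>Q. P c))" using Z by (rule negligible_Un[rotated])
  have der: "(f has_real_derivative 0) (at t within {p..q})"
    if t: "t \<in> {p..q}" "t \<notin> Z \<union> (\<Union>c\<in>Q. P c)" for t
  proof -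
    have "f t \<in> Q" using val t by auto
    then have "t \<notin> P (f t)" using t by auto
    then obtain x y where xy: "x \<in> E (f t)" "y \<in> E (f t)" "x < t" "t < y"
      using t by (auto simp: P_def E_def)
    have const: "f z = f t" if "z \<in> {x..y}" for z
    proof (rule antisym)
      show "f z \<le> f t" using mono_onD[OF mono, of z y] xy that by (auto simp: E_def)
      show "f t \<le> f z" using mono_onD[OF mono, of x z] xy that by (auto simp: E_def)
    qed
    have "(f has_real_derivative 0) (at t)"
    proof (rule DERIV_cong_ev[THEN iffD2, OF refl _ refl])
      have "\<forall>\<^sub>F z in nhds t. z \<in> {x<..<y}" using xy by (intro eventually_nhds_in_open) auto
      then show "\<forall>\<^sub>F z in nhds t. f z = f t" by eventually_elim (use const in auto)
    qed (rule DERIV_const)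
    then show ?thesis by (rule has_field_derivative_at_within)
  qed
  have "AE t in lebesgue_on {p..q}. t \<notin> Z \<union> (\<Union>c\<in>Q. P c)"
  proof -
    have "AE t in lebesgue. t \<notin> Z \<union> (\<Union>c\<in>Q. P c)"
      by (rule AE_not_in) (use neg in \<open>simp add: negligible_iff_null_sets\<close>)
    then show ?thesis by (subst AE_restrict_space_iff) auto
  qed
  then have "AE t in lebesgue_on {p..q}. (f has_real_derivative 0) (at t within {p..q})"
    by (rule AE_mp) (use der in \<open>auto intro!: AE_I2\<close>)
  then show ?thesis using mono by (simp add: purely_singular_on_def)
qed

lemma summable_geometric_pair:
  fixes r r' :: real
  assumes "0 < r" "r < 1" "0 < r'" "r' < 1"
  shows "summable (\<lambda>k. A * (r ^ k + r' ^ k))"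
  using assms by (intro summable_mult summable_add summable_geometric) auto

text \<open>Here the string is reduced to two inequalities for a sequence. In the application v, r
  and v', r' are weight and length of the first and of the last segment.\<close>

lemma singular_of_asymptotic_selfsimilarity:
  fixes lam :: "nat \<Rightarrow> real" and m :: nat and s :: "real \<Rightarrow> real"
  defines "N \<equiv> \<lambda>l. card {n. lam n \<le> l}"
  assumes m: "m \<ge> 2" and tau: "0 < \<tau>" "\<tau> < 1"
    and mono: "mono lam" and fin: "\<And>l. finite {n. lam n \<le> l}"
    and lower: "\<And>n. lam (n div m) \<le> \<tau> * lam n"
    and A: "0 \<le> A"
    and r: "0 < r" "r < 1" "0 < r'" "r' < 1" "v * r = \<tau>" "v' * r' = \<tau>"
    and bound: "\<And>p M. M > 0 \<Longrightarrow> (\<Sum>n<m * M. \<tau> * lam n - lam (n div m))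
       \<le> A * ((1/v) ^ p + (1/v') ^ p + (r ^ p + r' ^ p) * lam (M - 1))"
    and nu: "\<nu> = - ln \<tau>" and D: "\<tau> powr (- D) = real m"
    and per: "\<And>t. s (t + \<nu>) = s t"
    and lim: "((\<lambda>l. real (N l) / l powr D - s (ln l)) \<longlongrightarrow> 0) at_top"
  shows "\<exists>\<sigma>. purely_singular_on {0..\<nu>} \<sigma> \<and> (\<forall>t\<in>{0..\<nu>}. s t = exp (- D * t) * \<sigma> t)"
proof -
  define F where "F x = x powr D * s (ln x)" for x
  \<comment> \<open>The range of x = exp t for t in [0, \<nu>] ends at exp \<nu> = 1 /
    \<tau>.\<close>
  define X where "X = 1 / \<tau>"
  have X1: "1 < X" using tau by (simp add: X_def)
  have m0: "real m > 0" using m by simp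
  have N_mono: "N x \<le> N y" if "x \<le> y" for x y
    unfolding N_def using that by (intro card_mono fin) auto
  \<comment> \<open>Monotonicity makes N and \<open>lam\<close> inverse to each other in the order
    sense, so identities for N become equivalences between inequalities for eigenvalues.\<close>
  have N_less: "j < N l \<longleftrightarrow> lam j \<le> l" for j l
  proof
    assume "lam j \<le> l"
    then have "{..j} \<subseteq> {n. lam n \<le> l}" using monoD[OF mono] by force
    then have "card {..j} \<le> N l" unfolding N_def by (intro card_mono fin)
    then show "j < N l" by simp
  next
    assume j: "j < N l"
    show "lam j \<le> l"
    proof (rule ccontr)
      assume "\<not> lam j \<le> l"
      then have "{n. lam n \<le> l} \<subseteq> {..<j}" using monoD[OF mono, of j] by (smt (verit, best) lessThan_iff mem_Collect_eq not_le subsetI)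
      then have "N l \<le> card {..<j}" unfolding N_def by (intro card_mono) auto
      then show False using j by simp
    qed
  qed
  have s_per: "s (t + real k * \<nu>) = s t" for t k
  proof (induction k)
    case (Suc k)
    then show ?case using per[of "t + real k * \<nu>"] by (simp add: algebra_simps)
  qed simp
  \<comment> \<open>Along l = x / \<tau>^k the argument of s moves by multiples of the period, and
    l^D = x^D m^k by the choice of D.\<close>
  have Flim: "(\<lambda>k. real (N (x / \<tau> ^ k)) / real m ^ k) \<longlonglongrightarrow> F x" if x: "0 < x" for x
  proof -
    have "filterlim (\<lambda>k. x * (1 / \<tau>) ^ k) at_top sequentially"
      using x tau by (intro filterlim_tendsto_pos_mult_at_top[OF tendsto_const]
          filterlim_at_infinity_imp_filterlim_at_top[OF filterlim_realpow_sequentially_gt1] always_eventually) auto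
    then have "filterlim (\<lambda>k. x / \<tau> ^ k) at_top sequentially" by (simp add: power_divide)
    from filterlim_compose[OF lim this]
    have "(\<lambda>k. real (N (x / \<tau> ^ k)) / (x / \<tau> ^ k) powr D - s (ln (x / \<tau> ^ k))) \<longlonglongrightarrow> 0" .
    moreover have "(x / \<tau> ^ k) powr D = x powr D * real m ^ k" for k
    proof -
      have "(\<tau> ^ k) powr D = (\<tau> powr D) ^ k" 
        using tau by (simp add: powr_realpow[of \<tau> k, symmetric] powr_powr powr_power[of \<tau> D k] mult.commute del: powr_realpow)
      moreover have "1 / \<tau> powr D = real m" using D by (simp add: powr_minus_divide)
      moreover have "(x / \<tau> ^ k) powr D = x powr D / (\<tau> ^ k) powr D" using x tau by (simp add: powr_divide)
      ultimately show ?thesis by (metis divide_inverse inverse_eq_divide power_inverse)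
    qed
    moreover have "s (ln (x / \<tau> ^ k)) = s (ln x)" for k
    proof -
      have "ln (x / \<tau> ^ k) = ln x + real k * \<nu>" using x tau by (simp add: ln_div ln_realpow nu)
      then show ?thesis by (simp only: s_per)
    qed
    ultimately have "(\<lambda>k. real (N (x / \<tau> ^ k)) / (x powr D * real m ^ k) - s (ln x)) \<longlonglongrightarrow> 0" by simp
    then have "(\<lambda>k. x powr D * (real (N (x / \<tau> ^ k)) / (x powr D * real m ^ k) - s (ln x) + s (ln x))) \<longlonglongrightarrow> x powr D * (0 + s (ln x))"
      by (intro tendsto_mult tendsto_const tendsto_add)
    then show ?thesis using x by (simp add: F_def)
  qed
  define M where "M k = N (X / \<tau> ^ k)" for k
  \<comment> \<open>For x <= X only indices below m M k can distinguish the two counts at level k,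
    so a finite union is enough.\<close>
  define B where "B k = (\<Union>n<m * M k. {\<tau> ^ k * lam (n div m) ..< \<tau> ^ Suc k * lam n})" for k
  have meas: "measure lborel (B k) \<le> A * (1 + X) * (r ^ k + r' ^ k)" for k
  proof -
    have le: "\<tau> ^ k * lam (n div m) \<le> \<tau> ^ Suc k * lam n" for n
      using lower[of n] tau by (simp add: mult.assoc mult.left_commute)
    have "measure lborel (B k) \<le> (\<Sum>n<m * M k. measure lborel {\<tau> ^ k * lam (n div m) ..< \<tau> ^ Suc k * lam n})"
      unfolding B_def by (intro measure_UNION_le) auto
    also have "\<dots> = \<tau> ^ k * (\<Sum>n<m * M k. \<tau> * lam n - lam (n div m))"
      using le by (simp add: sum_distrib_left algebra_simps)
    also have "\<dots> \<le> A * (1 + X) * (r ^ k + r' ^ k)"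
    proof (cases "M k = 0")
      case True
      then show ?thesis using True A r X1 by (simp add: add_nonneg_nonneg)
    next
      case False
      have "lam (M k - 1) \<le> X / \<tau> ^ k" using False N_less[THEN iffD1, of "M k - 1" "X / \<tau> ^ k"] by (simp add: M_def)
      then have "A * ((1/v) ^ k + (1/v') ^ k + (r ^ k + r' ^ k) * lam (M k - 1))
          \<le> A * ((1/v) ^ k + (1/v') ^ k + (r ^ k + r' ^ k) * (X / \<tau> ^ k))"
        using A r by (intro mult_left_mono add_left_mono) auto
      \<comment> \<open>The free exponent is taken to be k. After multiplication by \<tau>^k the
        first two terms become r^k and r'^k because v r = v' r' = \<tau>, and in the last one
        \<tau>^k cancels.\<close>
      then have "(\<Sum>n<m * M k. \<tau> * lam n - lam (n div m))
          \<le> A * ((1/v) ^ k + (1/v') ^ k + (r ^ k + r' ^ k) * (X / \<tau> ^ k))"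
        using bound[of "M k" k] False by simp
      then have "\<tau> ^ k * (\<Sum>n<m * M k. \<tau> * lam n - lam (n div m))
          \<le> \<tau> ^ k * (A * ((1/v) ^ k + (1/v') ^ k + (r ^ k + r' ^ k) * (X / \<tau> ^ k)))"
        using tau by (intro mult_left_mono) auto
      also have "\<dots> = A * (\<tau> ^ k * (1/v) ^ k + \<tau> ^ k * (1/v') ^ k + X * (r ^ k + r' ^ k))"
      proof -
        have "t * (A * (x + y + z * (X / t))) = A * (t * x + t * y + X * z)" if "t \<noteq> 0" for t x y z :: real
          using that by (simp add: field_simps)
        then show ?thesis using tau by simp
      qed
      also have "\<tau> ^ k * (1/v) ^ k = r ^ k"
      proof -
        have "\<tau> * (1/v) = r" using r tau by (auto simp: field_simps)
        then show ?thesis by (metis power_mult_distrib)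
      qed
      also have "\<tau> ^ k * (1/v') ^ k = r' ^ k"
      proof -
        have "\<tau> * (1/v') = r'" using r(6) tau by (auto simp: field_simps)
        then show ?thesis by (metis power_mult_distrib)
      qed
      finally show ?thesis by (simp add: algebra_simps)
    qed
    finally show ?thesis .
  qed
  have "AE x in lborel. \<forall>\<^sub>F k in sequentially. x \<in> space lborel - B k"
  proof (rule borel_cantelli_AE1)
    show "B k \<in> sets lborel" for k by (auto simp: B_def)
    show "emeasure lborel (B k) < \<infinity>" for k
    proof -
      have "bounded (B k)" unfolding B_def by (intro bounded_UN) auto
      then show ?thesis by (rule emeasure_bounded_finite)
    qed
    show "summable (\<lambda>k. measure lborel (B k))"
      by (rule summable_comparison_test[OF _ summable_geometric_pair[OF r(1-4), of "A * (1 + X)"]])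
        (use meas in auto)
  qed
  then obtain Z where Z: "Z \<in> null_sets lborel" "\<And>x. x \<notin> Z \<Longrightarrow> \<forall>\<^sub>F k in sequentially. x \<notin> B k"
    by (auto elim!: AE_E3)
  have NB: "N (x / \<tau> ^ Suc k) = m * N (x / \<tau> ^ k)" if x: "0 < x" "x \<le> X" "x \<notin> B k" for x k
  proof -
    have "n < N (x / \<tau> ^ Suc k) \<longleftrightarrow> n < m * N (x / \<tau> ^ k)" for n
    proof -
      have "lam n \<le> x / \<tau> ^ Suc k \<longleftrightarrow> lam (n div m) \<le> x / \<tau> ^ k"
      proof
        assume "lam n \<le> x / \<tau> ^ Suc k"
        then have "\<tau> * lam n \<le> x / \<tau> ^ k" using tau by (simp add: field_simps)
        then show "lam (n div m) \<le> x / \<tau> ^ k" using lower[of n] by simp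
      next
        assume a: "lam (n div m) \<le> x / \<tau> ^ k"
        also have "\<dots> \<le> X / \<tau> ^ k" using x tau by (simp add: divide_right_mono)
        \<comment> \<open>The restriction x <= X puts n among the indices used in
          \<open>B k\<close>; as x avoids the n-th interval, the second inequality follows from the
          first.\<close>
        finally have "n div m < M k" using N_less by (simp add: M_def)
        then have "n < m * M k" using m by (simp add: less_mult_imp_div_less div_less_iff_less_mult mult.commute)
        then have "\<not> (\<tau> ^ k * lam (n div m) \<le> x \<and> x < \<tau> ^ Suc k * lam n)"
          using x(3) by (auto simp: B_def)
        then show "lam n \<le> x / \<tau> ^ Suc k" using a tau by (auto simp: field_simps)
      qed
      moreover have "n div m < N (x / \<tau> ^ k) \<longleftrightarrow> n < m * N (x / \<tau> ^ k)"
        using m by (simp add: div_less_iff_less_mult mult.commute)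
      ultimately show ?thesis using N_less by metis
    qed
    then show ?thesis by (metis linorder_neqE_nat less_irrefl)
  qed
  define Q where "Q = range (\<lambda>(n::nat, k::nat). real n / real m ^ k)"
  have FQ: "F x \<in> Q" if x: "0 < x" "x \<le> X" "x \<notin> Z" for x
  proof -
    obtain K where K: "\<And>k. k \<ge> K \<Longrightarrow> x \<notin> B k" using Z(2)[OF x(3)] by (auto simp: eventually_sequentially)
    have const: "real (N (x / \<tau> ^ (K + k))) / real m ^ (K + k) = real (N (x / \<tau> ^ K)) / real m ^ K" for k
    proof (induction k)
      case (Suc k)
      show ?case using NB[OF x(1,2) K, of "K + k"] Suc m0 by (simp add: field_simps)
    qed simp
    have "(\<lambda>k. real (N (x / \<tau> ^ (K + k))) / real m ^ (K + k)) \<longlonglongrightarrow> F x"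
      using LIMSEQ_ignore_initial_segment[OF Flim[OF x(1)], of K] by (simp add: add.commute)
    then have "F x = real (N (x / \<tau> ^ K)) / real m ^ K"
      unfolding const using LIMSEQ_unique tendsto_const by blast
    then show ?thesis by (auto simp: Q_def intro!: range_eqI[of _ _ "(N (x / \<tau> ^ K), K)"])
  qed
  define \<sigma> where "\<sigma> t = F (exp t)" for t
  have expX: "exp t \<le> X" if "t \<le> \<nu>" for t
  proof -
    have "exp t \<le> exp \<nu>" using that by simp
    then show ?thesis using tau by (simp add: nu X_def exp_minus divide_inverse)
  qed
  have "purely_singular_on {0..\<nu>} \<sigma>"
  proof (rule purely_singular_if_countable_values)
    have "F x \<le> F y" if "0 < x" "x \<le> y" for x y
    proof (rule LIMSEQ_le[OF Flim Flim])
      show "\<exists>K. \<forall>k\<ge>K. real (N (x / \<tau> ^ k)) / real m ^ k \<le> real (N (y / \<tau> ^ k)) / real m ^ k"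
        using that tau N_mono by (intro exI allI impI divide_right_mono) (auto simp: divide_right_mono)
    qed (use that in auto)
    then show "mono_on {0..\<nu>} \<sigma>" by (auto simp: mono_on_def \<sigma>_def)
    show "countable Q" by (simp add: Q_def)
    \<comment> \<open>The exceptional set is null in the variable x; the differentiable map ln
      carries this over to t = ln x.\<close>
    have "negligible (ln ` (Z \<inter> {0<..}))"
    proof (rule negligible_differentiable_image_negligible)
      have "negligible Z" using Z(1) by (meson negligible_iff_null_sets null_sets_completionI)
      then show "negligible (Z \<inter> {0<..})" by (rule negligible_subset) auto
      show "(ln :: real \<Rightarrow> real) differentiable_on (Z \<inter> {0<..})"
        unfolding differentiable_on_def real_differentiable_def
        by (blast intro: has_field_derivative_at_within[OF DERIV_ln])
    qed simp
    then show "negligible (ln ` (Z \<inter> {0<..}))" .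
    show "\<sigma> t \<in> Q" if "t \<in> {0..\<nu>} - ln ` (Z \<inter> {0<..})" for t
    proof -
      have "exp t \<notin> Z"
      proof
        assume "exp t \<in> Z"
        then have "ln (exp t) \<in> ln ` (Z \<inter> {0<..})" by (intro imageI) auto
        then show False using that by simp
      qed
      then show ?thesis unfolding \<sigma>_def using that expX by (intro FQ) auto
    qed
  qed
  moreover have "s t = exp (- D * t) * \<sigma> t" for t
    by (simp add: \<sigma>_def F_def powr_def flip: exp_add mult.assoc)
  ultimately show ?thesis by blast
qed

section \<open>Application to the Cantor string\<close>

theorem theorem1:
  fixes m :: nat
    and a b w :: "nat \<Rightarrow> real"
    and \<tau> \<nu> D :: real
    and C :: "real \<Rightarrow> real"
    and \<rho> :: "real measure"
    and s :: "real \<Rightarrow> real"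
  assumes "m \<ge> 2"
    and "\<And>k. k \<in> {1..m} \<Longrightarrow> a k < b k"
    and "\<And>k. k \<in> {1..m} \<Longrightarrow> {a k..b k} \<subseteq> {0..1}"
    and "a 1 = 0"
    and "b m = 1"
    and "\<And>k. k \<in> {2..m} \<Longrightarrow> b (k - 1) < a k"
    and "\<And>k. k \<in> {1..m} \<Longrightarrow> w k > 0"
    and "(\<Sum>k = 1..m. w k) = 1"
    and "\<And>k. k \<in> {1..m} \<Longrightarrow> w k * (b k - a k) = \<tau>"
    and "cantor_ladder m a b w C"
    and "prob_space \<rho>"
    and "sets \<rho> = sets (restrict_space borel {0..1})"
    and "distributional_derivative C \<rho>"
    and "\<nu> = - ln \<tau>"
    and "\<tau> powr (- D) = real m"
    and "continuous_on UNIV s"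
    and "\<And>t. s (t + \<nu>) = s t"
    and "((\<lambda>l. real (counting_function \<rho> l) / l powr D - s (ln l)) \<longlongrightarrow> 0) at_top"
  shows "\<exists>\<sigma>. purely_singular_on {0..\<nu>} \<sigma> \<and> (\<forall>t\<in>{0..\<nu>}. s t = exp (- D * t) * \<sigma> t)"
proof -
  interpret cantor_string m a b w \<tau> C \<rho>
    by (rule cantor_string.intro) (fact assms)+
  from spectral_sequence_exists obtain u u' :: "nat \<Rightarrow> real \<Rightarrow> real" and lam
    where spec: "\<forall>n. ac_on 0 1 (u n) (u' n) \<and> ip (u n) (u n) = 1 \<and>
     (\<forall>i<n. ip (u n) (u i) = 0) \<and> (\<forall>x. u' n x = - lam n * tail (u n) x) \<and>
     (\<forall>\<eta> \<eta>'. ac_on 0 1 \<eta> \<eta>' \<longrightarrow> energy (u' n) \<eta>' = lam n * ip (u n) \<eta>) \<and>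
     (\<forall>h h'. ac_on 0 1 h h' \<longrightarrow> (\<forall>i<n. ip h (u i) = 0) \<longrightarrow> lam n * ip h h \<le> energy h' h')"
    by (elim exE)
  interpret spectral_string m a b w \<tau> C \<rho> u u' lam
    by (rule spectral_string.intro[OF cantor_string_axioms spectral_string_axioms.intro])
      (use spec in blast)+
  have two: "2 \<in> {1..m}" using assms(1) by simp
  \<comment> \<open>Since m >= 2, both the first and the last segment leave room for another one, so
    their lengths are below 1 and the geometric series converge.\<close>
  have r1: "r 1 < 1"
    using b_less_a[of 1 2] a_less_b[OF two] b_le_1[OF two] a_1 assms(1) by (simp add: r_def)
  have rm: "r m < 1"
    using b_less_a[of 1 m] a_less_b[OF in_1m(1)] a_1 b_m assms(1) by (simp add: r_def)
  have r0: "0 < r 1" "0 < r m" using r_pos in_1m by auto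
  have tau1: "\<tau> < 1" using tau_le_w[OF in_1m(1)] w_less_1[OF in_1m(1)] by simp
  show ?thesis
  proof (rule singular_of_asymptotic_selfsimilarity[where lam = lam and m = m and \<tau> = \<tau>
        and r = "r 1" and r' = "r m" and v = "w 1" and v' = "w m" and A = "2 * real m / gp"])
    show "mono lam" using E.lam_mono by (simp add: mono_def)
    show "finite {n. lam n \<le> l}" for l by (rule finite_lam_le)
    show "lam (n div m) \<le> \<tau> * lam n" for n by (rule lam_div)
    show "w 1 * r 1 = \<tau>" "w m * r m = \<tau>" using w_tau in_1m by (simp_all only: r_def)
    show "0 \<le> 2 * real m / gp" using gp(1) by simp
    show "(\<Sum>n<m * M. \<tau> * lam n - lam (n div m))
       \<le> 2 * real m / gp * ((1 / w 1) ^ p + (1 / w m) ^ p + (r 1 ^ p + r m ^ p) * lam (M - 1))" for p M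
      by (rule gap_sum_bound)
    show "((\<lambda>l. real (card {n. lam n \<le> l}) / l powr D - s (ln l)) \<longlongrightarrow> 0) at_top"
      using assms(18) by (simp add: counting_function_eq)
  qed (use assms r0 r1 rm tau_pos tau1 in simp_all)
qed

end
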